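(* Let $d\ge 2$ and let $T\subsetneq S^dU$ be a proper linear subspace. Let $S=S_T\subseteq T$ be the smallest linear subspace such that $\mathbb{P}(S)$ contains the schematic intersection $\mathbb{P}(T)\cap C_d$ as a subscheme, and put $a=\dim S-1$ (so $a=-1$ if $\mathbb{P}(T)\cap C_d=\emptyset$). Then $\dim\partial S=\dim S$. Moreover, setting $r=\dim\partial T-\dim T$, one has $r\ge 0$, and exactly as follows: either $r=0$, and in this case $T=S$; or $r\ge 1$, and there exist integers $b_1,\dots,b_r\geq 0$ and forms $f_1,\dots,f_r$, with $[f_i]\in\mathbb{P}(S^{d+b_i}U)\setminus \mathrm{Sec}^{b_i}C_{d+b_i}$ for $i=1,\dots,r$, such that $T$ and $\partial T$ are the direct sums $$T=S\oplus\partial^{b_1}(f_1)\oplus\cdots\oplus\partial^{b_r}(f_r),$$ $$\partial T=\partial S\oplus\partial^{b_1+1}(f_1)\oplus\cdots\oplus\partial^{b_r+1}(f_r).$$ The $(r+1)$-tuple $(a,b_1,\dots,b_r)$, ordered so that $b_1\ge\cdots\ge b_r$, is uniquely determined by $T$. Finally, given integers $r\ge 0$ and $a,b_1\ge\cdots\ge b_r$, a proper subspace $T\subsetneq S^dU$ with associated tuple $(a,b_1,\dots,b_r)$ exists if and only if $a\ge -1$, $b_i\ge 0$ for all $i=1,\dots,r$, and $a+1+\sum_{i=1}^r(b_i+2)\le d$.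
   Context: $U\cong\mathbb{C}^2$ is a complex vector space with basis $x,y$; $S^nU$ is its $n$-th symmetric power, identified with binary forms of degree $n$ in $x,y$; $\mathbb{P}(V)$ is the space of one-dimensional subspaces of $V$, and $[v]\in\mathbb{P}(V)$ is the point of $v\neq0$. $C_n\subset\mathbb{P}(S^nU)\cong\mathbb{P}^n$ is the rational normal curve $\{[p^n] : [p]\in\mathbb{P}(U)\}$, image of the Veronese embedding. For $m\ge1$, $\mathrm{Sec}^{m-1}C_n\subseteq\mathbb{P}(S^nU)$ is the closure of the set of points $[p_1^n+\cdots+p_m^n]$ with $[p_1],\dots,[p_m]$ distinct (so $\mathrm{Sec}^0C_n=C_n$). $U^*=\langle\partial_x,\partial_y\rangle$ acts on forms by derivation, and for a subspace $T\subseteq S^nU$ one sets $\partial T=\sum_{D\in U^*}D(T)=\partial_xT+\partial_yT\subseteq S^{n-1}U$. For $m\ge0$ and $g\in S^{n+m}U$, $\partial^m(g)=\langle\partial_x^mg,\partial_x^{m-1}\partial_yg,\dots,\partial_y^mg\rangle\subseteq S^nU$. Thus above $\partial^{b_i}(f_i)\subseteq S^dU$ and $\partial^{b_i+1}(f_i)\subseteq S^{d-1}U$. *)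

theory Defs
  imports Complex_Main "HOL-Computational_Algebra.Polynomial"
begin

text \<open>
  The polynomial ring in x and y over the complex numbers is \<open>complex poly poly\<close>, with
  y as the outer and x as the inner variable: the coefficient of \<open>x^i y^j\<close> in \<open>f\<close>
  is \<open>coeff (coeff f j) i\<close>.
\<close>

type_synonym bipoly = "complex poly poly"

definition scale :: "complex \<Rightarrow> bipoly \<Rightarrow> bipoly" where
  "scale c f = smult [:c:] f"

global_interpretation cvec: vector_space scale
  by unfold_locales
    (simp_all add: scale_def smult_add_right smult_add_left[symmetric] mult.commute
      flip: one_pCons)

text \<open>\<open>binary_forms n\<close> is \<open>S^n U\<close>; in particular \<open>binary_forms 1\<close> is \<open>U\<close> itself.\<close>

definition binary_forms :: "nat \<Rightarrow> bipoly set" where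
  "binary_forms n = {f. \<forall>i j. coeff (coeff f j) i \<noteq> 0 \<longrightarrow> i + j = n}"

definition deriv_x :: "bipoly \<Rightarrow> bipoly" where
  "deriv_x f = map_poly pderiv f"

definition deriv_y :: "bipoly \<Rightarrow> bipoly" where
  "deriv_y f = pderiv f"

definition deriv_space :: "bipoly set \<Rightarrow> bipoly set" where
  "deriv_space T = {deriv_x f + deriv_y g |f g. f \<in> T \<and> g \<in> T}"

definition polar_space :: "nat \<Rightarrow> bipoly \<Rightarrow> bipoly set" where
  "polar_space m g = cvec.span {(deriv_x ^^ (m - i)) ((deriv_y ^^ i) g) |i. i \<le> m}"

text \<open>
  \<open>W\<close> is the internal direct sum of the listed subspaces: every element of \<open>W\<close> is the sum
  of a unique choice of one vector from each of them, and all such sums lie in \<open>W\<close>.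
\<close>

definition is_direct_sum :: "bipoly set \<Rightarrow> bipoly set list \<Rightarrow> bool" where
  "is_direct_sum W Vs \<longleftrightarrow> bij_betw sum_list (listset Vs) W"

definition proj_space :: "bipoly set \<Rightarrow> bipoly set set" where
  "proj_space V = {L. cvec.subspace L \<and> L \<subseteq> V \<and> cvec.dim L = 1}"

definition proj_point :: "bipoly \<Rightarrow> bipoly set" where
  "proj_point v = cvec.span {v}"

text \<open>
  The homogeneous coordinate ring of \<open>P(S^n U)\<close>. As the complex field is infinite,
  polynomials in the coefficients of a form of degree \<open>n\<close> are the same as polynomial functions.
  Only coefficients of monomials of degree \<open>n\<close> are used, so that such a function is
  determined by its restriction to \<open>S^n U\<close>; likewise homogeneity is expressed on functions.
\<close>

inductive_set coord_ring :: "nat \<Rightarrow> (bipoly \<Rightarrow> complex) set" for n :: nat where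
  const: "(\<lambda>_. c) \<in> coord_ring n"
| coord: "i + j = n \<Longrightarrow> (\<lambda>f. coeff (coeff f j) i) \<in> coord_ring n"
| add: "F \<in> coord_ring n \<Longrightarrow> G \<in> coord_ring n \<Longrightarrow> (\<lambda>f. F f + G f) \<in> coord_ring n"
| mult: "F \<in> coord_ring n \<Longrightarrow> G \<in> coord_ring n \<Longrightarrow> (\<lambda>f. F f * G f) \<in> coord_ring n"

definition homogeneous :: "nat \<Rightarrow> nat \<Rightarrow> (bipoly \<Rightarrow> complex) set" where
  "homogeneous n k = {F \<in> coord_ring n. \<forall>c f. F (scale c f) = c ^ k * F f}"

definition zariski_closure :: "nat \<Rightarrow> bipoly set set \<Rightarrow> bipoly set set" where
  "zariski_closure n X = {L \<in> proj_space (binary_forms n).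
     \<forall>k. \<forall>F \<in> homogeneous n k.
       (\<forall>M\<in>X. \<forall>v\<in>M. F v = 0) \<longrightarrow> (\<forall>v\<in>L. F v = 0)}"

definition rational_normal_curve :: "nat \<Rightarrow> bipoly set set" where
  "rational_normal_curve n =
     {proj_point (p ^ n) |p. proj_point p \<in> proj_space (binary_forms 1)}"

text \<open>
  \<open>secant_variety k n\<close> is \<open>Sec^k C_n\<close>, the closure of the set of points
  spanned by sums of \<open>k + 1\<close> powers (not \<open>k\<close>). A sum that vanishes defines no point.
\<close>

definition secant_variety :: "nat \<Rightarrow> nat \<Rightarrow> bipoly set set" where
  "secant_variety k n = zariski_closure n
     {proj_point (\<Sum>i\<le>k. p i ^ n) |p.
        (\<forall>i\<le>k. proj_point (p i) \<in> proj_space (binary_forms 1)) \<and>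
        inj_on (\<lambda>i. proj_point (p i)) {..k} \<and> (\<Sum>i\<le>k. p i ^ n) \<noteq> 0}"

text \<open>
  A closed subscheme of \<open>P(S^n U)\<close> is given by a homogeneous ideal of the coordinate ring;
  two ideals give the same subscheme iff their saturations agree. The reduced subscheme on a
  closed set of points is given by its vanishing ideal, and the schematic intersection of two
  closed subschemes by the sum of their ideals. Saturation is with respect to the irrelevant
  ideal, whose N-th power is generated by the homogeneous elements of degree \<open>N\<close>.
\<close>

definition vanishing_ideal :: "nat \<Rightarrow> bipoly set set \<Rightarrow> (bipoly \<Rightarrow> complex) set" where
  "vanishing_ideal n X = {F \<in> coord_ring n. \<forall>L\<in>X. \<forall>v\<in>L. F v = 0}"

definition ideal_plus ::
  "(bipoly \<Rightarrow> complex) set \<Rightarrow> (bipoly \<Rightarrow> complex) set \<Rightarrow> (bipoly \<Rightarrow> complex) set" where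
  "ideal_plus I J = {(\<lambda>f. F f + G f) |F G. F \<in> I \<and> G \<in> J}"

definition saturation :: "nat \<Rightarrow> (bipoly \<Rightarrow> complex) set \<Rightarrow> (bipoly \<Rightarrow> complex) set" where
  "saturation n I = {F \<in> coord_ring n. \<exists>N. \<forall>G \<in> homogeneous n N. (\<lambda>f. F f * G f) \<in> I}"

text \<open>The subscheme defined by \<open>I\<close> is contained in the one defined by \<open>J\<close>.\<close>

definition is_subscheme ::
  "nat \<Rightarrow> (bipoly \<Rightarrow> complex) set \<Rightarrow> (bipoly \<Rightarrow> complex) set \<Rightarrow> bool" where
  "is_subscheme n I J \<longleftrightarrow> saturation n J \<subseteq> saturation n I"

definition curve_section_ideal :: "nat \<Rightarrow> bipoly set \<Rightarrow> (bipoly \<Rightarrow> complex) set" where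
  "curve_section_ideal d T =
     ideal_plus (vanishing_ideal d (proj_space T)) (vanishing_ideal d (rational_normal_curve d))"

definition contains_curve_section :: "nat \<Rightarrow> bipoly set \<Rightarrow> bipoly set \<Rightarrow> bool" where
  "contains_curve_section d T S \<longleftrightarrow> cvec.subspace S \<and> S \<subseteq> binary_forms d \<and>
     is_subscheme d (curve_section_ideal d T) (vanishing_ideal d (proj_space S))"

text \<open>The subspace \<open>S_T\<close>; the order on sets is inclusion.\<close>

definition section_span :: "nat \<Rightarrow> bipoly set \<Rightarrow> bipoly set" where
  "section_span d T = (LEAST S. contains_curve_section d T S)"

definition defect :: "bipoly set \<Rightarrow> int" where
  "defect T = int (cvec.dim (deriv_space T)) - int (cvec.dim T)"

definition decomposes :: "nat \<Rightarrow> bipoly set \<Rightarrow> nat list \<Rightarrow> bipoly list \<Rightarrow> bool" where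
  "decomposes d T bs fs \<longleftrightarrow>
     length fs = length bs \<and>
     (\<forall>i < length bs. proj_point (fs ! i) \<in>
        proj_space (binary_forms (d + bs ! i)) - secant_variety (bs ! i) (d + bs ! i)) \<and>
     is_direct_sum T (section_span d T # map2 (\<lambda>b f. polar_space b f) bs fs) \<and>
     is_direct_sum (deriv_space T)
       (deriv_space (section_span d T) # map2 (\<lambda>b f. polar_space (b + 1) f) bs fs)"

text \<open>
  The tuple \<open>(a, b_1, ..., b_r)\<close> is encoded as \<open>(a, [b_1, ..., b_r])\<close>, with integer entries
  because \<open>a\<close> may be \<open>-1\<close>. For \<open>r = 0\<close> the decomposition just says \<open>T = S_T\<close>.
\<close>

definition has_tuple :: "nat \<Rightarrow> bipoly set \<Rightarrow> int \<times> int list \<Rightarrow> bool" where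
  "has_tuple d T t \<longleftrightarrow> (case t of (a, bs) \<Rightarrow>
     a = int (cvec.dim (section_span d T)) - 1 \<and>
     int (length bs) = defect T \<and>
     sorted_wrt (\<ge>) bs \<and>
     (\<exists>ns fs. bs = map int ns \<and> decomposes d T ns fs))"

end

theory Submission
  imports Defs "HOL-Library.Multiset" "Jordan_Normal_Form.Determinant"
begin

text \<open>
  The two derivations \<open>dx, dy\<close> from \<open>T\<close> to its derivative space form a pencil of linear maps, and the theorem is a classification
  of such pencils in the spirit of Kronecker, or of Grothendieck's splitting of sheaves on the projective line into a torsion
  part and line bundles. The proof is organised by the prolongations \<open>prolong d T j\<close>, the forms of degree \<open>d + j\<close>
  whose derivatives of order \<open>j\<close> are all in \<open>T\<close>. Differentiation lowers \<open>j\<close>, so they form a graded module over the polynomial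
  ring in two derivations.
  
  As \<open>T\<close> is proper, some derivation \<open>u = dx + c dy\<close> is injective on \<open>T\<close> and on all prolongations (\<open>transversal_exists\<close>). The
  dimensions therefore decrease with \<open>j\<close> and stabilise, and the elements of \<open>T\<close> that are divisible by all powers of \<open>u\<close>
  form a subspace, the core. On it \<open>u\<close> alone produces all derivatives, which gives the equality of the two dimensions for the core.
  
  The core is \<open>S_T\<close> (\<open>section_span_eq_core\<close>). Restricted to the curve, a homogeneous function of degree \<open>k\<close> is a form of degree
  \<open>d k\<close> in two variables, and such a form acts as a differential operator. Under this apolarity the ideal of the
  curve section annihilates exactly the prolongations of \<open>T\<close> in large degree (\<open>vanishing_ideal_pairing\<close>,
  \<open>form_kills_prolong_restricts_to\<close>). So containing the curve section means containing the high derivatives of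
  the high prolongations of \<open>T\<close>, and the smallest subspace with this property is the core.
  
  The \<open>f_i\<close> are minimal generators of the module of prolongations modulo those of the core, and \<open>b_i\<close> is the order of the
  prolongation in which \<open>f_i\<close> appears. That they generate freely is seen by reducing a relation modulo \<open>u\<close> and integrating the
  syzygy that remains (\<open>extend_generators\<close>). Freeness in order \<open>b_i + 1\<close> says that a maximal minor of a matrix of derivatives
  does not vanish at \<open>f_i\<close>, while it vanishes on sums of \<open>b_i + 1\<close> powers (\<open>not_in_secant_variety\<close>).
  
  Conversely, any decomposition as in the theorem consists of free generators, because the derivative of a polar space gains at most
  one dimension and the total gain is the number of summands (\<open>generators_if_direct_sum\<close>). Freeness propagates the
  decomposition to all prolongations (\<open>spans_mod_Suc\<close>), whose dimensions then determine the \<open>b_i\<close>. The inequality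
  bounds the dimension of the derivative space by \<open>d\<close>, and every tuple that satisfies it is realised by sums of
  powers of distinct linear forms (\<open>prescribed_generators_exist\<close>).
\<close>

global_interpretation endo: vector_space_pair scale scale
  by unfold_locales

lemma vector_space_complex: "vector_space ((*) :: complex \<Rightarrow> complex \<Rightarrow> complex)"
  by unfold_locales (simp_all add: algebra_simps)

section \<open>Coefficients and derivatives\<close>

definition cf :: "nat \<Rightarrow> nat \<Rightarrow> bipoly \<Rightarrow> complex" where
  "cf i j f = coeff (coeff f j) i"

definition xy_mono :: "nat \<Rightarrow> nat \<Rightarrow> bipoly" where
  "xy_mono i j = monom (monom 1 i) j"

lemma bipoly_eqI: "(\<And>i j. cf i j f = cf i j g) \<Longrightarrow> f = g"
  by (simp add: cf_def poly_eq_iff)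

lemma cf_0 [simp]: "cf i j 0 = 0"
  and cf_add [simp]: "cf i j (f + g) = cf i j f + cf i j g"
  and cf_diff [simp]: "cf i j (f - g) = cf i j f - cf i j g"
  and cf_scale [simp]: "cf i j (scale c f) = c * cf i j f"
  by (simp_all add: cf_def scale_def)

lemma cf_sum [simp]: "cf i j (sum F A) = (\<Sum>a\<in>A. cf i j (F a))"
  by (simp add: cf_def coeff_sum)

lemma cf_xy_mono [simp]: "cf i j (xy_mono k l) = (if i = k \<and> j = l then 1 else 0)"
  by (auto simp: cf_def xy_mono_def)

lemma cf_deriv_x [simp]: "cf i j (deriv_x f) = of_nat (Suc i) * cf (Suc i) j f"
  by (simp add: cf_def deriv_x_def coeff_map_poly coeff_pderiv)

lemma cf_deriv_y [simp]: "cf i j (deriv_y f) = of_nat (Suc j) * cf i (Suc j) f"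
proof -
  have "coeff (of_nat n * p) i = of_nat n * coeff p i" for n and p :: "complex poly"
    by (simp add: of_nat_poly)
  then show ?thesis
    by (simp add: cf_def deriv_y_def coeff_pderiv del: of_nat_Suc)
qed

lemma deriv_x_add [simp]: "deriv_x (f + g) = deriv_x f + deriv_x g"
  and deriv_x_scale [simp]: "deriv_x (scale c f) = scale c (deriv_x f)"
  and deriv_y_add [simp]: "deriv_y (f + g) = deriv_y f + deriv_y g"
  and deriv_y_scale [simp]: "deriv_y (scale c f) = scale c (deriv_y f)"
  by (rule bipoly_eqI; simp add: algebra_simps)+

lemma deriv_xy_commute: "deriv_x (deriv_y f) = deriv_y (deriv_x f)"
  by (rule bipoly_eqI) (simp add: algebra_simps)

lemma linear_iff_cvec:
  "Vector_Spaces.linear scale scale h \<longleftrightarrow> (\<forall>x y. h (x + y) = h x + h y) \<and> (\<forall>c x. h (scale c x) = scale c (h x))"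
  by (simp add: Vector_Spaces.linear_iff cvec.vector_space_axioms)

lemma linear_functional_iff:
  "Vector_Spaces.linear scale ((*) :: complex \<Rightarrow> complex \<Rightarrow> complex) h \<longleftrightarrow>
    (\<forall>x y. h (x + y) = h x + h y) \<and> (\<forall>c x. h (scale c x) = c * h x)"
  by (simp add: Vector_Spaces.linear_iff cvec.vector_space_axioms vector_space_complex)

lemma linear_deriv_x: "Vector_Spaces.linear scale scale deriv_x"
  and linear_deriv_y: "Vector_Spaces.linear scale scale deriv_y"
  by (simp_all add: linear_iff_cvec)

text \<open>
  The derivation \<open>dx + c dy\<close>. It completes \<open>dy\<close> to a basis of the space of constant
  derivations; the constant will be chosen so that this derivation is injective on \<open>T\<close>.
\<close>

definition dder :: "complex \<Rightarrow> bipoly \<Rightarrow> bipoly" where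
  "dder c f = deriv_x f + scale c (deriv_y f)"

lemma linear_dder: "Vector_Spaces.linear scale scale (dder c)"
  by (simp add: linear_iff_cvec dder_def algebra_simps cvec.scale_right_distrib cvec.scale_left_commute)

lemmas deriv_x_simps [simp] =
  endo.linear_0[OF linear_deriv_x] endo.linear_neg[OF linear_deriv_x]
  endo.linear_diff[OF linear_deriv_x] endo.linear_sum[OF linear_deriv_x]
lemmas deriv_y_simps [simp] =
  endo.linear_0[OF linear_deriv_y] endo.linear_neg[OF linear_deriv_y]
  endo.linear_diff[OF linear_deriv_y] endo.linear_sum[OF linear_deriv_y]
lemmas dder_simps [simp] =
  endo.linear_0[OF linear_dder] endo.linear_neg[OF linear_dder] endo.linear_add[OF linear_dder]
  endo.linear_scale[OF linear_dder]
  endo.linear_diff[OF linear_dder] endo.linear_sum[OF linear_dder]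

lemma dder_deriv_y: "dder c (deriv_y f) = deriv_y (dder c f)"
  and dder_deriv_x: "dder c (deriv_x f) = deriv_x (dder c f)"
  by (simp_all add: dder_def deriv_xy_commute)

lemma deriv_x_eq_dder: "deriv_x f = dder c f - scale c (deriv_y f)"
  by (simp add: dder_def)

section \<open>Binary forms\<close>

lemma binary_forms_iff: "f \<in> binary_forms n \<longleftrightarrow> (\<forall>i j. i + j \<noteq> n \<longrightarrow> cf i j f = 0)"
  by (auto simp: binary_forms_def cf_def)

lemma subspace_binary_forms [simp]: "cvec.subspace (binary_forms n)"
  by (rule cvec.subspaceI) (auto simp: binary_forms_iff)

lemma xy_mono_in_binary_forms: "i + j = n \<Longrightarrow> xy_mono i j \<in> binary_forms n"
  by (auto simp: binary_forms_iff)

lemma deriv_in_binary_forms: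
  assumes "f \<in> binary_forms (Suc n)"
  shows "deriv_x f \<in> binary_forms n" "deriv_y f \<in> binary_forms n" "dder c f \<in> binary_forms n"
proof -
  show x: "deriv_x f \<in> binary_forms n" and y: "deriv_y f \<in> binary_forms n"
    using assms by (auto simp: binary_forms_iff)
  then show "dder c f \<in> binary_forms n"
    unfolding dder_def by (intro cvec.subspace_add cvec.subspace_scale subspace_binary_forms)
qed

definition hom_part :: "nat \<Rightarrow> bipoly \<Rightarrow> bipoly" where
  "hom_part n f = (\<Sum>j\<le>n. scale (cf (n - j) j f) (xy_mono (n - j) j))"

lemma cf_hom_part: "cf i j (hom_part n f) = (if i + j = n then cf i j f else 0)"
proof -
  have "cf i j (hom_part n f) = (\<Sum>k\<le>n. if k = j then (if i = n - k then cf i j f else 0) else 0)"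
    unfolding hom_part_def cf_sum by (rule sum.cong) auto
  then show ?thesis
    by (auto simp: sum.delta)
qed

lemma hom_part_id: "f \<in> binary_forms n \<Longrightarrow> hom_part n f = f"
  by (rule bipoly_eqI) (auto simp: binary_forms_iff cf_hom_part)

lemma hom_part_other: "f \<in> binary_forms k \<Longrightarrow> k \<noteq> n \<Longrightarrow> hom_part n f = 0"
  by (rule bipoly_eqI) (auto simp: binary_forms_iff cf_hom_part)

lemma hom_part_add [simp]: "hom_part n (f + g) = hom_part n f + hom_part n g"
  and hom_part_scale [simp]: "hom_part n (scale c f) = scale c (hom_part n f)"
  and hom_part_0 [simp]: "hom_part n 0 = 0"
  by (rule bipoly_eqI; simp add: cf_hom_part)+

lemma one_plus_of_nat_neq_0 [simp]: "1 + complex_of_nat n \<noteq> 0"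
  using of_nat_neq_0[of n, where 'a = complex] by simp

lemma constant_if_derivs_0:
  assumes "f \<in> binary_forms (Suc n)" "deriv_x f = 0" "deriv_y f = 0"
  shows "f = 0"
proof (rule bipoly_eqI)
  fix i j
  have x: "cf i j (deriv_x f) = 0" and y: "cf i j (deriv_y f) = 0" for i j
    using assms by simp_all
  show "cf i j f = cf i j 0"
  proof (cases i)
    case 0
    then show ?thesis
      using assms(1) y[of i "j - 1"] by (cases j) (auto simp: binary_forms_iff)
  next
    case (Suc k)
    then show ?thesis using x[of k j] by (auto)
  qed
qed

lemma eq_if_dder_deriv_y_eq:
  assumes "f \<in> binary_forms (Suc n)" "g \<in> binary_forms (Suc n)" "dder c f = dder c g" "deriv_y f = deriv_y g"
  shows "f = g"
proof -
  have "f - g = 0"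
    using assms by (rule_tac constant_if_derivs_0[where n = n])
      (simp_all add: cvec.subspace_diff deriv_x_eq_dder[of _ c])
  then show ?thesis by simp
qed

definition mul_x :: "bipoly \<Rightarrow> bipoly" where "mul_x f = [:[:0, 1:]:] * f"
definition mul_y :: "bipoly \<Rightarrow> bipoly" where "mul_y f = [:0, 1:] * f"

lemma cf_mul_x: "cf i j (mul_x f) = (case i of 0 \<Rightarrow> 0 | Suc k \<Rightarrow> cf k j f)"
  by (simp add: cf_def mul_x_def coeff_pCons split: nat.split)

lemma cf_mul_y: "cf i j (mul_y f) = (case j of 0 \<Rightarrow> 0 | Suc k \<Rightarrow> cf i k f)"
  by (simp add: cf_def mul_y_def coeff_pCons split: nat.split)

text \<open>
  The primitive is \<open>(x f1 + y f2) / (n + 1)\<close>: the hypothesis turns the cross term \<open>y (dx f2)\<close> of its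
  x-derivative into \<open>y (dy f1)\<close>, and Euler's formula for \<open>f1\<close> does the rest.
\<close>

lemma poincare:
  assumes f1: "f1 \<in> binary_forms n" and f2: "f2 \<in> binary_forms n" and eq: "deriv_y f1 = deriv_x f2"
  obtains g where "g \<in> binary_forms (Suc n)" "deriv_x g = f1" "deriv_y g = f2"
proof
  define g where "g = scale (1 / of_nat (Suc n)) (mul_x f1 + mul_y f2)"
  have cfg: "cf i j g = ((case i of 0 \<Rightarrow> 0 | Suc k \<Rightarrow> cf k j f1) + (case j of 0 \<Rightarrow> 0 | Suc k \<Rightarrow> cf i k f2)) / of_nat (Suc n)" for i j
    by (simp add: g_def cf_mul_x cf_mul_y)
  have e: "of_nat (Suc j) * cf i (Suc j) f1 = of_nat (Suc i) * cf (Suc i) j f2" for i j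
    using arg_cong[OF eq, of "cf i j"] by simp
  have ne: "of_nat (Suc n) \<noteq> (0::complex)"
    by (rule of_nat_neq_0)
  show "g \<in> binary_forms (Suc n)"
    using f1 f2 by (auto simp: binary_forms_iff cfg split: nat.split)
  show "deriv_x g = f1"
  proof (rule bipoly_eqI)
    fix i j
    show "cf i j (deriv_x g) = cf i j f1"
    proof (cases "i + j = n")
      case True
      have "of_nat (Suc i) * (case j of 0 \<Rightarrow> 0 | Suc k \<Rightarrow> cf (Suc i) k f2) = of_nat j * cf i j f1"
        using e[of _ i] by (auto split: nat.split simp del: of_nat_Suc)
      then have "of_nat (Suc i) * (cf i j f1 + (case j of 0 \<Rightarrow> 0 | Suc k \<Rightarrow> cf (Suc i) k f2)) = of_nat (Suc n) * cf i j f1"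
        using True[symmetric] by (simp add: algebra_simps)
      then show ?thesis
        using ne by (simp add: cfg field_simps del: of_nat_Suc)
    next
      case False
      then show ?thesis using f1 f2 by (auto simp: cfg binary_forms_iff split: nat.split)
    qed
  qed
  show "deriv_y g = f2"
  proof (rule bipoly_eqI)
    fix i j
    show "cf i j (deriv_y g) = cf i j f2"
    proof (cases "i + j = n")
      case True
      have "of_nat (Suc j) * (case i of 0 \<Rightarrow> 0 | Suc k \<Rightarrow> cf k (Suc j) f1) = of_nat i * cf i j f2"
        using e[of j] by (auto split: nat.split simp del: of_nat_Suc)
      then have "of_nat (Suc j) * ((case i of 0 \<Rightarrow> 0 | Suc k \<Rightarrow> cf k (Suc j) f1) + cf i j f2) = of_nat (Suc n) * cf i j f2"
        using True[symmetric] by (simp add: algebra_simps)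
      then show ?thesis
        using ne by (simp add: cfg field_simps del: of_nat_Suc)
    next
      case False
      then show ?thesis using f1 f2 by (auto simp: cfg binary_forms_iff split: nat.split)
    qed
  qed
qed

text \<open>
  The same closedness criterion in the basis \<open>dder c\<close>, \<open>dy\<close>. This is what integrates a syzygy
  between two elements of a prolongation to an element of the next one.
\<close>

lemma poincare_dder:
  assumes f: "f \<in> binary_forms n" and h: "h \<in> binary_forms n" and eq: "deriv_y f = dder c h"
  obtains g where "g \<in> binary_forms (Suc n)" "dder c g = f" "deriv_y g = h"
proof -
  have "f - scale c h \<in> binary_forms n"
    using f h by (intro cvec.subspace_diff cvec.subspace_scale subspace_binary_forms)
  moreover have "deriv_y (f - scale c h) = deriv_x h"
    using eq by (simp add: dder_def)
  ultimately obtain g where g: "g \<in> binary_forms (Suc n)" "deriv_x g = f - scale c h" "deriv_y g = h"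
    using h poincare by blast
  then have "dder c g = f" by (simp add: dder_def)
  with g that show thesis by blast
qed

section \<open>Dimensions\<close>

lemma binary_forms_eq_span: "binary_forms n = cvec.span ((\<lambda>j. xy_mono (n - j) j) ` {..n})"
proof
  show "binary_forms n \<subseteq> cvec.span ((\<lambda>j. xy_mono (n - j) j) ` {..n})"
  proof
    fix f assume "f \<in> binary_forms n"
    then have "f = (\<Sum>j\<le>n. scale (cf (n - j) j f) (xy_mono (n - j) j))"
      using hom_part_id[of f n] by (simp add: hom_part_def)
    then show "f \<in> cvec.span ((\<lambda>j. xy_mono (n - j) j) ` {..n})"
      by (metis (no_types, lifting) cvec.span_base cvec.span_scale cvec.span_sum image_eqI)
  qed
  show "cvec.span ((\<lambda>j. xy_mono (n - j) j) ` {..n}) \<subseteq> binary_forms n"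
    by (rule cvec.span_minimal) (auto intro: xy_mono_in_binary_forms)
qed

lemma finite_basis:
  assumes "V \<subseteq> binary_forms n" "cvec.subspace V"
  obtains B where "finite B" "cvec.independent B" "cvec.span B = V" "card B = cvec.dim V" "B \<subseteq> V"
proof -
  obtain B where B: "B \<subseteq> V" "cvec.independent B" "V \<subseteq> cvec.span B" "card B = cvec.dim V"
    using cvec.basis_exists by blast
  have "B \<subseteq> cvec.span ((\<lambda>j. xy_mono (n - j) j) ` {..n})"
    using B(1) assms(1) binary_forms_eq_span by blast
  then have "finite B"
    using cvec.independent_span_bound[OF _ B(2)] by blast
  moreover have "cvec.span B = V"
    using B assms by (simp add: cvec.span_subspace)
  ultimately show thesis using B that by blast
qed

lemma dim_mono:
  assumes "V \<subseteq> W" "W \<subseteq> binary_forms n" "cvec.subspace V" "cvec.subspace W"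
  shows "cvec.dim V \<le> cvec.dim W"
proof -
  obtain B where B: "finite B" "cvec.span B = W" "card B = cvec.dim W"
    using finite_basis assms by metis
  then show ?thesis
    using cvec.dim_le_card[of V B] assms by simp
qed

lemma dim_le_binary_forms:
  assumes "V \<subseteq> binary_forms n"
  shows "cvec.dim V \<le> Suc n"
proof -
  have "cvec.dim V \<le> card ((\<lambda>j. xy_mono (n - j) j) ` {..n})"
    using assms binary_forms_eq_span by (intro cvec.dim_le_card) auto
  also have "\<dots> \<le> Suc n"
    using card_image_le[of "{..n}" "\<lambda>j. xy_mono (n - j) j"] by simp
  finally show ?thesis .
qed

lemma dim_binary_forms: "cvec.dim (binary_forms n) = Suc n"
proof -
  let ?m = "\<lambda>j. xy_mono (n - j) j"
  have inj: "inj_on ?m {..n}"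
  proof (rule inj_onI)
    fix a b assume "a \<in> {..n}" "b \<in> {..n}" "?m a = ?m b"
    then show "a = b"
      using cf_xy_mono[of "n - a" a "n - a" a] cf_xy_mono[of "n - a" a "n - b" b] by (metis zero_neq_one)
  qed
  have "cvec.independent (?m ` {..n})"
  proof (rule cvec.independent_if_scalars_zero)
    fix h x assume h: "(\<Sum>x\<in>?m ` {..n}. scale (h x) x) = 0" and "x \<in> ?m ` {..n}"
    then obtain j where j: "j \<le> n" "x = ?m j" by auto
    have "(\<Sum>k\<le>n. scale (h (?m k)) (?m k)) = 0"
      using h by (simp add: sum.reindex[OF inj])
    then have "cf (n - j) j (\<Sum>k\<le>n. scale (h (?m k)) (?m k)) = 0" by simp
    moreover have "cf (n - j) j (\<Sum>k\<le>n. scale (h (?m k)) (?m k)) = (\<Sum>k\<le>n. if k = j then h x else 0)"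
      unfolding cf_sum using j by (intro sum.cong) auto
    ultimately show "h x = 0" using j by simp
  qed simp
  then show ?thesis
    using card_image[OF inj] by (simp add: binary_forms_eq_span cvec.dim_eq_card_independent)
qed

lemma subspace_dim_equal:
  assumes "V \<subseteq> W" "W \<subseteq> binary_forms n" "cvec.subspace V" "cvec.subspace W" "cvec.dim W \<le> cvec.dim V"
  shows "V = W"
proof (rule ccontr)
  assume "V \<noteq> W"
  then obtain w where w: "w \<in> W" "w \<notin> V" using assms by blast
  obtain B where B: "finite B" "cvec.independent B" "cvec.span B = V" "card B = cvec.dim V" "B \<subseteq> V"
    using finite_basis assms by (metis order_trans)
  have "cvec.independent (insert w B)"
    using B w by (simp add: cvec.independent_insertI)
  moreover have "w \<notin> B" using B w by blast
  ultimately have "cvec.dim (cvec.span (insert w B)) = Suc (cvec.dim V)"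
    using B by (simp add: cvec.dim_eq_card_independent)
  moreover have "cvec.span (insert w B) \<subseteq> W"
    using w B assms by (intro cvec.span_minimal) auto
  ultimately show False
    using dim_mono[of "cvec.span (insert w B)" W n] assms by simp
qed

lemma dim_image_inj:
  assumes "V \<subseteq> binary_forms n" "cvec.subspace V" "Vector_Spaces.linear scale scale h"
    and "\<And>v. v \<in> V \<Longrightarrow> h v = 0 \<Longrightarrow> v = 0"
  shows "cvec.dim (h ` V) = cvec.dim V"
proof -
  obtain B where B: "finite B" "cvec.independent B" "cvec.span B = V" "card B = cvec.dim V" "B \<subseteq> V"
    using finite_basis assms by metis
  have inj: "inj_on h V"
    using assms by (subst endo.linear_inj_on_iff_eq_0[OF assms(3)]) auto
  have "cvec.independent (h ` B)"
    using endo.linear_independent_injective_image[OF assms(3) B(2)] inj B by simp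
  then have "cvec.dim (cvec.span (h ` B)) = card (h ` B)"
    by (simp add: cvec.dim_eq_card_independent)
  also have "card (h ` B) = card B"
    using card_image inj B inj_on_subset by blast
  finally show ?thesis
    using B endo.linear_span_image[OF assms(3), of B] by simp
qed

lemma dim_sum_disjoint:
  assumes "A \<subseteq> binary_forms n" "B \<subseteq> binary_forms n" "cvec.subspace A" "cvec.subspace B"
    and "A \<inter> B \<subseteq> {0}"
  shows "cvec.dim {a + b |a b. a \<in> A \<and> b \<in> B} = cvec.dim A + cvec.dim B"
proof -
  obtain X where X: "finite X" "cvec.independent X" "cvec.span X = A" "card X = cvec.dim A" "X \<subseteq> A"
    using finite_basis assms by metis
  obtain Y where Y: "finite Y" "cvec.independent Y" "cvec.span Y = B" "card Y = cvec.dim B" "Y \<subseteq> B"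
    using finite_basis assms by metis
  have "0 \<notin> X" using X cvec.dependent_zero by blast
  then have disj: "X \<inter> Y = {}" using X Y assms by blast
  have "cvec.independent (X \<union> Y)"
  proof (rule cvec.independent_if_scalars_zero)
    fix h x assume h: "(\<Sum>x\<in>X \<union> Y. scale (h x) x) = 0" and x: "x \<in> X \<union> Y"
    have s: "(\<Sum>x\<in>X. scale (h x) x) + (\<Sum>x\<in>Y. scale (h x) x) = 0"
      using h X Y disj by (simp add: sum.union_disjoint)
    have "(\<Sum>x\<in>X. scale (h x) x) \<in> A" "(\<Sum>x\<in>Y. scale (h x) x) \<in> B"
      using X Y assms by (auto intro!: cvec.subspace_sum cvec.subspace_scale)
    moreover from s have "(\<Sum>x\<in>X. scale (h x) x) = - (\<Sum>x\<in>Y. scale (h x) x)"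
      by (simp add: add_eq_0_iff2)
    ultimately have "(\<Sum>x\<in>X. scale (h x) x) \<in> A \<inter> B"
      using assms(4) by (simp add: cvec.subspace_neg)
    then have "(\<Sum>x\<in>X. scale (h x) x) = 0" "(\<Sum>x\<in>Y. scale (h x) x) = 0"
      using s assms(5) by auto
    then show "h x = 0"
      using x cvec.independentD[OF X(2) X(1) order_refl] cvec.independentD[OF Y(2) Y(1) order_refl] by blast
  qed (use X Y in simp)
  then have "cvec.dim (cvec.span (X \<union> Y)) = card X + card Y"
    using X Y disj by (simp add: cvec.dim_eq_card_independent card_Un_disjoint)
  then show ?thesis
    using X Y by (simp add: cvec.span_Un)
qed

section \<open>Linear functionals\<close>

definition linear_functional :: "(bipoly \<Rightarrow> complex) \<Rightarrow> bool" where
  "linear_functional \<phi> \<longleftrightarrow> (\<forall>x y. \<phi> (x + y) = \<phi> x + \<phi> y) \<and> (\<forall>c x. \<phi> (scale c x) = c * \<phi> x)"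

lemma linear_functional_add: "linear_functional \<phi> \<Longrightarrow> \<phi> (x + y) = \<phi> x + \<phi> y"
  and linear_functional_scale: "linear_functional \<phi> \<Longrightarrow> \<phi> (scale c x) = c * \<phi> x"
  by (simp_all add: linear_functional_def)

lemma linear_functional_0: "linear_functional \<phi> \<Longrightarrow> \<phi> 0 = 0"
  using linear_functional_scale[of \<phi> 0 0] by simp

lemma linear_functional_sum: "linear_functional \<phi> \<Longrightarrow> \<phi> (sum F A) = (\<Sum>a\<in>A. \<phi> (F a))"
  by (induction A rule: infinite_finite_induct) (simp_all add: linear_functional_0 linear_functional_add)

lemma functional_on_basis:
  assumes "cvec.independent B"
  shows "\<exists>\<phi>. linear_functional \<phi> \<and> (\<forall>b\<in>B. \<phi> b = h b)"
proof -
  interpret functional: vector_space_pair scale "(*) :: complex \<Rightarrow> complex \<Rightarrow> complex"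
    by (intro vector_space_pair.intro vector_space_complex cvec.vector_space_axioms)
  have "Vector_Spaces.linear scale (*) (functional.construct B h)"
    using assms functional.linear_construct by blast
  then have "linear_functional (functional.construct B h)"
    by (simp add: linear_functional_iff linear_functional_def)
  with functional.construct_basis[OF assms] show ?thesis by blast
qed

lemma subspace_functional_kernel:
  assumes "linear_functional \<phi>"
  shows "cvec.subspace {x. \<phi> x = 0}"
  by (intro cvec.subspaceI)
    (auto simp: linear_functional_0[OF assms] linear_functional_add[OF assms] linear_functional_scale[OF assms])

lemma functional_separates:
  assumes "cvec.subspace V" "v \<notin> V"
  obtains \<phi> where "linear_functional \<phi>" "\<And>x. x \<in> V \<Longrightarrow> \<phi> x = 0" "\<phi> v = 1"
proof -
  obtain B where B: "B \<subseteq> V" "cvec.independent B" "V \<subseteq> cvec.span B"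
    by (rule cvec.basis_exists[of V])
  have span: "cvec.span B = V"
    using B(1,3) assms(1) by (intro cvec.span_subspace)
  then have ind: "cvec.independent (insert v B)"
    using B(2) assms(2) by (intro cvec.independent_insertI) simp_all
  obtain \<phi> where \<phi>: "linear_functional \<phi>" "\<forall>b\<in>insert v B. \<phi> b = (if b = v then 1 else 0)"
    using functional_on_basis[OF ind, of "\<lambda>b. if b = v then 1 else 0"] by blast
  have "cvec.subspace {x. \<phi> x = 0}" by (rule subspace_functional_kernel[OF \<phi>(1)])
  then have "cvec.span B \<subseteq> {x. \<phi> x = 0}"
    using \<phi>(2) B(1) assms(2) by (intro cvec.span_minimal) auto
  then have "\<phi> x = 0" if "x \<in> V" for x using that span by blast
  moreover have "\<phi> v = 1" using \<phi>(2) by simp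
  ultimately show thesis using \<phi>(1) by (rule_tac that[of \<phi>])
qed

lemma projection_exists:
  assumes "cvec.subspace V"
  obtains P where "Vector_Spaces.linear scale scale P" "\<And>x. P x \<in> V" "\<And>x. x \<in> V \<Longrightarrow> P x = x"
proof -
  have lin: "Vector_Spaces.linear scale scale (\<lambda>x. x)"
    unfolding linear_iff_cvec by blast
  obtain g where g: "g ` UNIV \<subseteq> V" "Vector_Spaces.linear scale scale g" "\<forall>v\<in>V. g v = v"
    using endo.linear_exists_left_inverse_on[OF lin assms inj_on_id2] by blast
  have "g x \<in> V" for x using g(1) by (simp add: image_subset_iff)
  moreover have "g x = x" if "x \<in> V" for x using g(3) that by (rule bspec)
  ultimately show thesis using g(2) by (rule_tac that[of g])
qed

section \<open>Direct sums\<close>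

lemma listset_iff: "xs \<in> listset Vs \<longleftrightarrow> list_all2 (\<in>) xs Vs"
  by (induction Vs arbitrary: xs) (auto simp: set_Cons_def list_all2_Cons2)

lemma is_direct_sumI:
  assumes sub: "\<forall>V\<in>set Vs. cvec.subspace V" and W: "W = sum_list ` listset Vs"
    and 0: "\<And>xs. xs \<in> listset Vs \<Longrightarrow> sum_list xs = 0 \<Longrightarrow> set xs \<subseteq> {0}"
  shows "is_direct_sum W Vs"
  unfolding is_direct_sum_def
proof (rule bij_betw_imageI)
  show "inj_on sum_list (listset Vs)"
  proof (rule inj_onI)
    fix xs ys assume xs: "xs \<in> listset Vs" and ys: "ys \<in> listset Vs" and eq: "sum_list xs = sum_list ys"
    have len: "length xs = length Vs" "length ys = length Vs"
      using xs ys by (auto simp: listset_iff list_all2_lengthD)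
    let ?zs = "map2 (-) xs ys"
    have "?zs \<in> listset Vs"
      using xs ys sub unfolding listset_iff list_all2_conv_all_nth by (auto intro!: cvec.subspace_diff)
    moreover have "sum_list ?zs = sum_list xs - sum_list ys"
      using len by (simp add: sum_list_sum_nth sum_subtractf)
    ultimately have z: "set ?zs \<subseteq> {0}" using 0[of ?zs] eq by simp
    show "xs = ys"
    proof (rule nth_equalityI)
      fix i assume i: "i < length xs"
      then have "?zs ! i \<in> set ?zs" using len by (intro nth_mem) simp
      then have "?zs ! i = 0" using z by blast
      then show "xs ! i = ys ! i" using i len by simp
    qed (use len in simp)
  qed
qed (use W in simp)

lemma is_direct_sumD:
  assumes "is_direct_sum W Vs" "\<forall>V\<in>set Vs. cvec.subspace V" "xs \<in> listset Vs" "sum_list xs = 0"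
  shows "set xs \<subseteq> {0}"
proof -
  let ?zs = "replicate (length Vs) (0::bipoly)"
  have "?zs \<in> listset Vs"
    using assms(2) by (auto simp: listset_iff list_all2_conv_all_nth cvec.subspace_0)
  moreover have "sum_list ?zs = sum_list xs"
    using assms(4) by (simp add: sum_list_replicate)
  ultimately have "xs = ?zs"
    using assms(1,3) unfolding is_direct_sum_def bij_betw_def by (auto dest: inj_onD)
  then show ?thesis by auto
qed

lemma is_direct_sum_image: "is_direct_sum W Vs \<Longrightarrow> W = sum_list ` listset Vs"
  by (simp add: is_direct_sum_def bij_betw_def)

lemma dim_direct_sum:
  assumes "is_direct_sum W Vs" "\<forall>V\<in>set Vs. cvec.subspace V \<and> V \<subseteq> binary_forms n"
  shows "cvec.subspace W \<and> W \<subseteq> binary_forms n \<and> cvec.dim W = sum_list (map cvec.dim Vs)"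
  using assms
proof (induction Vs arbitrary: W)
  case Nil
  then have W: "W = {0}" using is_direct_sum_image[of W "[]"] by simp
  have "cvec.dim {0} = 0" using cvec.dim_le_card[of "{0}" "{}"] by simp
  then show ?case using W by (simp add: cvec.subspace_0)
next
  case (Cons V Vs)
  let ?W = "sum_list ` listset Vs"
  have V: "cvec.subspace V" "V \<subseteq> binary_forms n" using Cons.prems by auto
  have "is_direct_sum ?W Vs"
  proof (rule is_direct_sumI)
    fix xs assume "xs \<in> listset Vs" "sum_list xs = 0"
    then have "set (0 # xs) \<subseteq> {0}"
      using Cons.prems V by (intro is_direct_sumD[OF Cons.prems(1)]) (auto simp: set_Cons_def cvec.subspace_0)
    then show "set xs \<subseteq> {0}" by simp
  qed (use Cons.prems in auto)
  then have IH: "cvec.subspace ?W \<and> ?W \<subseteq> binary_forms n \<and> cvec.dim ?W = sum_list (map cvec.dim Vs)"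
    using Cons by simp
  have "a + sum_list xs \<in> sum_list ` listset (V # Vs)" if "a \<in> V" "xs \<in> listset Vs" for a xs
    using that by (intro image_eqI[of _ _ "a # xs"]) (auto simp: set_Cons_def)
  moreover have "\<exists>a b. sum_list zs = a + b \<and> a \<in> V \<and> b \<in> ?W" if zs: "zs \<in> listset (V # Vs)" for zs
  proof -
    obtain x xs where x: "zs = x # xs" "x \<in> V" "xs \<in> listset Vs" using zs by (auto simp: set_Cons_def)
    then show ?thesis by (intro exI[of _ x] exI[of _ "sum_list xs"]) simp
  qed
  ultimately have W: "W = {a + b |a b. a \<in> V \<and> b \<in> ?W}"
    unfolding is_direct_sum_image[OF Cons.prems(1)] by (auto simp del: listset.simps)
  have "V \<inter> ?W \<subseteq> {0}"
  proof
    fix a assume "a \<in> V \<inter> ?W"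
    then obtain xs where a: "a \<in> V" "xs \<in> listset Vs" "a = sum_list xs" by blast
    then have "set ((- a) # xs) \<subseteq> {0}"
      using Cons.prems V by (intro is_direct_sumD[OF Cons.prems(1)]) (auto simp: set_Cons_def cvec.subspace_neg)
    then show "a \<in> {0}" by simp
  qed
  then have "cvec.dim W = cvec.dim V + cvec.dim ?W"
    unfolding W using IH V by (intro dim_sum_disjoint) auto
  moreover have "W \<subseteq> binary_forms n"
    using W IH V by (auto intro!: cvec.subspace_add)
  ultimately show ?case
    using IH W V cvec.subspace_sums[of V ?W] by simp
qed

section \<open>Polar spaces in coordinates\<close>

lemma funpow_commute1: "(\<And>x. g (h x) = h (g x)) \<Longrightarrow> (g ^^ m) (h x) = h ((g ^^ m) x)"
  by (induction m) simp_all

lemma linear_funpow: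
  assumes "Vector_Spaces.linear scale scale h"
  shows "Vector_Spaces.linear scale scale (h ^^ m)"
  using assms by (induction m) (simp_all add: linear_iff_cvec)

text \<open>
  With \<open>u = dder c\<close> and \<open>v = dy\<close>, this is \<open>Q f\<close> for the form \<open>Q\<close> in \<open>u, v\<close> of degree \<open>n - 1\<close> that has
  coefficient \<open>q t\<close> at \<open>u^t v^(n-1-t)\<close>. Counting the coefficients, instead of recording the degree, lets
  \<open>n = 0\<close> stand for the zero form of degree \<open>-1\<close>: expressions such as \<open>comb c (n - k)\<close> then
  silently vanish as soon as the degree would become negative.
\<close>

definition comb :: "complex \<Rightarrow> nat \<Rightarrow> (nat \<Rightarrow> complex) \<Rightarrow> bipoly \<Rightarrow> bipoly" where
  "comb c n q f = (\<Sum>t<n. scale (q t) ((dder c ^^ t) ((deriv_y ^^ (n - 1 - t)) f)))"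

lemma comb_0 [simp]: "comb c 0 q f = 0"
  by (simp add: comb_def)

lemma comb_cong: "(\<And>t. t < n \<Longrightarrow> q t = q' t) \<Longrightarrow> comb c n q f = comb c n q' f"
  by (simp add: comb_def)

lemma comb_eq_0: "(\<And>t. t < n \<Longrightarrow> q t = 0) \<Longrightarrow> comb c n q f = 0"
  by (simp add: comb_def)

lemma comb_add: "comb c n (\<lambda>t. q t + q' t) f = comb c n q f + comb c n q' f"
  and comb_diff: "comb c n (\<lambda>t. q t - q' t) f = comb c n q f - comb c n q' f"
  and comb_scale: "comb c n (\<lambda>t. a * q t) f = scale a (comb c n q f)"
  by (simp_all add: comb_def cvec.scale_left_distrib cvec.scale_left_diff_distrib sum.distrib sum_subtractf
      cvec.scale_sum_right)

text \<open>
  Reduction modulo \<open>u = dder c\<close>: a form in \<open>u, v\<close> is a multiple of \<open>v^n\<close> plus \<open>u\<close> times a form of lower degree.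
\<close>

lemma comb_Suc_first:
  "comb c (Suc n) q f = scale (q 0) ((deriv_y ^^ n) f) + dder c (comb c n (\<lambda>t. q (Suc t)) f)"
  unfolding comb_def sum.lessThan_Suc_shift by simp

lemma comb_Suc_last:
  "comb c (Suc n) q f = deriv_y (comb c n q f) + scale (q n) ((dder c ^^ n) f)"
proof -
  have "(dder c ^^ t) ((deriv_y ^^ (n - t)) f) = deriv_y ((dder c ^^ t) ((deriv_y ^^ (n - 1 - t)) f))" if "t < n" for t
  proof -
    from that have "n - t = Suc (n - 1 - t)" by simp
    then show ?thesis
      using funpow_commute1[of "dder c" deriv_y t, OF dder_deriv_y] by simp
  qed
  then show ?thesis by (simp add: comb_def)
qed

text \<open>
  Multiplying by \<open>u\<close> shifts the coefficients, multiplying by \<open>v\<close> pads them with a zero.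
\<close>

lemma dder_comb: "dder c (comb c (n - Suc k) q f) = comb c (n - k) (\<lambda>t. case t of 0 \<Rightarrow> 0 | Suc s \<Rightarrow> q s) f"
proof (cases "n - k")
  case (Suc m)
  then have "n - Suc k = m" by simp
  with Suc show ?thesis by (simp add: comb_Suc_first)
qed simp

lemma deriv_y_comb:
  "deriv_y (comb c (n - Suc k) q f) = comb c (n - k) (\<lambda>t. if t < n - Suc k then q t else 0) f"
proof (cases "n - k")
  case (Suc m)
  then have "n - Suc k = m" by simp
  with Suc show ?thesis
    using comb_cong[of m "\<lambda>t. if t < m then q t else 0" q c f] by (simp add: comb_Suc_last)
qed simp

definition comb_space :: "complex \<Rightarrow> nat \<Rightarrow> bipoly \<Rightarrow> bipoly set" where
  "comb_space c n f = range (\<lambda>q. comb c n q f)"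

lemma subspace_comb_space: "cvec.subspace (comb_space c n f)"
proof (rule cvec.subspaceI)
  show "0 \<in> comb_space c n f"
    using comb_eq_0[of n "\<lambda>_. 0" c f] unfolding comb_space_def by (metis rangeI)
qed (auto simp: comb_space_def simp flip: comb_add comb_scale)

lemma subspace_deriv_space: "cvec.subspace T \<Longrightarrow> cvec.subspace (deriv_space T)"
proof -
  assume T: "cvec.subspace T"
  have "deriv_space T = {x + y |x y. x \<in> deriv_x ` T \<and> y \<in> deriv_y ` T}"
    by (auto simp: deriv_space_def)
  then show ?thesis
    using T by (simp add: cvec.subspace_sums endo.linear_subspace_image linear_deriv_x linear_deriv_y)
qed

lemma deriv_space_eq_dder:
  assumes "cvec.subspace T"
  shows "deriv_space T = {dder c f + deriv_y g |f g. f \<in> T \<and> g \<in> T}"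
proof (intro equalityI subsetI)
  fix h assume "h \<in> deriv_space T"
  then obtain f g where fg: "f \<in> T" "g \<in> T" "h = deriv_x f + deriv_y g" by (auto simp: deriv_space_def)
  then have "h = dder c f + deriv_y (g - scale c f)" by (simp add: dder_def)
  then show "h \<in> {dder c f + deriv_y g |f g. f \<in> T \<and> g \<in> T}"
    using fg assms by (blast intro: cvec.subspace_diff cvec.subspace_scale)
next
  fix h assume "h \<in> {dder c f + deriv_y g |f g. f \<in> T \<and> g \<in> T}"
  then obtain f g where fg: "f \<in> T" "g \<in> T" "h = dder c f + deriv_y g" by blast
  then have "h = deriv_x f + deriv_y (g + scale c f)" by (simp add: dder_def)
  then show "h \<in> deriv_space T"
    unfolding deriv_space_def using fg assms by (blast intro: cvec.subspace_add cvec.subspace_scale)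
qed

lemma deriv_space_comb_space:
  assumes "n > 0"
  shows "deriv_space (comb_space c n f) = comb_space c (Suc n) f"
proof (intro equalityI subsetI)
  fix h assume "h \<in> deriv_space (comb_space c n f)"
  then obtain q q' where "h = dder c (comb c n q f) + deriv_y (comb c n q' f)"
    unfolding deriv_space_eq_dder[OF subspace_comb_space, where c = c] by (auto simp: comb_space_def)
  then have "h = comb c (Suc n) (\<lambda>t. (case t of 0 \<Rightarrow> 0 | Suc s \<Rightarrow> q s) + (if t < n then q' t else 0)) f"
    using dder_comb[of c "Suc n" 0 q f] deriv_y_comb[of c "Suc n" 0 q' f] by (simp add: comb_add)
  then show "h \<in> comb_space c (Suc n) f" by (auto simp: comb_space_def)
next
  fix h assume "h \<in> comb_space c (Suc n) f"
  then obtain q where h: "h = comb c (Suc n) q f" by (auto simp: comb_space_def)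
  obtain m where m: "n = Suc m" using assms by (cases n) auto
  have "(deriv_y ^^ m) f = comb c n (\<lambda>t. if t = 0 then 1 else 0) f"
    unfolding m comb_Suc_first using comb_eq_0[of m "\<lambda>t. if Suc t = 0 then 1 else 0" c f] by simp
  then have "scale (q 0) ((deriv_y ^^ m) f) \<in> comb_space c n f"
    using cvec.subspace_scale[OF subspace_comb_space] by (simp add: comb_space_def)
  moreover have "h = dder c (comb c n (\<lambda>t. q (Suc t)) f) + deriv_y (scale (q 0) ((deriv_y ^^ m) f))"
    unfolding h comb_Suc_first by (simp add: m)
  ultimately show "h \<in> deriv_space (comb_space c n f)"
    unfolding deriv_space_eq_dder[OF subspace_comb_space, where c = c]
    by (intro CollectI exI[of _ "comb c n (\<lambda>t. q (Suc t)) f"] exI[of _ "scale (q 0) ((deriv_y ^^ m) f)"])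
      (simp add: comb_space_def)
qed

lemma deriv_space_span: "deriv_space (cvec.span A) = cvec.span (deriv_x ` A \<union> deriv_y ` A)"
  unfolding cvec.span_Un endo.linear_span_image[OF linear_deriv_x] endo.linear_span_image[OF linear_deriv_y]
  by (auto simp: deriv_space_def)

lemma polar_space_Suc: "polar_space (Suc m) f = deriv_space (polar_space m f)"
proof -
  let ?A = "\<lambda>m. {(deriv_x ^^ (m - i)) ((deriv_y ^^ i) f) |i. i \<le> m}"
  have x: "deriv_x ((deriv_x ^^ (m - i)) ((deriv_y ^^ i) f)) = (deriv_x ^^ (Suc m - i)) ((deriv_y ^^ i) f)"
    if "i \<le> m" for i
    using that by (simp add: Suc_diff_le)
  have y: "deriv_y ((deriv_x ^^ (m - i)) ((deriv_y ^^ i) f)) = (deriv_x ^^ (Suc m - Suc i)) ((deriv_y ^^ Suc i) f)" for i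
    using funpow_commute1[of deriv_x deriv_y "m - i" "(deriv_y ^^ i) f", OF deriv_xy_commute] by simp
  have "deriv_x ` ?A m \<union> deriv_y ` ?A m = ?A (Suc m)"
  proof (intro equalityI subsetI)
    fix h assume "h \<in> deriv_x ` ?A m \<union> deriv_y ` ?A m"
    then obtain i where i: "i \<le> m" "h = deriv_x ((deriv_x ^^ (m - i)) ((deriv_y ^^ i) f)) \<or>
        h = deriv_y ((deriv_x ^^ (m - i)) ((deriv_y ^^ i) f))" by blast
    from i(2) show "h \<in> ?A (Suc m)"
    proof
      assume "h = deriv_x ((deriv_x ^^ (m - i)) ((deriv_y ^^ i) f))"
      then show ?thesis using x i(1) le_SucI by auto
    next
      assume "h = deriv_y ((deriv_x ^^ (m - i)) ((deriv_y ^^ i) f))"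
      then show ?thesis using y[of i] i(1) Suc_le_mono by (intro CollectI exI[of _ "Suc i"]) simp
    qed
  next
    fix h assume "h \<in> ?A (Suc m)"
    then obtain i where i: "i \<le> Suc m" "h = (deriv_x ^^ (Suc m - i)) ((deriv_y ^^ i) f)" by blast
    show "h \<in> deriv_x ` ?A m \<union> deriv_y ` ?A m"
    proof (cases "i \<le> m")
      case True
      then have "h = deriv_x ((deriv_x ^^ (m - i)) ((deriv_y ^^ i) f))" using x i by simp
      then show ?thesis using True by blast
    next
      case False
      then have "i = Suc m" using i by simp
      then have "h = deriv_y ((deriv_x ^^ (m - m)) ((deriv_y ^^ m) f))" using y[of m] i by simp
      then show ?thesis by blast
    qed
  qed
  then show ?thesis by (simp add: polar_space_def deriv_space_span)
qed

text \<open>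
  Both families start with the line of \<open>f\<close> and are obtained from there by iterating \<open>deriv_space\<close>.
\<close>

lemma polar_space_eq_comb_space: "polar_space m f = comb_space c (Suc m) f"
proof (induction m)
  case 0
  have "comb c (Suc 0) q f = scale (q 0) f" for q
    by (simp add: comb_def)
  moreover have "range (\<lambda>q::nat \<Rightarrow> complex. scale (q 0) f) = range (\<lambda>k. scale k f)"
  proof (intro equalityI subsetI)
    fix h assume "h \<in> range (\<lambda>k. scale k f)"
    then obtain k where "h = scale k f" by blast
    then show "h \<in> range (\<lambda>q::nat \<Rightarrow> complex. scale (q 0) f)"
      by (intro image_eqI[of _ _ "\<lambda>_. k"]) simp_all
  qed auto
  ultimately have "comb_space c (Suc 0) f = range (\<lambda>k. scale k f)"
    unfolding comb_space_def by simp
  then show ?case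
    by (simp add: polar_space_def cvec.span_singleton)
next
  case (Suc m)
  then show ?case by (simp add: polar_space_Suc deriv_space_comb_space)
qed

section \<open>Prolongations\<close>

text \<open>
  The forms of degree \<open>d + j\<close> all of whose derivatives of order \<open>j\<close> lie in \<open>T\<close>. If the pair of maps
  \<open>dx, dy\<close> from \<open>T\<close> to its derivative space is read as a coherent sheaf on the projective line, these are the
  global sections of its twist by \<open>-j\<close>.
\<close>

primrec prolong :: "nat \<Rightarrow> bipoly set \<Rightarrow> nat \<Rightarrow> bipoly set" where
  "prolong d T 0 = T"
| "prolong d T (Suc j) = {g \<in> binary_forms (d + Suc j). deriv_x g \<in> prolong d T j \<and> deriv_y g \<in> prolong d T j}"

lemma subspace_prolong: "cvec.subspace T \<Longrightarrow> cvec.subspace (prolong d T j)"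
proof (induction j)
  case (Suc j)
  then have *: "cvec.subspace (prolong d T j)" by simp
  show ?case
    by (rule cvec.subspaceI)
      (auto simp: cvec.subspace_0[OF *] cvec.subspace_0 cvec.subspace_add[OF *] cvec.subspace_scale[OF *]
        intro!: cvec.subspace_add cvec.subspace_scale)
qed simp

lemma prolong_subset_forms: "T \<subseteq> binary_forms d \<Longrightarrow> prolong d T j \<subseteq> binary_forms (d + j)"
  by (cases j) auto

lemma prolong_mono: "S \<subseteq> T \<Longrightarrow> prolong d S j \<subseteq> prolong d T j"
  by (induction j) auto

lemma prolong_SucI:
  assumes "cvec.subspace T" "g \<in> binary_forms (d + Suc j)" "dder c g \<in> prolong d T j" "deriv_y g \<in> prolong d T j"
  shows "g \<in> prolong d T (Suc j)"
  using assms subspace_prolong[OF assms(1)] by (simp add: deriv_x_eq_dder[of _ c] cvec.subspace_diff cvec.subspace_scale)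

text \<open>
  The chain of prolongations with \<open>deriv_space T\<close> attached at its bottom, so that both decompositions of the
  theorem, that of \<open>T\<close> and that of its derivative space, are instances of one statement.
\<close>

definition level :: "nat \<Rightarrow> bipoly set \<Rightarrow> nat \<Rightarrow> bipoly set" where
  "level d T k = (case k of 0 \<Rightarrow> deriv_space T | Suc j \<Rightarrow> prolong d T j)"

lemma level_0 [simp]: "level d T 0 = deriv_space T"
  and level_Suc [simp]: "level d T (Suc j) = prolong d T j"
  by (simp_all add: level_def)

lemma subspace_level: "cvec.subspace T \<Longrightarrow> cvec.subspace (level d T k)"
  by (cases k) (simp_all add: subspace_prolong subspace_deriv_space)

lemma level_mono: "S \<subseteq> T \<Longrightarrow> level d S k \<subseteq> level d T k"
  using prolong_mono by (cases k) (auto simp: deriv_space_def)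

lemma deriv_level:
  assumes "cvec.subspace T" "g \<in> prolong d T k"
  shows "deriv_x g \<in> level d T k" "deriv_y g \<in> level d T k" "dder c g \<in> level d T k"
proof -
  have "deriv_x g \<in> deriv_space T \<and> deriv_y g \<in> deriv_space T" if "g \<in> T"
    unfolding deriv_space_def
    using that cvec.subspace_0[OF assms(1)] by (force intro: exI[of _ g] exI[of _ 0])
  then show x: "deriv_x g \<in> level d T k" and y: "deriv_y g \<in> level d T k"
    using assms(2) by (cases k; simp)+
  show "dder c g \<in> level d T k"
    unfolding dder_def by (intro cvec.subspace_add cvec.subspace_scale subspace_level assms(1) x y)
qed

lemma level_subset_forms:
  assumes "T \<subseteq> binary_forms d" "d > 0"
  shows "level d T k \<subseteq> binary_forms (d - 1 + k)"
proof (cases k)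
  case 0
  have "T \<subseteq> binary_forms (Suc (d - 1))" using assms by simp
  then have "deriv_space T \<subseteq> binary_forms (d - 1)"
    unfolding deriv_space_def
    by (auto intro!: cvec.subspace_add deriv_in_binary_forms)
  then show ?thesis using 0 by simp
next
  case (Suc j)
  then show ?thesis using prolong_subset_forms[OF assms(1), of j] assms(2) by simp
qed

lemma deriv_funpow_level:
  assumes "cvec.subspace T" "g \<in> level d T (k + m)"
  shows "(deriv_y ^^ m) g \<in> level d T k" "(dder c ^^ m) g \<in> level d T k"
  using assms(2)
proof (induction m arbitrary: g)
  case (Suc m)
  { case 1
    then have "deriv_y g \<in> level d T (k + m)" using deriv_level[OF assms(1)] by simp
    then show ?case using Suc.IH(1) by (simp add: funpow_swap1)
  next
    case 2
    then have "dder c g \<in> level d T (k + m)" using deriv_level[OF assms(1)] by simp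
    then show ?case using Suc.IH(2) by (simp add: funpow_swap1) }
qed auto

lemma comb_in_level:
  assumes T: "cvec.subspace T" and f: "f \<in> prolong d T n"
  shows "comb c (n + 2 - k) q f \<in> level d T k"
  unfolding comb_def
proof (intro cvec.subspace_sum cvec.subspace_scale subspace_level T)
  fix t assume "t \<in> {..<n + 2 - k}"
  then have "Suc n = k + t + (n + 2 - k - 1 - t)" by auto
  then have *: "f \<in> level d T (k + t + (n + 2 - k - 1 - t))" using f by (metis level_Suc)
  show "(dder c ^^ t) ((deriv_y ^^ (n + 2 - k - 1 - t)) f) \<in> level d T k"
    by (rule deriv_funpow_level(2)[OF T deriv_funpow_level(1)[OF T *]])
qed

section \<open>Combinations of several generators\<close>

text \<open>
  The generator \<open>f i\<close> has degree \<open>d + n i\<close> and level \<open>k\<close> consists of forms of degree \<open>d - 1 + k\<close>; the forms in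
  \<open>u, v\<close> that lead from the one to the other have degree \<open>n i + 1 - k\<close>, hence \<open>n i + 2 - k\<close> coefficients.
\<close>

definition comb_sum :: "complex \<Rightarrow> nat \<Rightarrow> nat \<Rightarrow> (nat \<Rightarrow> nat) \<Rightarrow> (nat \<Rightarrow> bipoly) \<Rightarrow> (nat \<Rightarrow> nat \<Rightarrow> complex) \<Rightarrow> bipoly" where
  "comb_sum c k r n f q = (\<Sum>i<r. comb c (n i + 2 - k) (q i) (f i))"

lemma comb_sum_add: "comb_sum c k r n f (\<lambda>i t. q i t + q' i t) = comb_sum c k r n f q + comb_sum c k r n f q'"
  and comb_sum_diff: "comb_sum c k r n f (\<lambda>i t. q i t - q' i t) = comb_sum c k r n f q - comb_sum c k r n f q'"
  by (simp_all add: comb_sum_def comb_add comb_diff sum.distrib sum_subtractf)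

lemma comb_sum_cong: "(\<And>i t. i < r \<Longrightarrow> t < n i + 2 - k \<Longrightarrow> q i t = q' i t) \<Longrightarrow> comb_sum c k r n f q = comb_sum c k r n f q'"
  unfolding comb_sum_def by (intro sum.cong comb_cong) auto

lemma comb_sum_eq_0: "(\<And>i t. i < r \<Longrightarrow> t < n i + 2 - k \<Longrightarrow> q i t = 0) \<Longrightarrow> comb_sum c k r n f q = 0"
  unfolding comb_sum_def by (intro sum.neutral ballI comb_eq_0) auto

lemma dder_comb_sum:
  "dder c (comb_sum c (Suc k) r n f q) = comb_sum c k r n f (\<lambda>i t. case t of 0 \<Rightarrow> 0 | Suc s \<Rightarrow> q i s)"
  unfolding comb_sum_def dder_simps dder_comb ..

lemma deriv_y_comb_sum:
  "deriv_y (comb_sum c (Suc k) r n f q) = comb_sum c k r n f (\<lambda>i t. if t < n i + 2 - Suc k then q i t else 0)"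
  unfolding comb_sum_def deriv_y_simps deriv_y_comb ..

lemma comb_sum_in_level:
  assumes "cvec.subspace T" "\<And>i. i < r \<Longrightarrow> f i \<in> prolong d T (n i)"
  shows "comb_sum c k r n f q \<in> level d T k"
  unfolding comb_sum_def using assms
  by (intro cvec.subspace_sum subspace_level comb_in_level) auto

definition free_mod :: "nat \<Rightarrow> complex \<Rightarrow> bipoly set \<Rightarrow> nat \<Rightarrow> nat \<Rightarrow> (nat \<Rightarrow> nat) \<Rightarrow> (nat \<Rightarrow> bipoly) \<Rightarrow> bool" where
  "free_mod d c S k r n f \<longleftrightarrow>
    (\<forall>q. comb_sum c k r n f q \<in> level d S k \<longrightarrow> (\<forall>i<r. \<forall>t<n i + 2 - k. q i t = 0))"

definition spans_mod :: "nat \<Rightarrow> complex \<Rightarrow> bipoly set \<Rightarrow> bipoly set \<Rightarrow> nat \<Rightarrow> nat \<Rightarrow> (nat \<Rightarrow> nat) \<Rightarrow> (nat \<Rightarrow> bipoly) \<Rightarrow> bool" where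
  "spans_mod d c S T k r n f \<longleftrightarrow> (\<forall>v\<in>level d T k. \<exists>s\<in>level d S k. \<exists>q. v = s + comb_sum c k r n f q)"

lemma complement_exists:
  assumes "A \<subseteq> V" "V \<subseteq> binary_forms m" "cvec.subspace A" "cvec.subspace V"
  shows "\<exists>s (g :: nat \<Rightarrow> bipoly). (\<forall>i<s. g i \<in> V) \<and>
    (\<forall>v\<in>V. \<exists>a\<in>A. \<exists>u. v = a + (\<Sum>i<s. scale (u i) (g i))) \<and>
    (\<forall>u. (\<Sum>i<s. scale (u i) (g i)) \<in> A \<longrightarrow> (\<forall>i<s. u i = 0))"
  using assms
proof (induction "cvec.dim V - cvec.dim A" arbitrary: A rule: less_induct)
  case less
  show ?case
  proof (cases "A = V")
    case True
    then show ?thesis by (intro exI[of _ 0]) auto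
  next
    case False
    then obtain v where v: "v \<in> V" "v \<notin> A" using less.prems by blast
    let ?A = "cvec.span (insert v A)"
    have A': "?A \<subseteq> V" using v less.prems by (intro cvec.span_minimal) auto
    have sub: "A \<subseteq> ?A" "v \<in> ?A" using cvec.span_superset[of "insert v A"] by auto
    have spanA: "cvec.span A = A" using less.prems by simp
    have "cvec.dim A < cvec.dim ?A"
    proof (rule ccontr)
      assume "\<not> ?thesis"
      then have "A = ?A" using subspace_dim_equal[of A ?A m] sub A' less.prems by auto
      then show False using v sub by blast
    qed
    moreover have "cvec.dim ?A \<le> cvec.dim V"
      using dim_mono[of ?A V m] A' less.prems by simp
    ultimately have "cvec.dim V - cvec.dim ?A < cvec.dim V - cvec.dim A" by simp
    from less.hyps[OF this A' less.prems(2) cvec.subspace_span less.prems(4)]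
    obtain s :: nat and g :: "nat \<Rightarrow> bipoly" where g: "\<forall>i<s. g i \<in> V"
      "\<forall>w\<in>V. \<exists>a\<in>?A. \<exists>u. w = a + (\<Sum>i<s. scale (u i) (g i))"
      "\<forall>u. (\<Sum>i<s. scale (u i) (g i)) \<in> ?A \<longrightarrow> (\<forall>i<s. u i = 0)"
      by blast
    define g' where "g' = g(s := v)"
    have sum': "(\<Sum>i<Suc s. scale (u i) (g' i)) = (\<Sum>i<s. scale (u i) (g i)) + scale (u s) v" for u
      by (simp add: g'_def)
    show ?thesis
    proof (intro exI[of _ "Suc s"] exI[of _ g'] conjI allI ballI impI)
      fix i assume "i < Suc s"
      then show "g' i \<in> V" using g(1) v by (auto simp: g'_def less_Suc_eq)
    next
      fix w assume "w \<in> V"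
      then obtain a u where a: "a \<in> ?A" "w = a + (\<Sum>i<s. scale (u i) (g i))" using g(2) by blast
      then obtain k where k: "a - scale k v \<in> A"
        using cvec.span_breakdown_eq spanA by blast
      have "(\<Sum>i<s. scale ((u(s := k)) i) (g i)) = (\<Sum>i<s. scale (u i) (g i))"
        by (intro sum.cong) auto
      then have "w = (a - scale k v) + (\<Sum>i<Suc s. scale ((u(s := k)) i) (g' i))"
        unfolding sum' using a(2) by simp
      then show "\<exists>a\<in>A. \<exists>u. w = a + (\<Sum>i<Suc s. scale (u i) (g' i))" using k by blast
    next
      fix u i assume u: "(\<Sum>i<Suc s. scale (u i) (g' i)) \<in> A" and i: "i < Suc s"
      have "(\<Sum>i<s. scale (u i) (g i)) + scale (u s) v \<in> ?A" using u sub unfolding sum' by blast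
      then have "(\<Sum>i<s. scale (u i) (g i)) + scale (u s) v - scale (u s) v \<in> ?A"
        using sub by (intro cvec.span_diff cvec.span_scale) auto
      then have u0: "\<forall>i<s. u i = 0" using g(3) by simp
      then have "(\<Sum>i<s. scale (u i) (g i)) = 0" by simp
      then have usv: "scale (u s) v \<in> A" using u unfolding sum' by simp
      have "u s = 0"
      proof (rule ccontr)
        assume "u s \<noteq> 0"
        moreover have "scale (1 / u s) (scale (u s) v) \<in> A"
          using usv less.prems(3) by (rule_tac cvec.subspace_scale)
        ultimately show False using v by simp
      qed
      then show "u i = 0" using u0 i by (auto simp: less_Suc_eq)
    qed
  qed
qed

section \<open>The core of a subspace\<close>

text \<open>
  Injectivity of \<open>dder c\<close> on \<open>T\<close> means that \<open>T\<close> does not contain the one power of a linear form, up to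
  scalars, that is killed by this derivation: \<open>c\<close> names a point of the projective line away from
  the intersection of \<open>T\<close> with the curve.
\<close>

locale transversal =
  fixes d :: nat and T :: "bipoly set" and c :: complex
  assumes d_pos: "d > 0" and sub_T: "cvec.subspace T" and T_forms: "T \<subseteq> binary_forms d"
    and dder_inj: "f \<in> T \<Longrightarrow> dder c f = 0 \<Longrightarrow> f = 0"
begin

lemma prolong_forms: "prolong d T j \<subseteq> binary_forms (d + j)"
  using T_forms by (rule prolong_subset_forms)

text \<open>
  All derivatives of a form killed by \<open>dder c\<close> are again killed by it, so injectivity climbs from \<open>T\<close> to its prolongations.
\<close>

lemma dder_inj_prolong: "g \<in> prolong d T j \<Longrightarrow> dder c g = 0 \<Longrightarrow> g = 0"
proof (induction j arbitrary: g)
  case 0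
  then show ?case using dder_inj by simp
next
  case (Suc j)
  then have "deriv_x g = 0" "deriv_y g = 0"
    by (simp_all add: dder_deriv_x dder_deriv_y)
  then show ?case using Suc.prems(1) by (intro constant_if_derivs_0[of g "d + j"]) simp_all
qed

lemma dder_funpow_inj_prolong: "g \<in> prolong d T (j + m) \<Longrightarrow> (dder c ^^ m) g = 0 \<Longrightarrow> g = 0"
proof (induction m arbitrary: g)
  case (Suc m)
  have g: "g \<in> prolong d T (Suc (j + m))" using Suc.prems(1) by simp
  then have "dder c g \<in> prolong d T (j + m)" using deriv_level(3)[OF sub_T g, of c] by simp
  then have "dder c g = 0" using Suc by (simp add: funpow_swap1)
  then show ?case using g dder_inj_prolong by blast
qed simp

lemma dder_prolong: "g \<in> prolong d T (Suc j) \<Longrightarrow> dder c g \<in> prolong d T j"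
  using deriv_level(3)[OF sub_T, of g d "Suc j" c] by simp

definition stable :: "nat \<Rightarrow> bool" where
  "stable J \<longleftrightarrow> (\<forall>j\<ge>J. dder c ` prolong d T (Suc j) = prolong d T j)"

text \<open>
  By injectivity the dimensions of the prolongations do not increase, so they are eventually constant.
\<close>

lemma stable_exists: "\<exists>J\<ge>1. stable J"
proof -
  define F where "F j = cvec.dim (prolong d T j)" for j
  have img: "cvec.dim (dder c ` prolong d T (Suc j)) = F (Suc j)" for j
    unfolding F_def
    by (rule dim_image_inj[OF prolong_forms subspace_prolong[OF sub_T] linear_dder]) (use dder_inj_prolong in blast)
  have sub: "dder c ` prolong d T (Suc j) \<subseteq> prolong d T j" for j
    using dder_prolong by blast
  have sp: "cvec.subspace (dder c ` prolong d T (Suc j))" for j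
    by (rule endo.linear_subspace_image[OF linear_dder subspace_prolong[OF sub_T]])
  have "F (Suc j) \<le> F j" for j
    using dim_mono[OF sub prolong_forms sp subspace_prolong[OF sub_T]] img by (simp add: F_def)
  then have dec: "i \<le> j \<Longrightarrow> F j \<le> F i" for i j
    by (metis lift_Suc_antimono_le)
  obtain J where J: "\<And>j. F J \<le> F j"
    using ex_has_least_nat[of "\<lambda>_. True" 0 F] by blast
  have "dder c ` prolong d T (Suc j) = prolong d T j" if "j \<ge> Suc J" for j
  proof (rule subspace_dim_equal[OF sub prolong_forms sp subspace_prolong[OF sub_T]])
    have "F j \<le> F J" using dec that by simp
    then show "cvec.dim (prolong d T j) \<le> cvec.dim (dder c ` prolong d T (Suc j))"
      using J[of "Suc j"] img by (simp add: F_def)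
  qed
  then show ?thesis unfolding stable_def by (intro exI[of _ "Suc J"]) simp
qed

text \<open>
  The torsion of the sheaf that \<open>T\<close> represents: it consists of the elements that can be divided by \<open>dder c\<close>
  arbitrarily often inside the prolongations. It will turn out to be the span of the curve section,
  and in particular not to depend on \<open>c\<close>.
\<close>

definition core :: "bipoly set" where
  "core = (\<Inter>j. (dder c ^^ j) ` prolong d T j)"

lemma stableD: "stable J \<Longrightarrow> j \<ge> J \<Longrightarrow> dder c ` prolong d T (Suc j) = prolong d T j"
  unfolding stable_def by blast

lemma core_eq: 
  assumes "stable J"
  shows "core = (dder c ^^ J) ` prolong d T J"
proof -
  define U where "U j = (dder c ^^ j) ` prolong d T j" for j
  have S: "U (Suc j) = (dder c ^^ j) ` dder c ` prolong d T (Suc j)" for j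
    unfolding U_def by (auto simp: funpow_swap1 image_image)
  have "U (Suc j) \<subseteq> U j" for j
    unfolding S unfolding U_def using dder_prolong by blast
  then have dec: "i \<le> j \<Longrightarrow> U j \<subseteq> U i" for i j
    by (metis lift_Suc_antimono_le)
  have "U (Suc j) = U j" if "j \<ge> J" for j
    unfolding S stableD[OF assms that] by (simp add: U_def)
  then have const: "U (J + j) = U J" for j
    by (induction j) simp_all
  have "U J \<subseteq> U j" for j
    using dec[of j "J + j"] const by simp
  then show ?thesis unfolding core_def U_def[symmetric] by blast
qed

lemma core_subset_image: "core \<subseteq> (dder c ^^ j) ` prolong d T j"
  unfolding core_def by blast

lemma core_subset: "core \<subseteq> T"
  using core_subset_image[of 0] by simp

lemma subspace_core: "cvec.subspace core"
proof -
  obtain J where "stable J" using stable_exists by blast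
  then show ?thesis
    unfolding core_eq[OF \<open>stable J\<close>]
    by (intro endo.linear_subspace_image linear_funpow linear_dder subspace_prolong sub_T)
qed

lemma core_forms: "core \<subseteq> binary_forms d"
  using core_subset T_forms by blast

text \<open>
  Prolonging the core loses nothing: if the derivatives of \<open>g\<close> are divisible by a high power of \<open>dder c\<close>,
  then the quotients satisfy the closedness condition, because \<open>dder c\<close> is injective, and their
  primitive divides \<open>g\<close>.
\<close>

lemma prolong_core:
  assumes "stable J" "J \<ge> 1"
  shows "prolong d core k = (dder c ^^ J) ` prolong d T (J + k)"
proof (induction k)
  case 0
  then show ?case using core_eq[OF assms(1)] by simp
next
  case (Suc k)
  have cx: "deriv_x ((dder c ^^ J) h) = (dder c ^^ J) (deriv_x h)" and cy: "deriv_y ((dder c ^^ J) h) = (dder c ^^ J) (deriv_y h)" for h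
    using funpow_commute1[of "dder c" deriv_x J h, OF dder_deriv_x] funpow_commute1[of "dder c" deriv_y J h, OF dder_deriv_y] by simp_all
  have forms: "(dder c ^^ J) h \<in> binary_forms (d + m)" if "h \<in> prolong d T (J + m)" for h m
  proof -
    have "h \<in> level d T (Suc m + J)" using that by (simp add: add.commute)
    then have "(dder c ^^ J) h \<in> level d T (Suc m)" by (rule deriv_funpow_level(2)[OF sub_T])
    then show ?thesis using prolong_forms by auto
  qed
  show ?case
  proof (intro equalityI subsetI)
    fix g assume g: "g \<in> prolong d core (Suc k)"
    then have gx: "deriv_x g \<in> (dder c ^^ J) ` prolong d T (J + k)" and gy: "deriv_y g \<in> (dder c ^^ J) ` prolong d T (J + k)"
      and gf: "g \<in> binary_forms (Suc (d + k))"
      using Suc by auto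
    from gx obtain h1 where h1: "h1 \<in> prolong d T (J + k)" "deriv_x g = (dder c ^^ J) h1" by blast
    from gy obtain h2 where h2: "h2 \<in> prolong d T (J + k)" "deriv_y g = (dder c ^^ J) h2" by blast
    obtain m where m: "J + k = Suc m" using assms(2) by (cases "J + k") auto
    have "deriv_y h1 - deriv_x h2 \<in> prolong d T m"
      using h1(1) h2(1) unfolding m
      by (intro cvec.subspace_diff subspace_prolong sub_T) auto
    moreover have "(dder c ^^ J) (deriv_y h1 - deriv_x h2) = 0"
      using deriv_xy_commute[of g] h1(2) h2(2) endo.linear_diff[OF linear_funpow[OF linear_dder]]
      by (simp add: cx[symmetric] cy[symmetric])
    ultimately have "deriv_y h1 - deriv_x h2 = 0"
    proof -
      assume a: "deriv_y h1 - deriv_x h2 \<in> prolong d T m" "(dder c ^^ J) (deriv_y h1 - deriv_x h2) = 0"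
      \<comment> \<open>For \<open>J = m + 1\<close> the last application of \<open>dder c\<close> happens on \<open>T\<close> itself, below the prolongations.\<close>
      have inj: "u = 0" if "u \<in> prolong d T m" "(dder c ^^ J) u = 0" "J \<le> Suc m" for u
      proof (cases "J \<le> m")
        case True
        then show ?thesis using dder_funpow_inj_prolong[of u "m - J" J] that by simp
      next
        case False
        then have J: "J = Suc m" using that by simp
        have "u \<in> level d T (1 + m)" using that(1) by simp
        then have "(dder c ^^ m) u \<in> T" using deriv_funpow_level(2)[OF sub_T, of u d 1 m c] by simp
        moreover have "dder c ((dder c ^^ m) u) = 0" using that(2) J by simp
        ultimately have "(dder c ^^ m) u = 0" by (rule dder_inj)
        then show ?thesis using dder_funpow_inj_prolong[of u 0 m] that(1) by simp
      qed
      show ?thesis using inj[OF a] m by simp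
    qed
    then have "deriv_y h1 = deriv_x h2" by simp
    then obtain h where h: "h \<in> binary_forms (Suc (d + (J + k)))" "deriv_x h = h1" "deriv_y h = h2"
      using poincare[of h1 "d + (J + k)" h2] h1(1) h2(1) prolong_forms by blast
    then have hT: "h \<in> prolong d T (J + Suc k)" using h1(1) h2(1) by simp
    have "g - (dder c ^^ J) h = 0"
    proof (rule constant_if_derivs_0[of _ "d + k"])
      show "g - (dder c ^^ J) h \<in> binary_forms (Suc (d + k))"
        using gf forms[OF hT] by (intro cvec.subspace_diff subspace_binary_forms) simp_all
    qed (simp_all add: cx cy h h1 h2)
    then show "g \<in> (dder c ^^ J) ` prolong d T (J + Suc k)" using hT by auto
  next
    fix g assume "g \<in> (dder c ^^ J) ` prolong d T (J + Suc k)"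
    then obtain h where h: "h \<in> prolong d T (J + Suc k)" "g = (dder c ^^ J) h" by blast
    then have "deriv_x h \<in> prolong d T (J + k)" "deriv_y h \<in> prolong d T (J + k)" by auto
    then show "g \<in> prolong d core (Suc k)"
      using forms[OF h(1)] Suc by (auto simp: h(2) cx cy)
  qed
qed

lemma dder_prolong_core: "dder c ` prolong d core (Suc k) = prolong d core k"
proof -
  obtain J where J: "J \<ge> 1" "stable J" using stable_exists by blast
  have "dder c ` (dder c ^^ J) ` prolong d T (J + Suc k) = (dder c ^^ J) ` dder c ` prolong d T (Suc (J + k))"
    by (auto simp: image_image funpow_swap1)
  then show ?thesis
    using stableD[OF J(2), of "J + k"] by (simp add: prolong_core[OF J(2,1)] del: prolong.simps(2))
qed

text \<open>
  An element of the core is \<open>dder c\<close> of some \<open>g'\<close>, hence its y-derivative is \<open>dder c\<close> of \<open>dy g'\<close>, which is again in the core.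
  So a single injective derivation already fills the derivative space of the core.
\<close>

lemma deriv_space_core: "deriv_space core = dder c ` core"
proof (intro equalityI subsetI)
  fix h assume "h \<in> deriv_space core"
  then obtain f g where fg: "f \<in> core" "g \<in> core" "h = dder c f + deriv_y g"
    unfolding deriv_space_eq_dder[OF subspace_core, where c = c] by blast
  have "g \<in> dder c ` prolong d core (Suc 0)" using dder_prolong_core[of 0] fg by simp
  then obtain g' where g': "g' \<in> prolong d core (Suc 0)" "g = dder c g'" by blast
  then have "deriv_y g' \<in> core" by simp
  moreover have "h = dder c (f + deriv_y g')" using fg g' by (simp add: dder_deriv_y)
  ultimately show "h \<in> dder c ` core" using fg subspace_core by (blast intro: cvec.subspace_add)
next
  fix h assume "h \<in> dder c ` core"
  then show "h \<in> deriv_space core" using deriv_level(3)[OF subspace_core, of _ d 0 c] by auto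
qed

lemma dder_level_core: "dder c ` level d core (Suc k) = level d core k"
  using dder_prolong_core deriv_space_core by (cases k) auto

lemma dim_deriv_space_core: "cvec.dim (deriv_space core) = cvec.dim core"
  unfolding deriv_space_core using dder_inj core_subset
  by (intro dim_image_inj[OF core_forms subspace_core linear_dder]) auto

lemma prolong_core_eventually: "\<exists>J. \<forall>j\<ge>J. prolong d core j = prolong d T j"
proof -
  obtain J where J: "J \<ge> 1" "stable J" using stable_exists by blast
  have "(dder c ^^ m) ` prolong d T (m + k) = prolong d T k" if "k \<ge> J" for k m
    using that
  proof (induction m arbitrary: k)
    case (Suc m)
    have "(dder c ^^ Suc m) ` prolong d T (Suc m + k) = dder c ` (dder c ^^ m) ` prolong d T (m + Suc k)"
      by (simp add: image_image)
    also have "\<dots> = prolong d T k"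
      using Suc.IH[of "Suc k"] Suc.prems stableD[OF J(2)] by (simp del: prolong.simps(2))
    finally show ?case .
  qed simp
  then show ?thesis unfolding prolong_core[OF J(2,1)] by blast
qed

section \<open>Existence of generators\<close>

lemma level_forms: "level d T k \<subseteq> binary_forms (d - 1 + k)"
  by (rule level_subset_forms[OF T_forms d_pos])

text \<open>
  The induction step towards a generating family. On level \<open>k\<close> the elements that are neither in the core nor
  derivatives of elements of level \<open>k + 1\<close> are accounted for by new generators \<open>g\<close>, a basis of a complement. Level \<open>0\<close>
  consists of derivatives of level \<open>1\<close>, so the complement is zero there, and otherwise \<open>k - 1\<close> is the index of the new generators.
  
  Spanning is then immediate. For freeness, take a relation modulo the core and reduce it modulo \<open>u = dder c\<close>:
  the new generators drop out by their choice, and what is left has the shape \<open>v Y = u t\<close> on level \<open>k + 1\<close>. This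
  syzygy is integrated to a form \<open>g0\<close> of level \<open>k + 2\<close> with \<open>Y = u g0\<close>. Since \<open>Y\<close> only involves powers
  of \<open>v\<close>, freeness on level \<open>k + 1\<close> forces it to vanish. The whole relation is thus divisible
  by \<open>u\<close>, and dividing by \<open>u\<close>, which is injective and maps the core of level \<open>k + 1\<close> onto that of level \<open>k\<close>,
  gives a relation on level \<open>k + 1\<close>.
\<close>

lemma extend_generators:
  assumes gen: "\<And>i. i < r \<Longrightarrow> k \<le> n i \<and> f i \<in> prolong d T (n i)"
    and free: "free_mod d c core (Suc k) r n f"
    and span1: "spans_mod d c core T (Suc k) r n f"
    and span2: "spans_mod d c core T (Suc (Suc k)) r n f"
  shows "\<exists>s g. (\<forall>i<s. g i \<in> level d T k) \<and> (k = 0 \<longrightarrow> s = 0) \<and>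
    (let n' = (\<lambda>i. if i < r then n i else k - 1); f' = (\<lambda>i. if i < r then f i else g (i - r)) in
      free_mod d c core k (r + s) n' f' \<and> spans_mod d c core T k (r + s) n' f')"
proof -
  let ?S = "level d core"
  let ?T = "level d T"
  note subS = subspace_level[OF subspace_core, of d] and subT = subspace_level[OF sub_T, of d]
  have ST: "?S j \<subseteq> ?T j" for j by (rule level_mono[OF core_subset])
  define A where "A = {a + b |a b. a \<in> ?S k \<and> b \<in> deriv_space (?T (Suc k))}"
  have subA: "cvec.subspace A"
    unfolding A_def using subS subT by (intro cvec.subspace_sums subspace_deriv_space)
  have d1: "deriv_space (?T (Suc k)) \<subseteq> ?T k"
    using deriv_level[OF sub_T] by (auto simp: deriv_space_def intro!: cvec.subspace_add[OF subT])
  then have AT: "A \<subseteq> ?T k"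
    unfolding A_def using ST by (auto intro!: cvec.subspace_add[OF subT])
  have A_S: "a \<in> A" if "a \<in> ?S k" for a
    unfolding A_def using that cvec.subspace_0[OF subspace_deriv_space[OF subT[of "Suc k"]]] by force
  have A_d: "b \<in> A" if "b \<in> deriv_space (?T (Suc k))" for b
    unfolding A_def using that cvec.subspace_0[OF subS[of k]] by force
  obtain s :: nat and g :: "nat \<Rightarrow> bipoly" where g: "\<forall>i<s. g i \<in> ?T k"
      "\<forall>v\<in>?T k. \<exists>a\<in>A. \<exists>u. v = a + (\<Sum>i<s. scale (u i) (g i))"
      "\<forall>u. (\<Sum>i<s. scale (u i) (g i)) \<in> A \<longrightarrow> (\<forall>i<s. u i = 0)"
    using complement_exists[OF AT level_forms subA subT] by blast
  define n' where "n' = (\<lambda>i. if i < r then n i else k - 1)"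
  define f' where "f' = (\<lambda>i. if i < r then f i else g (i - r))"
  \<comment> \<open>Level 0 consists of derivatives of level 1, so the complement is zero there.\<close>
  have s0: "s = 0" if "k = 0"
  proof (rule ccontr)
    assume "s \<noteq> 0"
    then have "g 0 \<in> ?T 0" using g(1) that by simp
    then have "g 0 \<in> A" using A_d that by simp
    moreover have "(\<Sum>i<s. scale (if i = 0 then 1 else 0) (g i)) = g 0"
      using \<open>s \<noteq> 0\<close> by (simp add: if_distrib[of "\<lambda>x. scale x _"] cong: if_cong)
    ultimately have mem: "(\<Sum>i<s. scale (if i = 0 then 1 else 0) (g i)) \<in> A" by simp
    have "\<forall>i<s. (if i = 0 then 1 else 0) = (0::complex)"
      by (rule g(3)[THEN spec, of "\<lambda>i. if i = 0 then 1 else 0", THEN mp, OF mem])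
    then show False using \<open>s \<noteq> 0\<close> by (metis neq0_conv zero_neq_one)
  qed
  have split_sum: "(\<Sum>i<r + s. F i) = (\<Sum>i<r. F i) + (\<Sum>i<s. F (r + i))" for F :: "nat \<Rightarrow> bipoly"
    by (induction s) (simp_all add: add.assoc)
  have len1: "n' (r + i) + 2 - k = Suc 0" if "i < s" for i
    using that s0 by (cases k) (auto simp: n'_def)
  have comb1: "comb c (n' (r + i) + 2 - k) q (f' (r + i)) = scale (q 0) (g i)" if "i < s" for i q
    unfolding len1[OF that] comb_def by (simp add: f'_def)
  have e1: "(\<Sum>i<r. comb c (n' i + 2 - k) (q i) (f' i)) = comb_sum c k r n f q" for q
    unfolding comb_sum_def by (intro sum.cong) (auto simp: n'_def f'_def)
  have e2: "(\<Sum>i<s. comb c (n' (r + i) + 2 - k) (q (r + i)) (f' (r + i))) = (\<Sum>i<s. scale (q (r + i) 0) (g i))" for q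
    using comb1 by (intro sum.cong) auto
  have comb_sum': "comb_sum c k (r + s) n' f' q = comb_sum c k r n f q + (\<Sum>i<s. scale (q (r + i) 0) (g i))" for q
    unfolding comb_sum_def[of c k "r + s"] split_sum e1 e2 ..
  have comb_sumT: "comb_sum c j r n f q \<in> ?T j" for q j
    using gen by (intro comb_sum_in_level sub_T) auto
  have spans: "spans_mod d c core T k (r + s) n' f'"
    unfolding spans_mod_def
  proof
    fix v assume "v \<in> ?T k"
    then obtain a u where a: "a \<in> A" "v = a + (\<Sum>i<s. scale (u i) (g i))" using g(2) by blast
    then obtain \<sigma> b where \<sigma>: "\<sigma> \<in> ?S k" "a = \<sigma> + b" "b \<in> deriv_space (?T (Suc k))" unfolding A_def by blast
    then obtain w1 w2 where w: "w1 \<in> ?T (Suc k)" "w2 \<in> ?T (Suc k)" "b = dder c w1 + deriv_y w2"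
      unfolding deriv_space_eq_dder[OF subT, where c = c] by blast
    obtain s1 q1 where s1: "s1 \<in> ?S (Suc k)" "w1 = s1 + comb_sum c (Suc k) r n f q1"
      using span1 w(1) unfolding spans_mod_def by blast
    obtain s2 q2 where s2: "s2 \<in> ?S (Suc k)" "w2 = s2 + comb_sum c (Suc k) r n f q2"
      using span1 w(2) unfolding spans_mod_def by blast
    have "dder c s1 \<in> ?S k" "deriv_y s2 \<in> ?S k"
      using s1(1) s2(1) deriv_level[OF subspace_core] by simp_all
    then have s': "\<sigma> + (dder c s1 + deriv_y s2) \<in> ?S k"
      using \<sigma>(1) by (intro cvec.subspace_add subS)
    define q where "q = (\<lambda>i t. if i < r then (case t of 0 \<Rightarrow> 0 | Suc t' \<Rightarrow> q1 i t') +
        (if t < n i + 2 - Suc k then q2 i t else 0) else u (i - r))"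
    have "comb_sum c k r n f q = comb_sum c k r n f (\<lambda>i t. (case t of 0 \<Rightarrow> 0 | Suc t' \<Rightarrow> q1 i t') +
        (if t < n i + 2 - Suc k then q2 i t else 0))"
      by (intro comb_sum_cong) (simp add: q_def)
    then have "comb_sum c k r n f q = dder c (comb_sum c (Suc k) r n f q1) + deriv_y (comb_sum c (Suc k) r n f q2)"
      unfolding comb_sum_add dder_comb_sum deriv_y_comb_sum .
    moreover have "(\<Sum>i<s. scale (q (r + i) 0) (g i)) = (\<Sum>i<s. scale (u i) (g i))"
      by (simp add: q_def)
    ultimately have "v = (\<sigma> + (dder c s1 + deriv_y s2)) + comb_sum c k (r + s) n' f' q"
      unfolding comb_sum' a(2) \<sigma>(2) w(3) s1(2) s2(2) by (simp add: algebra_simps)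
    with s' show "\<exists>s0\<in>?S k. \<exists>q. v = s0 + comb_sum c k (r + s) n' f' q" by blast
  qed
  have "free_mod d c core k (r + s) n' f'"
    unfolding free_mod_def
  proof (intro allI impI)
    fix q i t assume q: "comb_sum c k (r + s) n' f' q \<in> ?S k" and i: "i < r + s" and t: "t < n' i + 2 - k"
    define \<sigma> where "\<sigma> = comb_sum c k (r + s) n' f' q"
    define G where "G = (\<Sum>i<s. scale (q (r + i) 0) (g i))"
    \<comment> \<open>\<open>v Y\<close> is the part of the relation without \<open>u\<close>, and \<open>u Z\<close> the rest, as far as the old generators are concerned.\<close>
    define Y where "Y = comb_sum c (Suc k) r n f (\<lambda>i t. if t = 0 then q i 0 else 0)"
    define Z where "Z = comb_sum c (Suc k) r n f (\<lambda>i t. q i (Suc t))"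
    have YT: "Y \<in> ?T (Suc k)" and ZT: "Z \<in> ?T (Suc k)"
      unfolding Y_def Z_def by (rule comb_sumT)+
    have "comb_sum c k r n f q = comb_sum c k r n f (\<lambda>i t. (if t < n i + 2 - Suc k then if t = 0 then q i 0 else 0 else 0) +
        (case t of 0 \<Rightarrow> 0 | Suc t' \<Rightarrow> q i (Suc t')))"
      using gen by (intro comb_sum_cong) (auto split: nat.split simp: Suc_diff_le)
    then have "comb_sum c k r n f q = deriv_y Y + dder c Z"
      unfolding comb_sum_add Y_def Z_def dder_comb_sum deriv_y_comb_sum .
    then have eq: "\<sigma> = deriv_y Y + dder c Z + G"
      unfolding \<sigma>_def comb_sum' G_def by simp
    have \<sigma>S: "\<sigma> \<in> ?S k" using q by (simp add: \<sigma>_def)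
    have "dder c Z + deriv_y Y \<in> deriv_space (?T (Suc k))"
      unfolding deriv_space_eq_dder[OF subT, where c = c] using YT ZT by blast
    then have "\<sigma> - (dder c Z + deriv_y Y) \<in> A"
      using A_S[OF \<sigma>S] A_d by (intro cvec.subspace_diff[OF subA])
    moreover have "\<sigma> - (dder c Z + deriv_y Y) = G" using eq by (simp add: algebra_simps)
    ultimately have GA: "(\<Sum>i<s. scale (q (r + i) 0) (g i)) \<in> A" unfolding G_def by simp
    have new0: "\<forall>i<s. q (r + i) 0 = 0"
      by (rule g(3)[THEN spec, of "\<lambda>i. q (r + i) 0", THEN mp, OF GA])
    then have G0: "G = 0" by (simp add: G_def)
    obtain \<sigma>' where \<sigma>': "\<sigma>' \<in> ?S (Suc k)" "\<sigma> = dder c \<sigma>'"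
      using \<sigma>S dder_level_core[of k] by blast
    have \<sigma>'T: "\<sigma>' \<in> ?T (Suc k)" using \<sigma>'(1) ST by blast
    have tT: "\<sigma>' - Z \<in> ?T (Suc k)" using \<sigma>'T ZT by (intro cvec.subspace_diff[OF subT])
    have "deriv_y Y = dder c (\<sigma>' - Z)" using eq G0 \<sigma>'(2) by (simp add: algebra_simps)
    moreover have "Y \<in> binary_forms (d + k)" "\<sigma>' - Z \<in> binary_forms (d + k)"
      using YT tT prolong_forms[of k] by auto
    \<comment> \<open>Integrating the syzygy \<open>v Y = u (\<sigma>' - Z)\<close>.\<close>
    ultimately obtain g0 where g0: "g0 \<in> binary_forms (Suc (d + k))" "dder c g0 = Y" "deriv_y g0 = \<sigma>' - Z"
      using poincare_dder by metis
    have "g0 \<in> ?T (Suc (Suc k))"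
      unfolding level_Suc using g0 YT tT by (intro prolong_SucI[OF sub_T, where c = c]) simp_all
    then obtain s2 p where s2: "s2 \<in> ?S (Suc (Suc k))" "g0 = s2 + comb_sum c (Suc (Suc k)) r n f p"
      using span2 unfolding spans_mod_def by blast
    have "Y - dder c (comb_sum c (Suc (Suc k)) r n f p) = dder c s2"
      using g0(2) s2(2) by (simp add: algebra_simps)
    moreover have "dder c s2 \<in> ?S (Suc k)" using s2(1) deriv_level(3)[OF subspace_core, of s2 d "Suc k" c] by simp
    ultimately have "comb_sum c (Suc k) r n f (\<lambda>i t. (if t = 0 then q i 0 else 0) - (case t of 0 \<Rightarrow> 0 | Suc s \<Rightarrow> p i s)) \<in> ?S (Suc k)"
      unfolding comb_sum_diff dder_comb_sum Y_def[symmetric] by simp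
    then have z: "\<forall>i<r. \<forall>t<n i + 2 - Suc k. (if t = 0 then q i 0 else 0) - (case t of 0 \<Rightarrow> 0 | Suc s \<Rightarrow> p i s) = 0"
      using free unfolding free_mod_def by blast
    \<comment> \<open>A pure power of \<open>v\<close> is not a multiple of \<open>u\<close>: compare the coefficients at \<open>t = 0\<close>.\<close>
    have q0: "q i 0 = 0" if "i < r" for i
    proof -
      have "0 < n i + 2 - Suc k" using gen[OF that] by simp
      then show ?thesis using z that by fastforce
    qed
    have "Y = 0" unfolding Y_def using q0 by (intro comb_sum_eq_0) auto
    then have "dder c (Z - \<sigma>') = 0" using eq G0 \<sigma>'(2) by simp
    then have "Z - \<sigma>' = 0"
      using dder_inj_prolong[of "Z - \<sigma>'" k] cvec.subspace_diff[OF subT ZT \<sigma>'T] by simp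
    then have "Z \<in> ?S (Suc k)" using \<sigma>'(1) by simp
    then have qS: "\<forall>i<r. \<forall>t<n i + 2 - Suc k. q i (Suc t) = 0"
      using free unfolding free_mod_def Z_def by blast
    show "q i t = 0"
    proof (cases "i < r")
      case True
      then show ?thesis
        using q0 qS t by (cases t) (auto simp: n'_def)
    next
      case False
      then obtain i' where i': "i = r + i'" "i' < s" using i by (metis add_less_cancel_left le_Suc_ex not_less)
      then have "t = 0" using len1[of i'] t by simp
      then show ?thesis using new0 i' by simp
    qed
  qed
  with spans s0 g(1) show ?thesis
    unfolding Let_def n'_def f'_def by (intro exI[of _ s] exI[of _ g]) simp
qed

text \<open>
  Descending induction, starting where the prolongations of \<open>T\<close> and of its core agree. Generators that
  are found later have smaller index, which is why the family comes out sorted.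
\<close>

lemma generators_from_level:
  assumes "k \<le> K" "\<forall>j\<ge>K. level d core j = level d T j"
  shows "\<exists>r n f. (\<forall>i<r. k \<le> Suc (n i) \<and> f i \<in> prolong d T (n i)) \<and> (\<forall>i j. i < j \<and> j < r \<longrightarrow> n j \<le> n i) \<and>
    free_mod d c core k r n f \<and> (\<forall>k'\<ge>k. spans_mod d c core T k' r n f)"
  using assms(1)
proof (induction rule: inc_induct)
  case base
  have "spans_mod d c core T k' 0 n f" if "k' \<ge> K" for n f k'
    unfolding spans_mod_def comb_sum_def using assms(2) that by auto
  then show ?case
    by (intro exI[of _ 0]) (simp add: free_mod_def)
next
  case (step k)
  then obtain r n f where P: "\<forall>i<r. Suc k \<le> Suc (n i) \<and> f i \<in> prolong d T (n i)"
    "\<forall>i j. i < j \<and> j < r \<longrightarrow> n j \<le> n i" "free_mod d c core (Suc k) r n f"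
    "\<forall>k'\<ge>Suc k. spans_mod d c core T k' r n f"
    by blast
  have gen: "k \<le> n i \<and> f i \<in> prolong d T (n i)" if "i < r" for i
    using P(1) that by simp
  have sp: "spans_mod d c core T (Suc k) r n f" "spans_mod d c core T (Suc (Suc k)) r n f"
    using P(4) by simp_all
  obtain s g where sg: "\<forall>i<s. g i \<in> level d T k" "k = 0 \<longrightarrow> s = 0"
    "free_mod d c core k (r + s) (\<lambda>i. if i < r then n i else k - 1) (\<lambda>i. if i < r then f i else g (i - r))"
    "spans_mod d c core T k (r + s) (\<lambda>i. if i < r then n i else k - 1) (\<lambda>i. if i < r then f i else g (i - r))"
    using extend_generators[OF gen P(3) sp] unfolding Let_def by blast
  define n' where "n' = (\<lambda>i. if i < r then n i else k - 1)"
  define f' where "f' = (\<lambda>i. if i < r then f i else g (i - r))"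
  have "k \<le> Suc (n' i) \<and> f' i \<in> prolong d T (n' i)" if "i < r + s" for i
  proof (cases "i < r")
    case True
    then show ?thesis using gen by (simp add: n'_def f'_def le_SucI)
  next
    case False
    then have "i - r < s" using that by simp
    moreover from this have "k \<noteq> 0" using sg(2) by auto
    ultimately show ?thesis using sg(1) False by (cases k) (auto simp: n'_def f'_def)
  qed
  moreover have "n' j \<le> n' i" if "i < j" "j < r + s" for i j
  proof -
    have "k - 1 \<le> n i" if "i < r" using gen[OF that] by linarith
    then show ?thesis using P(2) that by (auto simp: n'_def)
  qed
  moreover have "spans_mod d c core T k' (r + s) n' f'" if k': "k' \<ge> k" for k'
  proof (cases "k' = k")
    case True
    then show ?thesis using sg(4) by (simp add: n'_def f'_def)
  next
    case False
    then have k': "k' \<ge> Suc k" using k' by simp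
    have "comb_sum c k' (r + s) n' f' q = comb_sum c k' r n f q" for q
      unfolding comb_sum_def
    proof (rule sum.mono_neutral_cong_right)
      show "\<forall>i\<in>{..<r + s} - {..<r}. comb c (n' i + 2 - k') (q i) (f' i) = 0"
      proof
        fix i assume i: "i \<in> {..<r + s} - {..<r}"
        then have "s \<noteq> 0" by auto
        then have "k \<noteq> 0" using sg(2) by auto
        then have "n' i + 2 - k' = 0" using i k' by (simp add: n'_def)
        then show "comb c (n' i + 2 - k') (q i) (f' i) = 0" by simp
      qed
    qed (auto simp: n'_def f'_def)
    then show ?thesis using P(4) k' unfolding spans_mod_def by simp
  qed
  moreover have "free_mod d c core k (r + s) n' f'" using sg(3) by (simp add: n'_def f'_def)
  ultimately show ?case by blast
qed

lemma generators_exist: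
  obtains r n f where "\<And>i. i < r \<Longrightarrow> f i \<in> prolong d T (n i)" "\<And>i j. i < j \<Longrightarrow> j < r \<Longrightarrow> n j \<le> n i"
    "free_mod d c core 0 r n f" "spans_mod d c core T (Suc 0) r n f"
proof -
  obtain J where J: "\<forall>j\<ge>J. prolong d core j = prolong d T j" using prolong_core_eventually by blast
  have "\<forall>j\<ge>Suc J. level d core j = level d T j"
  proof (intro allI impI)
    fix j assume "Suc J \<le> j"
    then show "level d core j = level d T j" using J by (cases j) simp_all
  qed
  then obtain r n f where *: "(\<forall>i<r. 0 \<le> Suc (n i) \<and> f i \<in> prolong d T (n i)) \<and> (\<forall>i j. i < j \<and> j < r \<longrightarrow> n j \<le> n i) \<and>
    free_mod d c core 0 r n f \<and> (\<forall>k'\<ge>0. spans_mod d c core T k' r n f)"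
    using generators_from_level[of 0 "Suc J"] by blast
  show thesis by (rule that[of r f n]) (use * in auto)
qed

end

section \<open>Generators and prolongations\<close>

text \<open>
  A relation on level \<open>k + 1\<close> becomes one on level \<open>k\<close> after applying \<open>dder c\<close>, which only shifts its coefficients.
\<close>

lemma free_mod_Suc:
  assumes "free_mod d c S k r n f" "cvec.subspace S"
  shows "free_mod d c S (Suc k) r n f"
  unfolding free_mod_def
proof (intro allI impI)
  fix q i t assume q: "comb_sum c (Suc k) r n f q \<in> level d S (Suc k)" and i: "i < r" and t: "t < n i + 2 - Suc k"
  have "dder c (comb_sum c (Suc k) r n f q) \<in> level d S k"
    using q deriv_level(3)[OF assms(2)] by simp
  then have "\<forall>i<r. \<forall>t<n i + 2 - k. (case t of 0 \<Rightarrow> 0 | Suc s \<Rightarrow> q i s) = 0"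
    using assms(1) unfolding dder_comb_sum free_mod_def by blast
  moreover have "Suc t < n i + 2 - k" using t by simp
  ultimately show "q i t = 0" using i by force
qed

lemma free_mod_level: "free_mod d c S 0 r n f \<Longrightarrow> cvec.subspace S \<Longrightarrow> free_mod d c S k r n f"
  by (induction k) (simp_all add: free_mod_Suc)

text \<open>
  A form \<open>g\<close> of the next level is known through \<open>u g\<close> and \<open>v g\<close>. Write both in terms of the generators and compare
  \<open>v (u g)\<close> with \<open>u (v g)\<close>: by freeness on the level below, the coefficients of \<open>u g\<close> are divisible by \<open>u\<close> and those of
  \<open>v g\<close> by \<open>v\<close>, with the same quotient, and the components in \<open>S\<close> have a common primitive.
\<close>

lemma spans_mod_Suc:
  assumes S: "cvec.subspace S" "S \<subseteq> T" and T: "cvec.subspace T" "T \<subseteq> binary_forms d"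
    and f: "\<And>i. i < r \<Longrightarrow> f i \<in> prolong d T (n i)"
    and free: "free_mod d c S j r n f" and span: "spans_mod d c S T (Suc j) r n f"
  shows "spans_mod d c S T (Suc (Suc j)) r n f"
  unfolding spans_mod_def
proof
  fix g assume "g \<in> level d T (Suc (Suc j))"
  then have g: "g \<in> prolong d T (Suc j)" by simp
  have gl: "dder c g \<in> level d T (Suc j)" "deriv_y g \<in> level d T (Suc j)"
    using deriv_level[OF T(1) g] by simp_all
  obtain s q where s: "s \<in> prolong d S j" "dder c g = s + comb_sum c (Suc j) r n f q"
    using span gl(1) unfolding spans_mod_def by auto
  obtain s' q' where s': "s' \<in> prolong d S j" "deriv_y g = s' + comb_sum c (Suc j) r n f q'"
    using span gl(2) unfolding spans_mod_def by auto
  \<comment> \<open>The generator part of \<open>u (v g) - v (u g) = 0\<close>.\<close>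
  define p where "p = (\<lambda>i t. (case t of 0 \<Rightarrow> 0 | Suc u \<Rightarrow> q' i u) - (if t < n i + 2 - Suc j then q i t else 0))"
  have "dder c (deriv_y g) = deriv_y (dder c g)" by (rule dder_deriv_y)
  then have eq: "comb_sum c j r n f p = deriv_y s - dder c s'"
    unfolding s(2) s'(2) p_def comb_sum_diff deriv_y_comb_sum[symmetric] dder_comb_sum[symmetric] by (simp add: algebra_simps)
  have sS: "deriv_y s - dder c s' \<in> level d S j"
    using s(1) s'(1) deriv_level[OF S(1)] by (intro cvec.subspace_diff subspace_level S(1)) auto
  with eq have p0: "\<forall>i<r. \<forall>t<n i + 2 - j. p i t = 0"
    using free unfolding free_mod_def by simp
  then have "comb_sum c j r n f p = 0" by (intro comb_sum_eq_0) auto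
  with eq have "deriv_y s = dder c s'" by simp
  moreover have "prolong d S j \<subseteq> binary_forms (d + j)"
    using prolong_subset_forms S T by blast
  ultimately obtain s2 where s2: "s2 \<in> binary_forms (Suc (d + j))" "dder c s2 = s" "deriv_y s2 = s'"
    using poincare_dder[of s "d + j" s' c] s(1) s'(1) by blast
  have s2S: "s2 \<in> prolong d S (Suc j)"
    using s2 s(1) s'(1) by (intro prolong_SucI[OF S(1), where c = c]) simp_all
  define h where "h = s2 + comb_sum c (Suc (Suc j)) r n f (\<lambda>i t. q i (Suc t))"
  have ql: "q i 0 = 0" if "i < r" "0 < n i + 2 - Suc j" for i
    using p0[rule_format, of i 0] that by (simp add: p_def)
  have "comb_sum c (Suc j) r n f (\<lambda>i t. case t of 0 \<Rightarrow> 0 | Suc u \<Rightarrow> q i (Suc u)) = comb_sum c (Suc j) r n f q"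
    using ql by (intro comb_sum_cong) (auto split: nat.split)
  then have "dder c h = dder c g"
    unfolding h_def s(2) by (simp only: dder_simps dder_comb_sum s2(2))
  moreover have "comb_sum c (Suc j) r n f (\<lambda>i t. if t < n i + 2 - Suc (Suc j) then q i (Suc t) else 0) = comb_sum c (Suc j) r n f q'"
  proof (intro comb_sum_cong)
    fix i t assume i: "i < r" and t: "t < n i + 2 - Suc j"
    have "Suc t < n i + 2 - j" using t by simp
    then have "p i (Suc t) = 0" using p0 i by blast
    then show "(if t < n i + 2 - Suc (Suc j) then q i (Suc t) else 0) = q' i t"
      using t by (auto simp: p_def split: if_splits)
  qed
  then have "deriv_y h = deriv_y g"
    unfolding h_def s'(2) by (simp only: deriv_y_add deriv_y_comb_sum s2(3))
  moreover have "h \<in> binary_forms (Suc (d + j))"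
  proof -
    have "comb_sum c (Suc (Suc j)) r n f (\<lambda>i t. q i (Suc t)) \<in> level d T (Suc (Suc j))"
      using f by (intro comb_sum_in_level T(1))
    then have "comb_sum c (Suc (Suc j)) r n f (\<lambda>i t. q i (Suc t)) \<in> binary_forms (Suc (d + j))" by simp
    then show ?thesis unfolding h_def using s2(1) by (intro cvec.subspace_add subspace_binary_forms)
  qed
  moreover have "g \<in> binary_forms (Suc (d + j))" using g by simp
  ultimately have "g = h" using eq_if_dder_deriv_y_eq by metis
  then show "\<exists>s\<in>level d S (Suc (Suc j)). \<exists>q. g = s + comb_sum c (Suc (Suc j)) r n f q"
    unfolding h_def using s2S by auto
qed

lemma spans_mod_level:
  assumes "cvec.subspace S" "S \<subseteq> T" "cvec.subspace T" "T \<subseteq> binary_forms d"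
    and "\<And>i. i < r \<Longrightarrow> f i \<in> prolong d T (n i)"
    and "free_mod d c S 0 r n f" and "spans_mod d c S T (Suc 0) r n f"
  shows "spans_mod d c S T (Suc j) r n f"
proof (induction j)
  case (Suc j)
  show ?case
    by (rule spans_mod_Suc[OF assms(1-5) free_mod_level[OF assms(6,1)] Suc])
qed (rule assms(7))

section \<open>Polynomial differential operators\<close>

text \<open>
  Polynomials also serve as differential operators: \<open>x\<close> acts as \<open>dx\<close> and \<open>y\<close> as \<open>dy\<close>. The recursion
  over \<open>pCons\<close> treats the inner variable here and the outer one in \<open>act\<close>.
\<close>

definition actx :: "complex poly \<Rightarrow> bipoly \<Rightarrow> bipoly" where
  "actx p f = fold_coeffs (\<lambda>a g. scale a f + deriv_x g) p 0"

definition act :: "bipoly \<Rightarrow> bipoly \<Rightarrow> bipoly" where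
  "act Q f = fold_coeffs (\<lambda>p g. actx p f + deriv_y g) Q 0"

lemma actx_0 [simp]: "actx 0 f = 0"
  by (simp add: actx_def)

lemma actx_pCons [simp]: "actx (pCons a p) f = scale a f + deriv_x (actx p f)"
  by (cases "p = 0 \<and> a = 0") (auto simp: actx_def)

lemma act_0 [simp]: "act 0 f = 0"
  by (simp add: act_def)

lemma act_pCons [simp]: "act (pCons p Q) f = actx p f + deriv_y (act Q f)"
  by (cases "Q = 0 \<and> p = 0") (auto simp: act_def)

lemma actx_add: "actx p (f + g) = actx p f + actx p g"
  and actx_scale: "actx p (scale c f) = scale c (actx p f)"
  and actx_deriv_x: "actx p (deriv_x f) = deriv_x (actx p f)"
  and actx_deriv_y: "actx p (deriv_y f) = deriv_y (actx p f)"
  by (induction p)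
    (simp_all add: algebra_simps cvec.scale_right_distrib cvec.scale_left_commute deriv_xy_commute)

lemma actx_zero_right [simp]: "actx p 0 = 0"
  using actx_scale[of p 0 0] by simp

lemma act_scale: "act Q (scale c f) = scale c (act Q f)"
  and act_deriv_y: "act Q (deriv_y f) = deriv_y (act Q f)"
  by (induction Q)
    (simp_all add: algebra_simps actx_add actx_scale actx_deriv_y cvec.scale_right_distrib cvec.scale_left_commute)

lemma actx_add_left: "actx (p + q) f = actx p f + actx q f"
  by (induction p q rule: poly_induct2) (simp_all add: cvec.scale_left_distrib)

lemma act_zero_right [simp]: "act Q 0 = 0"
  using act_scale[of Q 0 0] by simp

lemma act_add_left: "act (P + Q) f = act P f + act Q f"
  by (induction P Q rule: poly_induct2) (simp_all add: actx_add_left)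

lemma actx_smult: "actx (Polynomial.smult c p) f = scale c (actx p f)"
  by (induction p) (simp_all add: cvec.scale_right_distrib)

lemma actx_mult: "actx (p * q) f = actx p (actx q f)"
  by (induction p) (simp_all add: actx_add_left actx_smult)

lemma act_smult: "act (Polynomial.smult p Q) f = actx p (act Q f)"
  by (induction Q) (simp_all add: actx_mult actx_add actx_deriv_y)

lemma act_mult: "act (P * Q) f = act P (act Q f)"
  by (induction P) (simp_all add: act_add_left act_smult)

lemma act_scale_left: "act (scale c Q) f = scale c (act Q f)"
  by (simp add: scale_def act_smult)

lemma act_sum_left: "act (sum F A) f = (\<Sum>a\<in>A. act (F a) f)"
  by (induction A rule: infinite_finite_induct) (simp_all add: act_add_left)

lemma act_xy_mono: "act (xy_mono a b) f = (deriv_x ^^ a) ((deriv_y ^^ b) f)"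
proof -
  have x: "actx (monom 1 a) g = (deriv_x ^^ a) g" for g
    by (induction a) (simp_all add: monom_0 monom_Suc)
  have "act (monom p b) f = actx p ((deriv_y ^^ b) f)" for p
    by (induction b) (simp_all add: monom_0 monom_Suc actx_deriv_y)
  then show ?thesis by (simp add: xy_mono_def x)
qed

lemma act_form:
  assumes "Q \<in> binary_forms n"
  shows "act Q f = (\<Sum>j\<le>n. scale (cf (n - j) j Q) ((deriv_x ^^ (n - j)) ((deriv_y ^^ j) f)))"
proof -
  have "act Q f = act (hom_part n Q) f" using assms by (simp add: hom_part_id)
  then show ?thesis unfolding hom_part_def act_sum_left act_scale_left act_xy_mono .
qed

text \<open>
  The apolarity pairing. On forms of the same degree it is perfect, with the monomials as orthogonal bases.
\<close>

definition pairing :: "bipoly \<Rightarrow> bipoly \<Rightarrow> complex" where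
  "pairing Q f = cf 0 0 (act Q f)"

lemma cf_deriv_x_funpow: "fact i * cf i j ((deriv_x ^^ a) f) = fact (i + a) * cf (i + a) j f"
proof (induction a arbitrary: i)
  case (Suc a)
  have "fact i * cf i j ((deriv_x ^^ Suc a) f) = fact (Suc i) * cf (Suc i) j ((deriv_x ^^ a) f)"
    by (simp add: algebra_simps)
  also have "\<dots> = fact (Suc i + a) * cf (Suc i + a) j f" by (rule Suc)
  finally show ?case by (simp only: add_Suc_shift)
qed simp

lemma cf_deriv_y_funpow: "fact j * cf i j ((deriv_y ^^ b) f) = fact (j + b) * cf i (j + b) f"
proof (induction b arbitrary: j)
  case (Suc b)
  have "fact j * cf i j ((deriv_y ^^ Suc b) f) = fact (Suc j) * cf i (Suc j) ((deriv_y ^^ b) f)"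
    by (simp add: algebra_simps)
  also have "\<dots> = fact (Suc j + b) * cf i (Suc j + b) f" by (rule Suc)
  finally show ?case by (simp only: add_Suc_shift)
qed simp

lemma pairing_xy_mono: "pairing (xy_mono a b) f = fact a * fact b * cf a b f"
  using cf_deriv_x_funpow[of 0 0 a "(deriv_y ^^ b) f"] cf_deriv_y_funpow[of 0 a b f]
  by (simp add: pairing_def act_xy_mono)

lemma pairing_mult: "pairing (P * Q) f = pairing P (act Q f)"
  by (simp add: pairing_def act_mult)

lemma pairing_add_left: "pairing (P + Q) f = pairing P f + pairing Q f"
  and pairing_scale_left: "pairing (scale c Q) f = c * pairing Q f"
  by (simp_all add: pairing_def act_add_left act_scale_left)

lemma pairing_sum_left: "pairing (sum F A) f = (\<Sum>a\<in>A. pairing (F a) f)"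
  by (simp add: pairing_def act_sum_left)

lemma pairing_form:
  assumes "Q \<in> binary_forms n"
  shows "pairing Q f = (\<Sum>j\<le>n. cf (n - j) j Q * (fact (n - j) * fact j * cf (n - j) j f))"
proof -
  have "pairing Q f = pairing (hom_part n Q) f" using assms by (simp add: hom_part_id)
  then show ?thesis unfolding hom_part_def pairing_sum_left pairing_scale_left pairing_xy_mono .
qed

lemma deriv_in_forms_pred:
  assumes "f \<in> binary_forms m"
  shows "deriv_x f \<in> binary_forms (m - 1)" "deriv_y f \<in> binary_forms (m - 1)"
  using assms by (auto simp: binary_forms_iff)

lemma hom_part_act_small:
  assumes "f \<in> binary_forms m" "m < n"
  shows "hom_part n (act Q f) = 0"
proof -
  have x: "hom_part n (actx p f) = 0" if "f \<in> binary_forms m" "m < n" for p f m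
    using that
  proof (induction p arbitrary: f m)
    case (pCons a p)
    have "hom_part n (actx p (deriv_x f)) = 0"
      using pCons.prems by (intro pCons.IH[of _ "m - 1"] deriv_in_forms_pred) auto
    moreover have "hom_part n f = 0" using pCons.prems by (intro hom_part_other) auto
    ultimately show ?case by (simp add: actx_deriv_x[symmetric])
  qed simp
  show ?thesis
    using assms
  proof (induction Q arbitrary: f m)
    case (pCons p Q)
    have "hom_part n (act Q (deriv_y f)) = 0"
      using pCons.prems by (intro pCons.IH[of _ "m - 1"] deriv_in_forms_pred) auto
    then show ?case using x[OF pCons.prems] by (simp add: act_deriv_y[symmetric])
  qed simp
qed

text \<open>
  Components of an operator whose order differs from \<open>j\<close> do not contribute in degree \<open>d\<close>; those of order \<open>j\<close> lead into \<open>T\<close>.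
  The operators are allowed to be inhomogeneous because elements of the coordinate ring are.
\<close>

lemma hom_part_act_prolong:
  assumes T: "cvec.subspace T" "T \<subseteq> binary_forms d" and d: "d > 0" and g: "g \<in> prolong d T j"
  shows "hom_part d (act Q g) \<in> T"
proof -
  have small: "hom_part d (act Q (deriv_x f)) = 0 \<and> hom_part d (act Q (deriv_y f)) = 0" if "f \<in> T" for f Q
    using that T(2) d deriv_in_forms_pred[of f d] by (auto intro!: hom_part_act_small[of _ "d - 1"])
  have self: "hom_part d f \<in> T" if "f \<in> prolong d T j" for f j
  proof (cases j)
    case 0
    then show ?thesis using that T(2) by (auto simp: hom_part_id)
  next
    case (Suc i)
    then have "f \<in> binary_forms (d + j)" using that by simp
    then show ?thesis using Suc hom_part_other[of f "d + j" d] cvec.subspace_0[OF T(1)] by simp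
  qed
  have x: "hom_part d (actx p f) \<in> T" if "f \<in> prolong d T j" for p f j
    using that
  proof (induction p arbitrary: f j)
    case 0
    then show ?case using cvec.subspace_0[OF T(1)] by simp
  next
    case (pCons a p)
    have "hom_part d (actx p (deriv_x f)) \<in> T"
    proof (cases j)
      case 0
      have "act [:p:] (deriv_x f) = actx p (deriv_x f)" by simp
      then show ?thesis using small[of f "[:p:]"] pCons.prems 0 cvec.subspace_0[OF T(1)] by simp
    next
      case (Suc i)
      then show ?thesis using pCons.IH[of "deriv_x f" i] pCons.prems by simp
    qed
    then show ?case
      using self[OF pCons.prems] by (simp add: actx_deriv_x[symmetric] cvec.subspace_add[OF T(1)] cvec.subspace_scale[OF T(1)])
  qed
  show ?thesis
    using g
  proof (induction Q arbitrary: g j)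
    case 0
    then show ?case using cvec.subspace_0[OF T(1)] by simp
  next
    case (pCons p Q)
    have "hom_part d (act Q (deriv_y g)) \<in> T"
    proof (cases j)
      case 0
      then show ?thesis using small[of g Q] pCons.prems cvec.subspace_0[OF T(1)] by simp
    next
      case (Suc i)
      then show ?thesis using pCons.IH[of "deriv_y g" i] pCons.prems by simp
    qed
    then show ?case
      using x[OF pCons.prems] by (simp add: act_deriv_y[symmetric] cvec.subspace_add[OF T(1)])
  qed
qed

section \<open>Powers of linear forms and evaluation\<close>

definition lin_form :: "complex \<Rightarrow> complex \<Rightarrow> bipoly" where
  "lin_form \<alpha> \<beta> = [:[:0, \<alpha>:], [:\<beta>:]:]"

lemma lin_form_mult: "lin_form \<alpha> \<beta> * f = scale \<alpha> (mul_x f) + scale \<beta> (mul_y f)"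
proof -
  have "lin_form \<alpha> \<beta> = Polynomial.smult [:\<alpha>:] [:[:0, 1:]:] + Polynomial.smult [:\<beta>:] [:0, 1:]"
    by (simp add: lin_form_def)
  then show ?thesis
    unfolding mul_x_def mul_y_def scale_def by (simp only: distrib_right mult_smult_left)
qed

lemma cf_lin_form_mult: "cf i j (lin_form \<alpha> \<beta> * f) = \<alpha> * (case i of 0 \<Rightarrow> 0 | Suc k \<Rightarrow> cf k j f) + \<beta> * (case j of 0 \<Rightarrow> 0 | Suc k \<Rightarrow> cf i k f)"
  by (simp add: lin_form_mult cf_mul_x cf_mul_y)

lemma cf_1: "cf i j 1 = (if i = 0 \<and> j = 0 then 1 else 0)"
  by (simp add: cf_def)

lemma cf_lin_form_power: "cf i j (lin_form \<alpha> \<beta> ^ n) = (if i + j = n then of_nat (n choose j) * \<alpha> ^ i * \<beta> ^ j else 0)"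
proof (induction n arbitrary: i j)
  case 0
  then show ?case by (auto simp: cf_1)
next
  case (Suc n)
  have bin: "Suc (i' + j') = n \<Longrightarrow> Suc n choose Suc j' = (n choose j') + (n choose Suc j')" for i' j'
    by simp
  show ?case
  proof (cases i)
    case 0
    then show ?thesis by (cases j) (auto simp: cf_lin_form_mult Suc algebra_simps)
  next
    case i: (Suc i')
    show ?thesis
    proof (cases j)
      case 0
      then show ?thesis using i by (auto simp: cf_lin_form_mult Suc algebra_simps)
    next
      case j: (Suc j')
      show ?thesis using i j by (auto simp: cf_lin_form_mult Suc algebra_simps)
    qed
  qed
qed

lemma lin_form_power_in_forms: "lin_form \<alpha> \<beta> ^ n \<in> binary_forms n"
  by (auto simp: binary_forms_iff cf_lin_form_power)

lemma scale_lin_form_power: "scale (r ^ n) (lin_form \<alpha> \<beta> ^ n) = lin_form (r * \<alpha>) (r * \<beta>) ^ n"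
  by (rule bipoly_eqI) (auto simp: cf_lin_form_power power_mult_distrib power_add[symmetric])

lemma form_1_eq_lin_form: "p \<in> binary_forms 1 \<Longrightarrow> p = lin_form (cf 1 0 p) (cf 0 1 p)"
proof (rule bipoly_eqI)
  fix i j assume p: "p \<in> binary_forms 1"
  have "cf i j (lin_form a b) = (if i + j = 1 then of_nat (1 choose j) * a ^ i * b ^ j else 0)" for a b
    using cf_lin_form_power[of i j a b 1] by simp
  moreover have "i + j = 1 \<longleftrightarrow> (i = 1 \<and> j = 0) \<or> (i = 0 \<and> j = 1)" by auto
  ultimately show "cf i j p = cf i j (lin_form (cf 1 0 p) (cf 0 1 p))"
    using p by (auto simp: binary_forms_iff)
qed

lemma lin_form_in_form_1: "lin_form \<alpha> \<beta> \<in> binary_forms 1"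
  using lin_form_power_in_forms[of \<alpha> \<beta> 1] by simp

lemma lin_form_eq_0_iff: "lin_form \<alpha> \<beta> = 0 \<longleftrightarrow> \<alpha> = 0 \<and> \<beta> = 0"
  by (auto simp: lin_form_def)

lemma deriv_x_lin_form_mult: "deriv_x (lin_form \<alpha> \<beta> * f) = scale \<alpha> f + lin_form \<alpha> \<beta> * deriv_x f"
  by (rule bipoly_eqI, simp only: cf_deriv_x cf_add cf_scale cf_lin_form_mult)
    (auto simp: algebra_simps split: nat.split)

lemma deriv_y_lin_form_mult: "deriv_y (lin_form \<alpha> \<beta> * f) = scale \<beta> f + lin_form \<alpha> \<beta> * deriv_y f"
  by (rule bipoly_eqI, simp only: cf_deriv_y cf_add cf_scale cf_lin_form_mult)
    (auto simp: algebra_simps split: nat.split)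

lemma mult_scale_right: "f * scale c g = scale c (f * g)"
  by (simp add: scale_def)

lemma deriv_x_lin_form_power: "deriv_x (lin_form \<alpha> \<beta> ^ Suc n) = scale (of_nat (Suc n) * \<alpha>) (lin_form \<alpha> \<beta> ^ n)"
proof (induction n)
  case 0
  have "deriv_x 1 = 0" by (rule bipoly_eqI) (simp add: cf_1)
  then show ?case using deriv_x_lin_form_mult[of \<alpha> \<beta> 1] by simp
next
  case (Suc n)
  have "deriv_x (lin_form \<alpha> \<beta> ^ Suc (Suc n)) = scale \<alpha> (lin_form \<alpha> \<beta> ^ Suc n) + scale (of_nat (Suc n) * \<alpha>) (lin_form \<alpha> \<beta> * lin_form \<alpha> \<beta> ^ n)"
    unfolding power_Suc[of _ "Suc n"] deriv_x_lin_form_mult Suc mult_scale_right ..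
  also have "\<dots> = scale (\<alpha> + of_nat (Suc n) * \<alpha>) (lin_form \<alpha> \<beta> ^ Suc n)"
    by (simp add: cvec.scale_left_distrib)
  also have "\<alpha> + of_nat (Suc n) * \<alpha> = of_nat (Suc (Suc n)) * \<alpha>" by (simp add: algebra_simps)
  finally show ?case .
qed

lemma deriv_y_lin_form_power: "deriv_y (lin_form \<alpha> \<beta> ^ Suc n) = scale (of_nat (Suc n) * \<beta>) (lin_form \<alpha> \<beta> ^ n)"
proof (induction n)
  case 0
  have "deriv_y 1 = 0" by (rule bipoly_eqI) (simp add: cf_1)
  then show ?case using deriv_y_lin_form_mult[of \<alpha> \<beta> 1] by simp
next
  case (Suc n)
  have "deriv_y (lin_form \<alpha> \<beta> ^ Suc (Suc n)) = scale \<beta> (lin_form \<alpha> \<beta> ^ Suc n) + scale (of_nat (Suc n) * \<beta>) (lin_form \<alpha> \<beta> * lin_form \<alpha> \<beta> ^ n)"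
    unfolding power_Suc[of _ "Suc n"] deriv_y_lin_form_mult Suc mult_scale_right ..
  also have "\<dots> = scale (\<beta> + of_nat (Suc n) * \<beta>) (lin_form \<alpha> \<beta> ^ Suc n)"
    by (simp add: cvec.scale_left_distrib)
  also have "\<beta> + of_nat (Suc n) * \<beta> = of_nat (Suc (Suc n)) * \<beta>" by (simp add: algebra_simps)
  finally show ?case .
qed

lemma dder_lin_form_power: "dder c (lin_form \<alpha> \<beta> ^ Suc n) = scale (of_nat (Suc n) * (\<alpha> + c * \<beta>)) (lin_form \<alpha> \<beta> ^ n)"
proof -
  have "dder c (lin_form \<alpha> \<beta> ^ Suc n) = scale (of_nat (Suc n) * \<alpha> + c * (of_nat (Suc n) * \<beta>)) (lin_form \<alpha> \<beta> ^ n)"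
    unfolding dder_def deriv_x_lin_form_power deriv_y_lin_form_power cvec.scale_scale cvec.scale_left_distrib ..
  also have "of_nat (Suc n) * \<alpha> + c * (of_nat (Suc n) * \<beta>) = of_nat (Suc n) * (\<alpha> + c * \<beta>)"
    by (simp add: algebra_simps)
  finally show ?thesis .
qed

text \<open>
  The equation \<open>dder c f = 0\<close> is a recursion that determines all coefficients of \<open>f\<close> from that of \<open>y^n\<close>.
\<close>

lemma dder_kernel:
  assumes f: "f \<in> binary_forms n" and 0: "dder c f = 0" and n: "n > 0"
  shows "f = scale (cf 0 n f) (lin_form (- c) 1 ^ n)"
proof -
  obtain m where m: "n = Suc m" using n by (cases n) auto
  define h where "h = f - scale (cf 0 n f) (lin_form (- c) 1 ^ n)"
  have hf: "h \<in> binary_forms n"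
    unfolding h_def using f lin_form_power_in_forms by (intro cvec.subspace_diff cvec.subspace_scale subspace_binary_forms)
  have "dder c h = 0"
    using 0 dder_lin_form_power[of c "- c" 1 m] unfolding h_def m by (simp del: power_Suc)
  then have rec: "of_nat (Suc i) * cf (Suc i) j h + c * (of_nat (Suc j) * cf i (Suc j) h) = 0" for i j
    using arg_cong[of "dder c h" 0 "cf i j"]
    unfolding dder_def cf_add cf_scale cf_deriv_x cf_deriv_y cf_0 by simp
  have "cf i j h = 0" for i j
  proof (induction i arbitrary: j)
    case 0
    show ?case
    proof (cases "j = n")
      case True
      then show ?thesis by (simp add: h_def cf_lin_form_power)
    next
      case False
      then show ?thesis using hf by (simp add: binary_forms_iff)
    qed
  next
    case (Suc i)
    then show ?case using rec[of i j] of_nat_neq_0[of i, where 'a = complex] by (simp del: of_nat_Suc)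
  qed
  then have "h = 0" by (intro bipoly_eqI) simp
  then show ?thesis by (simp add: h_def)
qed

definition form_value :: "bipoly \<Rightarrow> complex \<Rightarrow> complex \<Rightarrow> complex" where
  "form_value Q \<alpha> \<beta> = poly (poly Q [:\<beta>:]) \<alpha>"

lemma form_value_0 [simp]: "form_value 0 \<alpha> \<beta> = 0"
  and form_value_add [simp]: "form_value (P + Q) \<alpha> \<beta> = form_value P \<alpha> \<beta> + form_value Q \<alpha> \<beta>"
  and form_value_diff [simp]: "form_value (P - Q) \<alpha> \<beta> = form_value P \<alpha> \<beta> - form_value Q \<alpha> \<beta>"
  and form_value_mult [simp]: "form_value (P * Q) \<alpha> \<beta> = form_value P \<alpha> \<beta> * form_value Q \<alpha> \<beta>"
  and form_value_power [simp]: "form_value (P ^ n) \<alpha> \<beta> = form_value P \<alpha> \<beta> ^ n"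
  and form_value_scale [simp]: "form_value (scale c Q) \<alpha> \<beta> = c * form_value Q \<alpha> \<beta>"
  and form_value_const [simp]: "form_value [:[:c:]:] \<alpha> \<beta> = c"
  by (simp_all add: form_value_def scale_def)

lemma form_value_sum [simp]: "form_value (sum F A) \<alpha> \<beta> = (\<Sum>a\<in>A. form_value (F a) \<alpha> \<beta>)"
  by (induction A rule: infinite_finite_induct) simp_all

lemma form_value_xy_mono [simp]: "form_value (xy_mono i j) \<alpha> \<beta> = \<alpha> ^ i * \<beta> ^ j"
  by (simp add: form_value_def xy_mono_def poly_monom)

lemma form_value_zero_imp_zero:
  assumes "\<And>\<alpha> \<beta>. \<beta> \<noteq> 0 \<Longrightarrow> form_value Q \<alpha> \<beta> = 0"
  shows "Q = 0"
proof (rule ccontr)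
  assume "Q \<noteq> 0"
  then have fin: "finite {x. poly Q x = 0}" by (rule poly_roots_finite)
  have "poly Q [:\<beta>:] = 0" if "\<beta> \<noteq> 0" for \<beta>
    using assms[OF that] by (simp add: form_value_def poly_all_0_iff_0[symmetric])
  then have "(\<lambda>\<beta>. [:\<beta>:]) ` (- {0}) \<subseteq> {x. poly Q x = 0}" by auto
  then have "finite ((\<lambda>\<beta>::complex. [:\<beta>:]) ` (- {0}))" using fin finite_subset by blast
  then have "finite (- {0::complex})" by (rule finite_imageD) (auto simp: inj_on_def)
  then have "finite (UNIV :: complex set)" by (metis Compl_partition finite.emptyI finite_Un finite_insert)
  then show False using infinite_UNIV_char_0 by blast
qed

lemma form_value_inject: "(\<And>\<alpha> \<beta>. form_value P \<alpha> \<beta> = form_value Q \<alpha> \<beta>) \<Longrightarrow> P = Q"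
  using form_value_zero_imp_zero[of "P - Q"] by simp

lemma form_value_homogeneous:
  assumes "Q \<in> binary_forms n"
  shows "form_value Q (k * \<alpha>) (k * \<beta>) = k ^ n * form_value Q \<alpha> \<beta>"
proof -
  have "form_value Q a b = (\<Sum>j\<le>n. cf (n - j) j Q * (a ^ (n - j) * b ^ j))" for a b
    using hom_part_id[OF assms] by (metis (no_types, lifting) hom_part_def form_value_sum form_value_scale form_value_xy_mono sum.cong)
  moreover have "(k * \<alpha>) ^ (n - j) * (k * \<beta>) ^ j = k ^ n * (\<alpha> ^ (n - j) * \<beta> ^ j)" if "j \<le> n" for j
    using that power_add[of k "n - j" j] by (simp add: power_mult_distrib)
  ultimately show ?thesis by (simp add: sum_distrib_left mult.left_commute)
qed

text \<open>
  Scaling by \<open>2\<close> alone separates the degrees, as the powers of \<open>2\<close> are distinct.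
\<close>

lemma form_if_form_value_homogeneous:
  assumes "\<And>k \<alpha> \<beta>. form_value Q (k * \<alpha>) (k * \<beta>) = k ^ n * form_value Q \<alpha> \<beta>"
  shows "Q \<in> binary_forms n"
  unfolding binary_forms_iff
proof (intro allI impI)
  fix i j assume ij: "i + j \<noteq> n"
  define R where "R i = map_poly (\<lambda>p. coeff p i) Q" for i
  have R: "coeff (poly Q [:\<beta>:]) i = poly (R i) \<beta>" for \<beta>
    unfolding R_def by (induction Q) (simp_all add: map_poly_pCons)
  have "pcompose (poly Q [:2 * \<beta>:]) [:0, 2:] = Polynomial.smult (2 ^ n) (poly Q [:\<beta>:])" for \<beta>
  proof -
    have "poly (pcompose (poly Q [:2 * \<beta>:]) [:0, 2:]) \<alpha> = poly (Polynomial.smult (2 ^ n) (poly Q [:\<beta>:])) \<alpha>" for \<alpha>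
      using assms[of 2 \<alpha> \<beta>] by (simp add: poly_pcompose form_value_def mult.commute)
    then show ?thesis using poly_eq_poly_eq_iff by blast
  qed
  then have "2 ^ i * poly (R i) (2 * \<beta>) = 2 ^ n * poly (R i) \<beta>" for \<beta>
    using R by (metis coeff_pcompose_linear coeff_smult)
  then have "poly (Polynomial.smult (2 ^ i) (pcompose (R i) [:0, 2:])) \<beta> = poly (Polynomial.smult (2 ^ n) (R i)) \<beta>" for \<beta>
    by (simp add: poly_pcompose mult.commute)
  then have "Polynomial.smult (2 ^ i) (pcompose (R i) [:0, 2:]) = Polynomial.smult (2 ^ n) (R i)"
    using poly_eq_poly_eq_iff by blast
  then have "2 ^ i * (2 ^ j * coeff (R i) j) = 2 ^ n * coeff (R i) j"
    by (metis coeff_pcompose_linear coeff_smult)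
  moreover have "coeff (R i) j = cf i j Q" by (simp add: R_def coeff_map_poly cf_def)
  ultimately have "(2 ^ (i + j) - 2 ^ n) * cf i j Q = 0" by (simp add: power_add algebra_simps)
  moreover have "(2::complex) ^ (i + j) \<noteq> 2 ^ n"
  proof
    assume "(2::complex) ^ (i + j) = 2 ^ n"
    then have "of_nat (2 ^ (i + j)) = (of_nat (2 ^ n) :: complex)" by simp
    then show False using ij by (metis of_nat_eq_iff power_inject_exp one_less_numeral_iff semiring_norm(76))
  qed
  ultimately show "cf i j Q = 0" by simp
qed

section \<open>Restriction to the rational normal curve\<close>

text \<open>
  \<open>Q\<close> is the pullback of \<open>F\<close> under the Veronese map, a polynomial in the coefficients of the linear form.
\<close>

definition restricts_to :: "nat \<Rightarrow> (bipoly \<Rightarrow> complex) \<Rightarrow> bipoly \<Rightarrow> bool" where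
  "restricts_to n F Q \<longleftrightarrow> (\<forall>\<alpha> \<beta>. F (lin_form \<alpha> \<beta> ^ n) = form_value Q \<alpha> \<beta>)"

lemma restricts_to_unique: "restricts_to n F P \<Longrightarrow> restricts_to n F Q \<Longrightarrow> P = Q"
  by (rule form_value_inject) (simp add: restricts_to_def)

lemma restricts_to_add: "restricts_to n F P \<Longrightarrow> restricts_to n G Q \<Longrightarrow> restricts_to n (\<lambda>f. F f + G f) (P + Q)"
  and restricts_to_mult: "restricts_to n F P \<Longrightarrow> restricts_to n G Q \<Longrightarrow> restricts_to n (\<lambda>f. F f * G f) (P * Q)"
  by (simp_all add: restricts_to_def)

lemma restricts_to_coord: "i + j = n \<Longrightarrow> restricts_to n (\<lambda>f. coeff (coeff f j) i) (scale (of_nat (n choose j)) (xy_mono i j))"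
  using cf_lin_form_power[of i j _ _ n] by (simp add: restricts_to_def cf_def)

lemma restricts_to_exists: "F \<in> coord_ring n \<Longrightarrow> \<exists>Q. restricts_to n F Q"
proof (induction rule: coord_ring.induct)
  case (const c)
  have "restricts_to n (\<lambda>_. c) [:[:c:]:]" by (simp add: restricts_to_def)
  then show ?case by blast
qed (blast intro: restricts_to_coord restricts_to_add restricts_to_mult)+

lemma functional_hom_part:
  assumes "linear_functional \<phi>"
  shows "\<phi> (hom_part n f) = (\<Sum>j\<le>n. cf (n - j) j f * \<phi> (xy_mono (n - j) j))"
  unfolding hom_part_def linear_functional_sum[OF assms] linear_functional_scale[OF assms] ..

lemma coord_ring_sum: "(\<And>a. a \<in> A \<Longrightarrow> F a \<in> coord_ring n) \<Longrightarrow> (\<lambda>f. \<Sum>a\<in>A. F a f) \<in> coord_ring n"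
  by (induction A rule: infinite_finite_induct) (auto intro: coord_ring.const coord_ring.add)

lemma coord_ring_prod: "(\<And>a. a \<in> A \<Longrightarrow> F a \<in> coord_ring n) \<Longrightarrow> (\<lambda>f. \<Prod>a\<in>A. F a f) \<in> coord_ring n"
  by (induction A rule: infinite_finite_induct) (auto intro: coord_ring.const coord_ring.mult)

lemma functional_in_coord_ring:
  assumes "linear_functional \<phi>"
  shows "(\<lambda>f. \<phi> (hom_part n f)) \<in> coord_ring n"
  unfolding functional_hom_part[OF assms]
proof (rule coord_ring_sum)
  fix j assume "j \<in> {..n}"
  then have "(\<lambda>f. cf (n - j) j f) \<in> coord_ring n"
    unfolding cf_def by (intro coord_ring.coord) simp
  then show "(\<lambda>f. cf (n - j) j f * \<phi> (xy_mono (n - j) j)) \<in> coord_ring n"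
    by (intro coord_ring.mult coord_ring.const)
qed

text \<open>
  Apolarity: as a differential operator, the restriction of a linear form on \<open>S^n U\<close> to the curve gives back
  this linear form up to the factor \<open>n!\<close>.
\<close>

lemma functional_restricts_to:
  assumes \<phi>: "linear_functional \<phi>" and Q: "restricts_to n (\<lambda>f. \<phi> (hom_part n f)) Q"
  shows "Q \<in> binary_forms n" "pairing Q f = fact n * \<phi> (hom_part n f)"
proof -
  define P where "P = (\<Sum>j\<le>n. scale (of_nat (n choose j) * \<phi> (xy_mono (n - j) j)) (xy_mono (n - j) j))"
  have "restricts_to n (\<lambda>f. \<phi> (hom_part n f)) P"
    unfolding restricts_to_def functional_hom_part[OF \<phi>] P_def
    by (auto simp: cf_lin_form_power mult_ac intro!: sum.cong)
  then have PQ: "Q = P" using restricts_to_unique Q by blast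
  show "Q \<in> binary_forms n"
    unfolding PQ P_def
    by (intro cvec.subspace_sum cvec.subspace_scale subspace_binary_forms xy_mono_in_binary_forms) auto
  have bin: "of_nat (n choose j) * (fact (n - j) * fact j) = (fact n :: complex)" if "j \<le> n" for j
  proof -
    have "fact j * fact (n - j) * (n choose j) = (fact n :: nat)" using binomial_fact_lemma[OF that] .
    then have "of_nat (fact j * fact (n - j) * (n choose j)) = (of_nat (fact n) :: complex)" by simp
    then show ?thesis by (simp add: mult_ac)
  qed
  have "pairing P f = (\<Sum>j\<le>n. (of_nat (n choose j) * (fact (n - j) * fact j)) * (cf (n - j) j f * \<phi> (xy_mono (n - j) j)))"
    unfolding P_def pairing_sum_left pairing_scale_left pairing_xy_mono by (simp add: mult_ac)
  also have "\<dots> = (\<Sum>j\<le>n. fact n * (cf (n - j) j f * \<phi> (xy_mono (n - j) j)))"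
    using bin by (intro sum.cong) auto
  also have "\<dots> = fact n * \<phi> (hom_part n f)"
    unfolding functional_hom_part[OF \<phi>] sum_distrib_left ..
  finally show "pairing Q f = fact n * \<phi> (hom_part n f)" unfolding PQ .
qed

lemma restricts_to_by_functional:
  assumes "Q \<in> binary_forms n"
  shows "\<exists>\<phi>. linear_functional \<phi> \<and> restricts_to n (\<lambda>f. \<phi> (hom_part n f)) Q"
proof -
  define \<phi> where "\<phi> f = (\<Sum>j\<le>n. cf (n - j) j Q / of_nat (n choose j) * cf (n - j) j f)" for f
  have lin: "linear_functional \<phi>"
    unfolding linear_functional_def \<phi>_def
    by (simp add: algebra_simps sum.distrib sum_distrib_left)
  have "form_value (hom_part n Q) \<alpha> \<beta> = (\<Sum>j\<le>n. cf (n - j) j Q * (\<alpha> ^ (n - j) * \<beta> ^ j))" for \<alpha> \<beta>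
    unfolding hom_part_def form_value_sum form_value_scale form_value_xy_mono ..
  then have "\<phi> (hom_part n (lin_form \<alpha> \<beta> ^ n)) = form_value (hom_part n Q) \<alpha> \<beta>" for \<alpha> \<beta>
    unfolding hom_part_id[OF lin_form_power_in_forms] \<phi>_def
    by (auto simp: cf_lin_form_power intro!: sum.cong)
  then have "restricts_to n (\<lambda>f. \<phi> (hom_part n f)) Q"
    using hom_part_id[OF assms] by (simp add: restricts_to_def)
  with lin show ?thesis by blast
qed

text \<open>
  Otherwise \<open>T\<close> would contain the powers \<open>(y - c x)^d\<close> for all \<open>c\<close>. The restriction to the curve of a linear
  form that vanishes on \<open>T\<close> would then be zero, and so would be the linear form itself, although \<open>T\<close> is proper.
\<close>

lemma transversal_exists:
  assumes "d > 0" "cvec.subspace T" "T \<subset> binary_forms d"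
  shows "\<exists>c. transversal d T c"
proof (rule ccontr)
  assume no: "\<not> ?thesis"
  obtain h where h: "h \<in> binary_forms d" "h \<notin> T" using assms by blast
  obtain \<phi> where \<phi>: "linear_functional \<phi>" "\<And>x. x \<in> T \<Longrightarrow> \<phi> x = 0" "\<phi> h = 1"
    using functional_separates[OF assms(2) h(2)] by metis
  obtain Q where Q: "restricts_to d (\<lambda>f. \<phi> (hom_part d f)) Q"
    using restricts_to_exists[OF functional_in_coord_ring[OF \<phi>(1)]] by blast
  have zero: "form_value Q (- c) 1 = 0" for c
  proof -
    have "\<not> transversal d T c" using no by blast
    then obtain f where f: "f \<in> T" "dder c f = 0" "f \<noteq> 0"
      using assms unfolding transversal_def by blast
    have fd: "f \<in> binary_forms d" using f assms by blast
    have eq: "f = scale (cf 0 d f) (lin_form (- c) 1 ^ d)"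
      using dder_kernel[OF fd f(2) assms(1)] .
    then have "cf 0 d f \<noteq> 0" using f(3) by (metis cvec.scale_zero_left)
    then have "lin_form (- c) 1 ^ d = scale (1 / cf 0 d f) f"
      by (subst eq) simp
    then have "lin_form (- c) 1 ^ d \<in> T" using f(1) assms(2) cvec.subspace_scale by metis
    then have "\<phi> (hom_part d (lin_form (- c) 1 ^ d)) = 0"
      using \<phi>(2) by (simp add: hom_part_id lin_form_power_in_forms)
    then show ?thesis using Q unfolding restricts_to_def by metis
  qed
  have "Q = 0"
  proof (rule form_value_zero_imp_zero)
    fix \<alpha> \<beta> :: complex assume "\<beta> \<noteq> 0"
    then have "form_value Q \<alpha> \<beta> = \<beta> ^ d * form_value Q (\<alpha> / \<beta>) 1"
      using form_value_homogeneous[OF functional_restricts_to(1)[OF \<phi>(1) Q], of \<beta> "\<alpha> / \<beta>" 1] by simp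
    then show "form_value Q \<alpha> \<beta> = 0" using zero[of "- (\<alpha> / \<beta>)"] by simp
  qed
  then have "fact d * \<phi> (hom_part d h) = 0"
    using functional_restricts_to(2)[OF \<phi>(1) Q, of h] by (simp add: pairing_def)
  then show False using \<phi>(3) h(1) by (simp add: hom_part_id)
qed

section \<open>Homogeneous ideals and the curve section\<close>

lemma proj_point_in_iff:
  assumes "cvec.subspace V"
  shows "proj_point v \<in> proj_space V \<longleftrightarrow> v \<in> V \<and> v \<noteq> 0"
proof -
  have vin: "v \<in> proj_point v" by (simp add: proj_point_def cvec.span_base)
  have dim: "cvec.dim (proj_point v) = (if v = 0 then 0 else 1)"
  proof (cases "v = 0")
    case True
    have "cvec.dim (cvec.span {}) = card ({} :: bipoly set)" by (rule cvec.dim_span_eq_card_independent[OF cvec.independent_empty])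
    then show ?thesis using True by (simp add: proj_point_def)
  next
    case False
    then have "cvec.independent {v}" by simp
    then have "cvec.dim (cvec.span {v}) = card {v}" by (rule cvec.dim_span_eq_card_independent)
    then show ?thesis using False by (simp add: proj_point_def)
  qed
  have "proj_point v \<subseteq> V" if "v \<in> V"
    unfolding proj_point_def using that assms by (intro cvec.span_minimal) auto
  moreover have "cvec.subspace (proj_point v)" by (simp add: proj_point_def)
  ultimately show ?thesis
    using dim vin by (auto simp: proj_space_def split: if_splits)
qed

lemma proj_space_nonzero:
  assumes "L \<in> proj_space V"
  shows "\<exists>v\<in>L. v \<noteq> 0"
proof (rule ccontr)
  assume "\<not> ?thesis"
  then have "L \<subseteq> cvec.span {}" by auto
  then have "cvec.dim L \<le> card ({} :: bipoly set)" by (intro cvec.dim_le_card) auto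
  then show False using assms by (simp add: proj_space_def)
qed

lemma mem_proj_space:
  assumes "cvec.subspace V" "v \<in> V" "V \<noteq> {0}"
  shows "\<exists>L\<in>proj_space V. v \<in> L"
proof (cases "v = 0")
  case False
  then have "proj_point v \<in> proj_space V" using assms proj_point_in_iff by blast
  moreover have "v \<in> proj_point v" by (simp add: proj_point_def cvec.span_base)
  ultimately show ?thesis by blast
next
  case True
  obtain w where "w \<in> V" "w \<noteq> 0" using assms cvec.subspace_0 by blast
  then have "proj_point w \<in> proj_space V" using assms proj_point_in_iff by blast
  moreover have "v \<in> proj_point w" using True by (simp add: proj_point_def cvec.span_zero)
  ultimately show ?thesis by blast
qed

lemma vanishing_ideal_linear:
  assumes "linear_functional \<phi>" "\<And>x. x \<in> V \<Longrightarrow> \<phi> x = 0" "V \<subseteq> binary_forms d"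
  shows "(\<lambda>f. \<phi> (hom_part d f)) \<in> vanishing_ideal d (proj_space V)"
proof -
  have "\<phi> (hom_part d v) = 0" if "L \<in> proj_space V" "v \<in> L" for L v
  proof -
    have "v \<in> V" using that by (auto simp: proj_space_def)
    then show ?thesis using assms by (auto simp: hom_part_id)
  qed
  then show ?thesis
    unfolding vanishing_ideal_def using functional_in_coord_ring[OF assms(1)] by blast
qed

text \<open>
  The vanishing ideal of a linear subspace is generated by linear forms: with a projection \<open>P\<close> onto \<open>V\<close>, every
  difference \<open>F - F o P\<close> is in the ideal generated by the linear forms that vanish on \<open>V\<close>, by
  induction over the construction of \<open>F\<close>, and \<open>F o P = 0\<close> for an \<open>F\<close> that vanishes on \<open>V\<close>. For \<open>V = 0\<close> the
  projective space is empty and the constants belong to the ideal as well.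
\<close>

lemma vanishing_ideal_generated:
  assumes V: "cvec.subspace V" "V \<subseteq> binary_forms d" "V \<noteq> {0}"
    and F: "F \<in> vanishing_ideal d (proj_space V)"
    and add: "\<And>F G. K F \<Longrightarrow> K G \<Longrightarrow> K (\<lambda>f. F f + G f)"
    and mult: "\<And>F G. K F \<Longrightarrow> G \<in> coord_ring d \<Longrightarrow> K (\<lambda>f. F f * G f)"
    and lin: "\<And>\<phi>. linear_functional \<phi> \<Longrightarrow> (\<And>x. x \<in> V \<Longrightarrow> \<phi> x = 0) \<Longrightarrow> K (\<lambda>f. \<phi> (hom_part d f))"
  shows "K F"
proof -
  obtain P where P: "Vector_Spaces.linear scale scale P" "\<And>x. P x \<in> V" "\<And>x. x \<in> V \<Longrightarrow> P x = x"
    using projection_exists[OF V(1)] by metis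
  define R where "R f = P (hom_part d f)" for f
  have coord_in: "(\<lambda>f. cf i j (R f)) \<in> coord_ring d" for i j
  proof -
    have "linear_functional (\<lambda>f. cf i j (P f))"
      using P(1) by (simp add: linear_functional_def linear_iff_cvec)
    then show ?thesis unfolding R_def by (rule functional_in_coord_ring)
  qed
  have claim: "K (\<lambda>f. F f - F (R f)) \<and> (\<lambda>f. F (R f)) \<in> coord_ring d" if "F \<in> coord_ring d" for F
    using that
  proof (induction rule: coord_ring.induct)
    case (const c)
    have "K (\<lambda>f. 0)" using lin[of "\<lambda>_. 0"] by (simp add: linear_functional_def)
    then show ?case by (simp add: coord_ring.const)
  next
    case (coord i j)
    have "linear_functional (\<lambda>f. cf i j f - cf i j (P f))"
      using P(1) by (simp add: linear_functional_def linear_iff_cvec algebra_simps)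
    then have "K (\<lambda>f. cf i j (hom_part d f) - cf i j (P (hom_part d f)))"
      using lin[of "\<lambda>f. cf i j f - cf i j (P f)"] P(3) by simp
    then show ?case using coord coord_in[of i j] by (simp add: cf_hom_part R_def cf_def[symmetric])
  next
    case (add F G)
    have "K (\<lambda>f. (F f - F (R f)) + (G f - G (R f)))"
      using add.IH assms(5) by blast
    then show ?case using add.IH by (auto simp: algebra_simps intro: coord_ring.add)
  next
    case (mult F G)
    have "K (\<lambda>f. (F f - F (R f)) * G f)" "K (\<lambda>f. (G f - G (R f)) * F (R f))"
      using mult.IH mult.hyps assms(6) by blast+
    then have "K (\<lambda>f. (F f - F (R f)) * G f + (G f - G (R f)) * F (R f))"
      using assms(5) by blast
    then show ?case using mult.IH by (auto simp: algebra_simps intro: coord_ring.mult)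
  qed
  have R0: "F (R f) = 0" for f
    using mem_proj_space[OF V(1) P(2) V(3), of "hom_part d f"] F unfolding vanishing_ideal_def R_def by blast
  have "F \<in> coord_ring d" using F by (simp add: vanishing_ideal_def)
  then have "K (\<lambda>f. F f - F (R f))" using claim by blast
  then show ?thesis unfolding R0 by simp
qed

lemma complex_root: "n > 0 \<Longrightarrow> \<exists>r::complex. r ^ n = k"
proof -
  assume n: "n > 0"
  have "rcis (root n (cmod k)) (Arg k / n) ^ n = rcis (root n (cmod k) ^ n) (real n * (Arg k / n))"
    by (rule DeMoivre2)
  also have "\<dots> = k" using n by (simp add: rcis_cmod_Arg)
  finally show ?thesis by blast
qed

text \<open>
  Every multiple of a d-th power of a linear form is itself such a power, as complex numbers have d-th roots;
  so the affine cone over the curve is the image of the Veronese map.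
\<close>

lemma curve_ideal_iff:
  assumes "d > 0" "F \<in> coord_ring d"
  shows "F \<in> vanishing_ideal d (rational_normal_curve d) \<longleftrightarrow> (\<forall>\<alpha> \<beta>. F (lin_form \<alpha> \<beta> ^ d) = 0)"
proof
  assume F: "F \<in> vanishing_ideal d (rational_normal_curve d)"
  show "\<forall>\<alpha> \<beta>. F (lin_form \<alpha> \<beta> ^ d) = 0"
  proof (intro allI)
    fix \<alpha> \<beta>
    have vin: "proj_point (p ^ d) \<in> rational_normal_curve d" if "p \<in> binary_forms 1" "p \<noteq> 0" for p
      using that proj_point_in_iff[OF subspace_binary_forms] unfolding rational_normal_curve_def by blast
    show "F (lin_form \<alpha> \<beta> ^ d) = 0"
    proof (cases "lin_form \<alpha> \<beta> = 0")
      case True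
      have "0 \<in> proj_point (lin_form 1 0 ^ d)" by (simp add: proj_point_def cvec.span_zero)
      then have "F 0 = 0"
        using F vin[of "lin_form 1 0"] lin_form_in_form_1 lin_form_eq_0_iff unfolding vanishing_ideal_def by force
      then show ?thesis using True assms(1) by (simp add: zero_power)
    next
      case False
      have "lin_form \<alpha> \<beta> ^ d \<in> proj_point (lin_form \<alpha> \<beta> ^ d)" by (simp add: proj_point_def cvec.span_base)
      then show ?thesis using F vin[OF lin_form_in_form_1 False] unfolding vanishing_ideal_def by blast
    qed
  qed
next
  assume F: "\<forall>\<alpha> \<beta>. F (lin_form \<alpha> \<beta> ^ d) = 0"
  have "F v = 0" if L: "L \<in> rational_normal_curve d" and v: "v \<in> L" for L v
  proof -
    obtain p where p: "L = proj_point (p ^ d)" "p \<in> binary_forms 1"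
      using L proj_point_in_iff[OF subspace_binary_forms] unfolding rational_normal_curve_def by blast
    then obtain \<alpha> \<beta> where lin_form: "p = lin_form \<alpha> \<beta>" using form_1_eq_lin_form by blast
    obtain k where k: "v = scale k (p ^ d)" using v p(1) by (auto simp: proj_point_def cvec.span_singleton)
    obtain r where "r ^ d = k" using complex_root[OF assms(1)] by blast
    then have "v = lin_form (r * \<alpha>) (r * \<beta>) ^ d" using k lin_form scale_lin_form_power by metis
    then show ?thesis using F by simp
  qed
  then show "F \<in> vanishing_ideal d (rational_normal_curve d)"
    using assms(2) unfolding vanishing_ideal_def by blast
qed

lemma vanishing_ideal_add:
  "F \<in> vanishing_ideal d X \<Longrightarrow> G \<in> vanishing_ideal d X \<Longrightarrow> (\<lambda>f. F f + G f) \<in> vanishing_ideal d X"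
  by (simp add: vanishing_ideal_def coord_ring.add)

lemma vanishing_ideal_mult:
  "F \<in> vanishing_ideal d X \<Longrightarrow> G \<in> coord_ring d \<Longrightarrow> (\<lambda>f. F f * G f) \<in> vanishing_ideal d X"
  by (simp add: vanishing_ideal_def coord_ring.mult)

lemma section_ideal_memI:
  assumes "F \<in> vanishing_ideal d (proj_space T)" "G \<in> vanishing_ideal d (rational_normal_curve d)"
  shows "(\<lambda>f. F f + G f) \<in> curve_section_ideal d T"
  unfolding curve_section_ideal_def ideal_plus_def
  by (rule CollectI, rule exI[of _ F], rule exI[of _ G]) (simp add: assms)

lemma section_ideal_memE:
  assumes "H \<in> curve_section_ideal d T"
  obtains F G where "H = (\<lambda>f. F f + G f)" "F \<in> vanishing_ideal d (proj_space T)"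
    "G \<in> vanishing_ideal d (rational_normal_curve d)"
  using assms unfolding curve_section_ideal_def ideal_plus_def by blast

lemma section_ideal_add:
  assumes "F \<in> curve_section_ideal d T" "G \<in> curve_section_ideal d T"
  shows "(\<lambda>f. F f + G f) \<in> curve_section_ideal d T"
proof -
  obtain F1 F2 where F: "F = (\<lambda>f. F1 f + F2 f)" "F1 \<in> vanishing_ideal d (proj_space T)"
    "F2 \<in> vanishing_ideal d (rational_normal_curve d)"
    by (rule section_ideal_memE[OF assms(1)])
  obtain G1 G2 where G: "G = (\<lambda>f. G1 f + G2 f)" "G1 \<in> vanishing_ideal d (proj_space T)"
    "G2 \<in> vanishing_ideal d (rational_normal_curve d)"
    by (rule section_ideal_memE[OF assms(2)])
  have "(\<lambda>f. F f + G f) = (\<lambda>f. (F1 f + G1 f) + (F2 f + G2 f))"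
    using F(1) G(1) by (simp add: algebra_simps)
  then show ?thesis
    using section_ideal_memI[OF vanishing_ideal_add[OF F(2) G(2)] vanishing_ideal_add[OF F(3) G(3)]] by simp
qed

lemma section_ideal_mult:
  assumes "F \<in> curve_section_ideal d T" "G \<in> coord_ring d"
  shows "(\<lambda>f. F f * G f) \<in> curve_section_ideal d T"
proof -
  obtain F1 F2 where F: "F = (\<lambda>f. F1 f + F2 f)" "F1 \<in> vanishing_ideal d (proj_space T)"
    "F2 \<in> vanishing_ideal d (rational_normal_curve d)"
    by (rule section_ideal_memE[OF assms(1)])
  have "(\<lambda>f. F f * G f) = (\<lambda>f. F1 f * G f + F2 f * G f)"
    using F(1) by (simp add: algebra_simps)
  then show ?thesis
    using section_ideal_memI[OF vanishing_ideal_mult[OF F(2) assms(2)] vanishing_ideal_mult[OF F(3) assms(2)]] by simp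
qed

lemma coord_ring_diff:
  assumes "F \<in> coord_ring n" "G \<in> coord_ring n"
  shows "(\<lambda>f. F f - G f) \<in> coord_ring n"
proof -
  have "(\<lambda>f. F f + (-1) * G f) \<in> coord_ring n"
    using assms by (intro coord_ring.intros)
  then show ?thesis by simp
qed

lemma section_idealI:
  assumes "d > 0" "G \<in> coord_ring d" "restricts_to d G Q" "F \<in> vanishing_ideal d (proj_space T)" "restricts_to d F Q"
  shows "G \<in> curve_section_ideal d T"
proof -
  have "F \<in> coord_ring d" using assms(4) by (simp add: vanishing_ideal_def)
  then have "(\<lambda>f. G f - F f) \<in> coord_ring d" using assms(2) by (intro coord_ring_diff)
  then have "(\<lambda>f. G f - F f) \<in> vanishing_ideal d (rational_normal_curve d)"
    using assms(3,5) by (simp add: curve_ideal_iff[OF assms(1)] restricts_to_def)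
  from section_ideal_memI[OF assms(4) this] show ?thesis by simp
qed

lemma homogeneous_restricts_to:
  assumes "G \<in> homogeneous d k" "restricts_to d G Q"
  shows "Q \<in> binary_forms (d * k)"
proof (rule form_if_form_value_homogeneous)
  fix a \<alpha> \<beta>
  have "form_value Q (a * \<alpha>) (a * \<beta>) = G (scale (a ^ d) (lin_form \<alpha> \<beta> ^ d))"
    using assms(2) by (simp add: restricts_to_def scale_lin_form_power)
  also have "\<dots> = (a ^ d) ^ k * G (lin_form \<alpha> \<beta> ^ d)"
    using assms(1) by (simp add: homogeneous_def)
  finally show "form_value Q (a * \<alpha>) (a * \<beta>) = a ^ (d * k) * form_value Q \<alpha> \<beta>"
    using assms(2) by (simp add: restricts_to_def power_mult)
qed

lemma mult_xy_mono: "xy_mono a b * xy_mono a' b' = xy_mono (a + a') (b + b')"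
  by (simp add: xy_mono_def mult_monom)

lemma monomial_restricts_to:
  assumes "a + b = d * N"
  shows "\<exists>M\<in>coord_ring d. restricts_to d M (xy_mono a b)"
  using assms
proof (induction N arbitrary: a b)
  case 0
  have "xy_mono 0 0 = 1" by (simp add: xy_mono_def)
  then have "restricts_to d (\<lambda>_. 1) (xy_mono a b)" using 0 by (simp add: restricts_to_def form_value_def)
  then show ?case using coord_ring.const by blast
next
  case (Suc N)
  define a1 where "a1 = min a d"
  define b1 where "b1 = d - a1"
  have b1: "b1 \<le> b" "a1 \<le> a" "a1 + b1 = d" using Suc.prems by (auto simp: a1_def b1_def min_def)
  have "(a - a1) + (b - b1) = d * N" using b1 Suc.prems by simp
  then obtain M where M: "M \<in> coord_ring d" "restricts_to d M (xy_mono (a - a1) (b - b1))" using Suc.IH by blast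
  obtain \<phi> where \<phi>: "linear_functional \<phi>" "restricts_to d (\<lambda>f. \<phi> (hom_part d f)) (xy_mono a1 b1)"
    using restricts_to_by_functional[OF xy_mono_in_binary_forms[OF b1(3)]] by blast
  have "xy_mono a b = xy_mono a1 b1 * xy_mono (a - a1) (b - b1)"
    using b1 by (simp add: mult_xy_mono)
  then have "restricts_to d (\<lambda>f. \<phi> (hom_part d f) * M f) (xy_mono a b)"
    using restricts_to_mult[OF \<phi>(2) M(2)] by simp
  moreover have "(\<lambda>f. \<phi> (hom_part d f) * M f) \<in> coord_ring d"
    using M(1) functional_in_coord_ring[OF \<phi>(1)] by (intro coord_ring.mult)
  ultimately show ?case by (rule_tac bexI)
qed

lemma prolongI:
  assumes "g \<in> binary_forms (d + j)" "\<And>a b. a + b = j \<Longrightarrow> (deriv_x ^^ a) ((deriv_y ^^ b) g) \<in> T"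
  shows "g \<in> prolong d T j"
  using assms
proof (induction j arbitrary: g)
  case 0
  then show ?case using 0(2)[of 0 0] by simp
next
  case (Suc j)
  have f: "deriv_x g \<in> binary_forms (d + j)" "deriv_y g \<in> binary_forms (d + j)"
    using Suc.prems(1) by (auto intro: deriv_in_binary_forms)
  have "deriv_x g \<in> prolong d T j"
  proof (rule Suc.IH[OF f(1)])
    fix a b assume "a + b = j"
    moreover have "(deriv_x ^^ a) ((deriv_y ^^ b) (deriv_x g)) = (deriv_x ^^ Suc a) ((deriv_y ^^ b) g)"
      using funpow_commute1[of deriv_y deriv_x b g] deriv_xy_commute by (simp add: funpow_swap1)
    ultimately show "(deriv_x ^^ a) ((deriv_y ^^ b) (deriv_x g)) \<in> T"
      using Suc.prems(2)[of "Suc a" b] by simp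
  qed
  moreover have "deriv_y g \<in> prolong d T j"
  proof (rule Suc.IH[OF f(2)])
    fix a b assume "a + b = j"
    then show "(deriv_x ^^ a) ((deriv_y ^^ b) (deriv_y g)) \<in> T"
      using Suc.prems(2)[of a "Suc b"] by (simp add: funpow_swap1)
  qed
  ultimately show ?case using Suc.prems(1) by simp
qed

lemma deriv_prolong: "g \<in> prolong d T (a + b) \<Longrightarrow> (deriv_x ^^ a) ((deriv_y ^^ b) g) \<in> T"
proof (induction b arbitrary: g)
  case 0
  then show ?case
  proof (induction a arbitrary: g)
    case (Suc a)
    then have "(deriv_x ^^ a) (deriv_x g) \<in> T" by simp
    then show ?case by (simp add: funpow_swap1)
  qed simp
next
  case (Suc b)
  then have "(deriv_x ^^ a) ((deriv_y ^^ b) (deriv_y g)) \<in> T" by simp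
  then show ?case by (simp add: funpow_swap1)
qed

lemma prolong_binary_forms: "prolong d (binary_forms d) j = binary_forms (d + j)"
  by (induction j) (auto intro: deriv_in_binary_forms)

text \<open>
  In degree \<open>d + d N\<close> the vanishing ideal of the projective space of \<open>T\<close>, restricted to the curve, contains the whole annihilator of
  the prolongation of order \<open>d N\<close>. Here duality is used twice: a form outside the ideal is detected by some \<open>g\<close>
  that is apolar to the ideal, and the derivatives of order \<open>d N\<close> of such a \<open>g\<close> are annihilated by all linear
  forms that vanish on \<open>T\<close>, hence lie in \<open>T\<close>.
\<close>

lemma form_kills_prolong_restricts_to:
  assumes d: "d > 0" and T: "cvec.subspace T" "T \<subseteq> binary_forms d"
    and Q: "Q \<in> binary_forms (d + d * N)" and kill: "\<And>g. g \<in> prolong d T (d * N) \<Longrightarrow> pairing Q g = 0"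
  shows "\<exists>F\<in>vanishing_ideal d (proj_space T). restricts_to d F Q"
proof (rule ccontr)
  assume no: "\<not> ?thesis"
  let ?I = "vanishing_ideal d (proj_space T)"
  let ?m = "d + d * N"
  define V where "V = {Q. \<exists>F\<in>?I. restricts_to d F Q}"
  have zero: "(\<lambda>_. 0) \<in> ?I" by (simp add: vanishing_ideal_def coord_ring.const)
  have "cvec.subspace V"
  proof (rule cvec.subspaceI)
    have "restricts_to d (\<lambda>_. 0) 0" by (simp add: restricts_to_def)
    then show "0 \<in> V" using zero unfolding V_def by blast
  next
    fix P Q assume "P \<in> V" "Q \<in> V"
    then obtain F G where "F \<in> ?I" "restricts_to d F P" "G \<in> ?I" "restricts_to d G Q" unfolding V_def by blast
    then show "P + Q \<in> V" unfolding V_def using vanishing_ideal_add restricts_to_add by blast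
  next
    fix c P assume "P \<in> V"
    then obtain F where F: "F \<in> ?I" "restricts_to d F P" unfolding V_def by blast
    have "(\<lambda>f. F f * c) \<in> ?I" using F(1) coord_ring.const by (intro vanishing_ideal_mult)
    moreover have "restricts_to d (\<lambda>f. F f * c) (scale c P)" using F(2) by (simp add: restricts_to_def)
    ultimately show "scale c P \<in> V" unfolding V_def by blast
  qed
  moreover have "Q \<notin> V" using no unfolding V_def by blast
  ultimately obtain \<psi> where \<psi>: "linear_functional \<psi>" "\<And>x. x \<in> V \<Longrightarrow> \<psi> x = 0" "\<psi> Q = 1"
    by (rule functional_separates) blast
  \<comment> \<open>The form that represents \<open>\<psi>\<close> under the apolarity pairing.\<close>
  define g where "g = (\<Sum>j\<le>?m. scale (\<psi> (xy_mono (?m - j) j) / (fact (?m - j) * fact j)) (xy_mono (?m - j) j))"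
  have gf: "g \<in> binary_forms ?m"
    unfolding g_def
    by (intro cvec.subspace_sum cvec.subspace_scale subspace_binary_forms xy_mono_in_binary_forms) auto
  have cfg: "cf (?m - j) j g = \<psi> (xy_mono (?m - j) j) / (fact (?m - j) * fact j)" if "j \<le> ?m" for j
  proof -
    have "cf (?m - j) j g = (\<Sum>k\<le>?m. if k = j then \<psi> (xy_mono (?m - j) j) / (fact (?m - j) * fact j) else 0)"
      unfolding g_def cf_sum by (intro sum.cong) auto
    then show ?thesis using that by simp
  qed
  have pair: "pairing P g = \<psi> P" if "P \<in> binary_forms ?m" for P
  proof -
    have "pairing P g = (\<Sum>j\<le>?m. cf (?m - j) j P * \<psi> (xy_mono (?m - j) j))"
      unfolding pairing_form[OF that] using cfg by (intro sum.cong) simp_all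
    also have "\<dots> = \<psi> (hom_part ?m P)" by (rule functional_hom_part[OF \<psi>(1), symmetric])
    finally show ?thesis using hom_part_id[OF that] by simp
  qed
  have "g \<in> prolong d T (d * N)"
  proof (rule prolongI[OF gf])
    fix a b assume ab: "a + b = d * N"
    let ?h = "(deriv_x ^^ a) ((deriv_y ^^ b) g)"
    have hf: "?h \<in> binary_forms d"
      using deriv_prolong[of g d "binary_forms d" a b] gf ab by (simp add: prolong_binary_forms)
    show "?h \<in> T"
    proof (rule ccontr)
      assume "?h \<notin> T"
      obtain \<phi> where \<phi>: "linear_functional \<phi>" "\<And>x. x \<in> T \<Longrightarrow> \<phi> x = 0" "\<phi> ?h = 1"
        by (rule functional_separates[OF T(1) \<open>?h \<notin> T\<close>]) blast
      obtain R where R: "restricts_to d (\<lambda>f. \<phi> (hom_part d f)) R"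
        using restricts_to_exists[OF functional_in_coord_ring[OF \<phi>(1)]] by blast
      obtain M where M: "M \<in> coord_ring d" "restricts_to d M (xy_mono a b)" using monomial_restricts_to[OF ab] by blast
      have "(\<lambda>f. \<phi> (hom_part d f) * M f) \<in> ?I"
        using vanishing_ideal_linear[OF \<phi>(1,2) T(2)] M(1) by (intro vanishing_ideal_mult)
      then have "R * xy_mono a b \<in> V"
        unfolding V_def using restricts_to_mult[OF R M(2)] by blast
      moreover have "R * xy_mono a b \<in> binary_forms ?m"
      proof (rule form_if_form_value_homogeneous)
        fix k \<alpha> \<beta>
        show "form_value (R * xy_mono a b) (k * \<alpha>) (k * \<beta>) = k ^ ?m * form_value (R * xy_mono a b) \<alpha> \<beta>"
          using form_value_homogeneous[OF functional_restricts_to(1)[OF \<phi>(1) R], of k \<alpha> \<beta>]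
            form_value_homogeneous[OF xy_mono_in_binary_forms[OF ab], of k \<alpha> \<beta>]
          by (simp add: power_add mult_ac)
      qed
      ultimately have "pairing (R * xy_mono a b) g = 0" using pair \<psi>(2) by simp
      then have "fact d * \<phi> (hom_part d ?h) = 0"
        using functional_restricts_to(2)[OF \<phi>(1) R, of ?h] by (simp add: pairing_mult act_xy_mono)
      then show False using \<phi>(3) hf by (simp add: hom_part_id)
    qed
  qed
  then show False using kill pair[OF Q] \<psi>(3) by simp
qed

text \<open>
  Needed only to see that a function that vanishes on the nonzero vectors of a line vanishes at the origin.
\<close>

lemma coord_ring_radial_poly:
  assumes "F \<in> coord_ring n"
  shows "\<exists>p. \<forall>c. F (scale c v) = poly p c"
  using assms
proof (induction rule: coord_ring.induct)
  case (const c)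
  show ?case by (intro exI[of _ "[:c:]"]) simp
next
  case (coord i j)
  show ?case by (intro exI[of _ "[:0, cf i j v:]"]) (simp add: cf_def[symmetric])
next
  case (add F G)
  then obtain p q where "\<forall>c. F (scale c v) = poly p c" "\<forall>c. G (scale c v) = poly q c" by blast
  then show ?case by (intro exI[of _ "p + q"]) simp
next
  case (mult F G)
  then obtain p q where "\<forall>c. F (scale c v) = poly p c" "\<forall>c. G (scale c v) = poly q c" by blast
  then show ?case by (intro exI[of _ "p * q"]) simp
qed

lemma coord_ring_power: "F \<in> coord_ring n \<Longrightarrow> (\<lambda>f. F f ^ N) \<in> coord_ring n"
proof (induction N)
  case (Suc N)
  then show ?case using coord_ring.mult[of F n "\<lambda>f. F f ^ N"] by simp
qed (simp add: coord_ring.const)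

lemma coord_power_homogeneous:
  assumes "i + j = n"
  shows "(\<lambda>f. cf i j f ^ N) \<in> homogeneous n N"
proof -
  have "(\<lambda>f. cf i j f ^ N) \<in> coord_ring n"
    unfolding cf_def by (intro coord_ring_power coord_ring.coord assms)
  then show ?thesis by (simp add: homogeneous_def power_mult_distrib)
qed

lemma saturation_vanishing_ideal:
  assumes F: "F \<in> saturation n (vanishing_ideal n X)" and X: "X \<subseteq> proj_space (binary_forms n)"
  shows "F \<in> vanishing_ideal n X"
proof -
  have Fc: "F \<in> coord_ring n" using F by (simp add: saturation_def)
  obtain N where N: "\<And>G. G \<in> homogeneous n N \<Longrightarrow> (\<lambda>f. F f * G f) \<in> vanishing_ideal n X"
    using F unfolding saturation_def by blast
  have nz: "F v = 0" if v: "L \<in> X" "v \<in> L" "v \<noteq> 0" for L v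
  proof -
    have vf: "v \<in> binary_forms n" using v X by (auto simp: proj_space_def)
    \<comment> \<open>Multiply by a power of a coordinate that does not vanish at \<open>v\<close>.\<close>
    obtain i j where ij: "cf i j v \<noteq> 0" using v(3) bipoly_eqI[of v 0] by auto
    with vf have "i + j = n" by (auto simp: binary_forms_iff)
    then have "F v * cf i j v ^ N = 0"
      using N[OF coord_power_homogeneous] v(1,2) unfolding vanishing_ideal_def by blast
    then show ?thesis using ij by simp
  qed
  have "F v = 0" if L: "L \<in> X" and v: "v \<in> L" for L v
  proof (cases "v = 0")
    case True
    obtain w where w: "w \<in> L" "w \<noteq> 0" using proj_space_nonzero L X by blast
    have sub: "cvec.subspace L" using L X by (auto simp: proj_space_def)
    obtain p where p: "\<And>c. F (scale c w) = poly p c" using coord_ring_radial_poly[OF Fc] by blast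
    have "poly p c = 0" if "c \<noteq> 0" for c
      using nz[OF L cvec.subspace_scale[OF sub w(1), of c]] w(2) that p by simp
    then have "- {0} \<subseteq> {c. poly p c = 0}" by auto
    moreover have "infinite (- {0::complex})"
      using infinite_UNIV_char_0 by (metis Compl_partition finite.emptyI finite_Un finite_insert)
    ultimately have "p = 0" using poly_roots_finite finite_subset by blast
    then show ?thesis using p[of 0] True by simp
  qed (use nz L v in blast)
  then show ?thesis using Fc by (simp add: vanishing_ideal_def)
qed

text \<open>
  The converse inclusion: the elements of the coordinate ring whose restriction annihilates all \<open>g\<close> with
  the closure property of a prolongation form an ideal, and it contains the linear forms that vanish on \<open>T\<close>.
\<close>

lemma vanishing_ideal_pairing:
  assumes d: "d > 0" and T: "cvec.subspace T" "T \<subseteq> binary_forms d" "T \<noteq> {0}"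
    and F: "F \<in> vanishing_ideal d (proj_space T)" and Q: "restricts_to d F Q" and g: "g \<in> prolong d T j"
  shows "pairing Q g = 0"
proof -
  define K where "K F \<longleftrightarrow> F \<in> coord_ring d \<and>
    (\<forall>Q g. restricts_to d F Q \<longrightarrow> (\<forall>R. hom_part d (act R g) \<in> T) \<longrightarrow> pairing Q g = 0)" for F
  have "K F"
  proof (rule vanishing_ideal_generated[OF T F])
    fix F G assume KF: "K F" and KG: "K G"
    then have "F \<in> coord_ring d" "G \<in> coord_ring d" by (simp_all add: K_def)
    then obtain P Q where PQ: "restricts_to d F P" "restricts_to d G Q" using restricts_to_exists[of F d] restricts_to_exists[of G d] by blast
    show "K (\<lambda>f. F f + G f)"
      unfolding K_def
    proof (intro conjI allI impI)
      fix R g assume R: "restricts_to d (\<lambda>f. F f + G f) R" and g: "\<forall>R. hom_part d (act R g) \<in> T"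
      have "R = P + Q" by (rule restricts_to_unique[OF R restricts_to_add[OF PQ]])
      then show "pairing R g = 0"
        using KF KG PQ g unfolding K_def by (simp add: pairing_add_left)
    qed (use KF KG in \<open>simp add: K_def coord_ring.add\<close>)
  next
    fix F G assume KF: "K F" and G: "G \<in> coord_ring d"
    then have "F \<in> coord_ring d" by (simp add: K_def)
    then obtain P Q where PQ: "restricts_to d F P" "restricts_to d G Q" using G restricts_to_exists[of F d] restricts_to_exists[of G d] by blast
    show "K (\<lambda>f. F f * G f)"
      unfolding K_def
    proof (intro conjI allI impI)
      fix R g assume R: "restricts_to d (\<lambda>f. F f * G f) R" and g: "\<forall>R. hom_part d (act R g) \<in> T"
      have "R = P * Q" by (rule restricts_to_unique[OF R restricts_to_mult[OF PQ]])
      moreover have "\<forall>R. hom_part d (act R (act Q g)) \<in> T" using g by (simp add: act_mult[symmetric])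
      ultimately show "pairing R g = 0"
        using KF PQ(1) unfolding K_def by (simp add: pairing_mult)
    qed (use KF G in \<open>simp add: K_def coord_ring.mult\<close>)
  next
    fix \<phi> assume \<phi>: "linear_functional \<phi>" "\<And>x. x \<in> T \<Longrightarrow> \<phi> x = 0"
    show "K (\<lambda>f. \<phi> (hom_part d f))"
      unfolding K_def
    proof (intro conjI allI impI)
      fix R g assume R: "restricts_to d (\<lambda>f. \<phi> (hom_part d f)) R" and g: "\<forall>R. hom_part d (act R g) \<in> T"
      have "act 1 g = g" by (simp add: one_pCons)
      then have "hom_part d g \<in> T" using g by metis
      then show "pairing R g = 0"
        using functional_restricts_to(2)[OF \<phi>(1) R, of g] \<phi>(2) by simp
    qed (rule functional_in_coord_ring[OF \<phi>(1)])
  qed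
  then show ?thesis
    using Q hom_part_act_prolong[OF T(1,2) d g] unfolding K_def by blast
qed

section \<open>The core is the span of the curve section\<close>

context transversal
begin

text \<open>
  Suppose \<open>s\<close> is in the core but not in \<open>S'\<close>, and separate them by a linear form \<open>w\<close>. By assumption \<open>w G\<close> is in the
  ideal of the curve section for all \<open>G\<close> of some degree \<open>N\<close>. Choose \<open>G\<close> to restrict to the power of \<open>u + c v\<close>
  with exponent \<open>d N\<close>, which acts as \<open>dder c\<close> iterated, and write \<open>s\<close> as that operator applied to some \<open>g\<close> in the
  prolongation. Then \<open>w G\<close> has to annihilate \<open>g\<close>, whereas its pairing with \<open>g\<close> is \<open>d!\<close> times \<open>w\<close> at \<open>s\<close>.
\<close>

lemma core_minimal:
  assumes S': "contains_curve_section d T S'"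
  shows "core \<subseteq> S'"
proof (rule ccontr)
  assume "\<not> ?thesis"
  then obtain s where s: "s \<in> core" "s \<notin> S'" by blast
  have sub: "cvec.subspace S'" and forms: "S' \<subseteq> binary_forms d"
    and sat: "saturation d (vanishing_ideal d (proj_space S')) \<subseteq> saturation d (curve_section_ideal d T)"
    using S' by (simp_all add: contains_curve_section_def is_subscheme_def)
  have s0: "s \<noteq> 0" using s sub cvec.subspace_0 by blast
  have sT: "s \<in> T" using s core_subset by blast
  have T0: "T \<noteq> {0}" using s0 sT by blast
  obtain \<phi> where \<phi>: "linear_functional \<phi>" "\<And>x. x \<in> S' \<Longrightarrow> \<phi> x = 0" "\<phi> s = 1"
    by (rule functional_separates[OF sub s(2)]) blast
  let ?w = "\<lambda>f. \<phi> (hom_part d f)"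
  obtain R where R: "restricts_to d ?w R"
    using restricts_to_exists[OF functional_in_coord_ring[OF \<phi>(1)]] by blast
  have w: "?w \<in> vanishing_ideal d (proj_space S')"
    by (rule vanishing_ideal_linear[OF \<phi>(1,2) forms])
  then have "?w \<in> saturation d (vanishing_ideal d (proj_space S'))"
    unfolding saturation_def
    using vanishing_ideal_mult functional_in_coord_ring[OF \<phi>(1)]
    by (intro CollectI conjI exI[of _ 0] ballI) (auto simp: homogeneous_def)
  then have "?w \<in> saturation d (curve_section_ideal d T)" using sat by blast
  then obtain N where N: "\<And>G. G \<in> homogeneous d N \<Longrightarrow> (\<lambda>f. ?w f * G f) \<in> curve_section_ideal d T"
    unfolding saturation_def by blast
  obtain g where g: "g \<in> prolong d T (d * N)" "s = (dder c ^^ (d * N)) g"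
    using s(1) core_subset_image[of "d * N"] by blast
  let ?L = "lin_form 1 c"
  obtain \<eta> where \<eta>: "linear_functional \<eta>" "restricts_to d (\<lambda>f. \<eta> (hom_part d f)) (?L ^ d)"
    using restricts_to_by_functional[OF lin_form_power_in_forms] by blast
  let ?G = "\<lambda>f. \<eta> (hom_part d f) ^ N"
  have "?G \<in> coord_ring d"
    by (intro coord_ring_power functional_in_coord_ring \<eta>(1))
  then have Ghom: "?G \<in> homogeneous d N"
    unfolding homogeneous_def
    by (simp add: linear_functional_scale[OF \<eta>(1)] power_mult_distrib)
  have Grep: "restricts_to d ?G (?L ^ (d * N))"
    using \<eta>(2) by (simp add: restricts_to_def power_mult)
  obtain F1 F2 where F: "(\<lambda>f. ?w f * ?G f) = (\<lambda>f. F1 f + F2 f)" "F1 \<in> vanishing_ideal d (proj_space T)"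
    "F2 \<in> vanishing_ideal d (rational_normal_curve d)"
    by (rule section_ideal_memE[OF N[OF Ghom]])
  have "F2 (lin_form \<alpha> \<beta> ^ d) = 0" for \<alpha> \<beta>
    using F(3) curve_ideal_iff[OF d_pos, of F2] unfolding vanishing_ideal_def by blast
  then have "F1 (lin_form \<alpha> \<beta> ^ d) = ?w (lin_form \<alpha> \<beta> ^ d) * ?G (lin_form \<alpha> \<beta> ^ d)" for \<alpha> \<beta>
    using fun_cong[OF F(1), of "lin_form \<alpha> \<beta> ^ d"] by simp
  then have "restricts_to d F1 (R * ?L ^ (d * N))"
    using restricts_to_mult[OF R Grep] unfolding restricts_to_def by simp
  then have "pairing (R * ?L ^ (d * N)) g = 0"
    using vanishing_ideal_pairing[OF d_pos sub_T T_forms T0 F(2) _ g(1)] by blast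
  moreover have "act (?L ^ m) g = (dder c ^^ m) g" for m
  proof (induction m)
    case 0
    then show ?case by (simp add: one_pCons)
  next
    case (Suc m)
    have "act ?L h = dder c h" for h
      by (simp add: lin_form_def dder_def)
    then show ?case using Suc by (simp add: act_mult)
  qed
  ultimately have "pairing R s = 0" using g(2) by (simp add: pairing_mult)
  then have "\<phi> (hom_part d s) = 0" using functional_restricts_to(2)[OF \<phi>(1) R, of s] by simp
  moreover have "hom_part d s = s" using sT T_forms by (intro hom_part_id) auto
  ultimately show False using \<phi>(3) by simp
qed

text \<open>
  From some order on, \<open>T\<close> and its core have the same prolongations. So for a linear form \<open>w\<close> that vanishes on the core
  and \<open>G\<close> of large degree, \<open>w G\<close> restricts to a form that annihilates the prolongation of \<open>T\<close>, which
  puts it into the ideal of the curve section. If the core is zero, the same argument applies to \<open>G\<close> itself.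
\<close>

lemma core_contains_curve_section: "contains_curve_section d T core"
proof -
  let ?J = "curve_section_ideal d T"
  obtain J where J: "\<And>j. j \<ge> J \<Longrightarrow> prolong d core j = prolong d T j" using prolong_core_eventually by blast
  define N where "N = J"
  have dN: "prolong d core (d * N) = prolong d T (d * N)"
    using d_pos by (intro J) (simp add: N_def)
  have "saturation d (vanishing_ideal d (proj_space core)) \<subseteq> saturation d ?J"
  proof
    fix F assume Fs: "F \<in> saturation d (vanishing_ideal d (proj_space core))"
    then have Fc: "F \<in> coord_ring d" by (simp add: saturation_def)
    show "F \<in> saturation d ?J"
    proof (cases "core = {0}")
      case True
      have zero: "h = 0" if "h \<in> prolong d {0} j" for h j
        using that
      proof (induction j arbitrary: h)
        case (Suc j)
        then show ?case using constant_if_derivs_0[of h "d + j"] by simp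
      qed simp
      have "(\<lambda>f. F f * G f) \<in> ?J" if G: "G \<in> homogeneous d (Suc N)" for G
      proof -
        have Gc: "G \<in> coord_ring d" using G by (simp add: homogeneous_def)
        obtain Q where Q: "restricts_to d G Q" using restricts_to_exists[OF Gc] by blast
        have "Q \<in> binary_forms (d + d * N)" using homogeneous_restricts_to[OF G Q] by simp
        moreover have "pairing Q g = 0" if "g \<in> prolong d T (d * N)" for g
          using zero[of g "d * N"] that dN True by (simp add: pairing_def)
        ultimately obtain F1 where "F1 \<in> vanishing_ideal d (proj_space T)" "restricts_to d F1 Q"
          using form_kills_prolong_restricts_to[OF d_pos sub_T T_forms] by blast
        then have "G \<in> ?J" using section_idealI[OF d_pos Gc Q] by blast
        then have "(\<lambda>f. G f * F f) \<in> ?J" using Fc by (rule section_ideal_mult)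
        then show ?thesis by (simp add: mult.commute)
      qed
      then show ?thesis unfolding saturation_def using Fc by blast
    next
      case False
      have "F \<in> vanishing_ideal d (proj_space core)"
        by (rule saturation_vanishing_ideal[OF Fs]) (use core_forms in \<open>auto simp: proj_space_def\<close>)
      then have "\<forall>G\<in>homogeneous d N. (\<lambda>f. F f * G f) \<in> ?J"
      proof (rule vanishing_ideal_generated[OF subspace_core core_forms False])
        fix F F' assume *: "\<forall>G\<in>homogeneous d N. (\<lambda>f. F f * G f) \<in> ?J" "\<forall>G\<in>homogeneous d N. (\<lambda>f. F' f * G f) \<in> ?J"
        show "\<forall>G\<in>homogeneous d N. (\<lambda>f. (F f + F' f) * G f) \<in> ?J"
        proof
          fix G assume "G \<in> homogeneous d N"
          then have "(\<lambda>f. F f * G f + F' f * G f) \<in> ?J" using * section_ideal_add by blast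
          then show "(\<lambda>f. (F f + F' f) * G f) \<in> ?J" by (simp add: algebra_simps)
        qed
      next
        fix F H assume *: "\<forall>G\<in>homogeneous d N. (\<lambda>f. F f * G f) \<in> ?J" and H: "H \<in> coord_ring d"
        show "\<forall>G\<in>homogeneous d N. (\<lambda>f. (F f * H f) * G f) \<in> ?J"
        proof
          fix G assume "G \<in> homogeneous d N"
          then have "(\<lambda>f. (F f * G f) * H f) \<in> ?J" using * H section_ideal_mult by blast
          then show "(\<lambda>f. (F f * H f) * G f) \<in> ?J" by (simp add: mult_ac)
        qed
      next
        fix \<phi> assume \<phi>: "linear_functional \<phi>" "\<And>x. x \<in> core \<Longrightarrow> \<phi> x = 0"
        show "\<forall>G\<in>homogeneous d N. (\<lambda>f. \<phi> (hom_part d f) * G f) \<in> ?J"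
        proof
          fix G assume G: "G \<in> homogeneous d N"
          then have Gc: "G \<in> coord_ring d" by (simp add: homogeneous_def)
          obtain Q where Q: "restricts_to d G Q" using restricts_to_exists[OF Gc] by blast
          obtain R where R: "restricts_to d (\<lambda>f. \<phi> (hom_part d f)) R"
            using restricts_to_exists[OF functional_in_coord_ring[OF \<phi>(1)]] by blast
          have Qf: "Q \<in> binary_forms (d * N)" by (rule homogeneous_restricts_to[OF G Q])
          have RQ: "R * Q \<in> binary_forms (d + d * N)"
          proof (rule form_if_form_value_homogeneous)
            fix k \<alpha> \<beta>
            show "form_value (R * Q) (k * \<alpha>) (k * \<beta>) = k ^ (d + d * N) * form_value (R * Q) \<alpha> \<beta>"
              using form_value_homogeneous[OF functional_restricts_to(1)[OF \<phi>(1) R], of k \<alpha> \<beta>]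
                form_value_homogeneous[OF Qf, of k \<alpha> \<beta>]
              by (simp add: power_add mult_ac)
          qed
          have "pairing (R * Q) g = 0" if "g \<in> prolong d T (d * N)" for g
          proof -
            have gc: "g \<in> prolong d core (d * N)" using that dN by simp
            have "act Q g \<in> core"
              unfolding act_form[OF Qf]
            proof (intro cvec.subspace_sum cvec.subspace_scale subspace_core)
              fix j assume "j \<in> {..d * N}"
              then have "g \<in> prolong d core ((d * N - j) + j)" using gc by simp
              then show "(deriv_x ^^ (d * N - j)) ((deriv_y ^^ j) g) \<in> core" by (rule deriv_prolong)
            qed
            moreover from this have "hom_part d (act Q g) = act Q g"
              using core_forms by (intro hom_part_id) auto
            ultimately show ?thesis
              using functional_restricts_to(2)[OF \<phi>(1) R, of "act Q g"] \<phi>(2) by (simp add: pairing_mult)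
          qed
          then obtain F1 where F1: "F1 \<in> vanishing_ideal d (proj_space T)" "restricts_to d F1 (R * Q)"
            using form_kills_prolong_restricts_to[OF d_pos sub_T T_forms RQ] by blast
          have "(\<lambda>f. \<phi> (hom_part d f) * G f) \<in> coord_ring d"
            using Gc functional_in_coord_ring[OF \<phi>(1)] by (intro coord_ring.mult)
          then show "(\<lambda>f. \<phi> (hom_part d f) * G f) \<in> ?J"
            using section_idealI[OF d_pos _ restricts_to_mult[OF R Q] F1] by blast
        qed
      qed
      then show ?thesis unfolding saturation_def using Fc by blast
    qed
  qed
  then show ?thesis
    unfolding contains_curve_section_def is_subscheme_def using subspace_core core_forms by blast
qed

lemma section_span_eq_core: "section_span d T = core"
  unfolding section_span_def
  by (rule Least_equality) (rule core_contains_curve_section, rule core_minimal)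

end

section \<open>Direct sums of polar spaces\<close>

lemma indexed_independent:
  assumes "\<And>q. (\<Sum>t<N. scale (q t) (v t)) = 0 \<Longrightarrow> \<forall>t<N. q t = 0"
  shows "inj_on v {..<N::nat}" "cvec.independent (v ` {..<N})"
proof -
  show inj: "inj_on v {..<N}"
  proof (rule inj_onI, rule ccontr)
    fix a b assume ab: "a \<in> {..<N}" "b \<in> {..<N}" "v a = v b" "a \<noteq> b"
    let ?q = "\<lambda>t. (if t = a then 1 else 0) - (if t = b then 1 else (0::complex))"
    have "(\<Sum>t<N. scale (?q t) (v t)) = (\<Sum>t<N. if t = a then v a else 0) - (\<Sum>t<N. if t = b then v b else 0)"
      unfolding sum_subtractf[symmetric] by (intro sum.cong) (auto simp: cvec.scale_left_diff_distrib)
    also have "\<dots> = 0" using ab by simp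
    finally have "\<forall>t<N. ?q t = 0" by (rule assms)
    then show False using ab by force
  qed
  show "cvec.independent (v ` {..<N})"
  proof (rule cvec.independent_if_scalars_zero)
    fix h x assume h: "(\<Sum>x\<in>v ` {..<N}. scale (h x) x) = 0" and "x \<in> v ` {..<N}"
    then obtain t where t: "t < N" "x = v t" by blast
    have "(\<Sum>t<N. scale (h (v t)) (v t)) = 0"
      using h by (simp add: sum.reindex[OF inj])
    then show "h x = 0" using assms[of "\<lambda>t. h (v t)"] t by blast
  qed simp
qed

lemma comb_space_eq_span:
  "comb_space c n f = cvec.span ((\<lambda>t. (dder c ^^ t) ((deriv_y ^^ (n - 1 - t)) f)) ` {..<n})"
proof
  show "comb_space c n f \<subseteq> cvec.span ((\<lambda>t. (dder c ^^ t) ((deriv_y ^^ (n - 1 - t)) f)) ` {..<n})"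
  proof
    fix h assume "h \<in> comb_space c n f"
    then obtain q where h: "h = comb c n q f" by (auto simp: comb_space_def)
    show "h \<in> cvec.span ((\<lambda>t. (dder c ^^ t) ((deriv_y ^^ (n - 1 - t)) f)) ` {..<n})"
      unfolding h comb_def
      by (intro cvec.span_sum cvec.span_scale, rule cvec.span_base) blast
  qed
  have "(dder c ^^ t) ((deriv_y ^^ (n - 1 - t)) f) \<in> comb_space c n f" if "t < n" for t
  proof -
    have "comb c n (\<lambda>s. if s = t then 1 else 0) f = (\<Sum>s<n. if s = t then (dder c ^^ t) ((deriv_y ^^ (n - 1 - t)) f) else 0)"
      unfolding comb_def by (intro sum.cong) auto
    then have "comb c n (\<lambda>s. if s = t then 1 else 0) f = (dder c ^^ t) ((deriv_y ^^ (n - 1 - t)) f)"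
      using that by simp
    then show ?thesis unfolding comb_space_def by (metis rangeI)
  qed
  then show "cvec.span ((\<lambda>t. (dder c ^^ t) ((deriv_y ^^ (n - 1 - t)) f)) ` {..<n}) \<subseteq> comb_space c n f"
    by (intro cvec.span_minimal subspace_comb_space) auto
qed

definition comb_inj :: "complex \<Rightarrow> nat \<Rightarrow> bipoly \<Rightarrow> bool" where
  "comb_inj c n f \<longleftrightarrow> (\<forall>q. comb c n q f = 0 \<longrightarrow> (\<forall>t<n. q t = 0))"

lemma dim_comb_space:
  assumes "comb_inj c n f"
  shows "cvec.dim (comb_space c n f) = n"
proof -
  let ?v = "\<lambda>t. (dder c ^^ t) ((deriv_y ^^ (n - 1 - t)) f)"
  have *: "(\<Sum>t<n. scale (q t) (?v t)) = 0 \<Longrightarrow> \<forall>t<n. q t = 0" for q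
    using assms unfolding comb_inj_def comb_def by blast
  have "cvec.dim (comb_space c n f) = card (?v ` {..<n})"
    unfolding comb_space_eq_span by (rule cvec.dim_span_eq_card_independent[OF indexed_independent(2)[OF *]])
  then show ?thesis using card_image[OF indexed_independent(1)[OF *]] by simp
qed

lemma listset_map_iff:
  "xs \<in> listset (map G [0..<r]) \<longleftrightarrow> (\<exists>g. xs = map g [0..<r] \<and> (\<forall>i<r. g i \<in> G i))"
proof
  assume "xs \<in> listset (map G [0..<r])"
  then have len: "length xs = r" and x: "\<forall>i<r. xs ! i \<in> G i"
    by (auto simp: listset_iff list_all2_conv_all_nth)
  then have "xs = map (\<lambda>i. xs ! i) [0..<r]" by (intro nth_equalityI) auto
  then show "\<exists>g. xs = map g [0..<r] \<and> (\<forall>i<r. g i \<in> G i)" using x by blast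
qed (auto simp: listset_iff list_all2_conv_all_nth)

lemma sum_list_map_upt: "sum_list (map g [0..<r]) = (\<Sum>i<r. g i)"
  by (simp add: interv_sum_list_conv_sum_set_nat atLeast0LessThan)

lemma listset_Cons_map_iff:
  "xs \<in> listset (A # map G [0..<r]) \<longleftrightarrow> (\<exists>a\<in>A. \<exists>g. xs = a # map g [0..<r] \<and> (\<forall>i<r. g i \<in> G i))"
  using listset_map_iff[of _ G r] by (auto simp: set_Cons_def)

lemma is_direct_sum_level:
  assumes S: "cvec.subspace S" "S \<subseteq> T" and T: "cvec.subspace T"
    and f: "\<And>i. i < r \<Longrightarrow> f i \<in> prolong d T (n i)"
    and free: "free_mod d c S k r n f" and span: "spans_mod d c S T k r n f"
  shows "is_direct_sum (level d T k) (level d S k # map (\<lambda>i. comb_space c (n i + 2 - k) (f i)) [0..<r])"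
proof (rule is_direct_sumI)
  let ?G = "\<lambda>i. comb_space c (n i + 2 - k) (f i)"
  show "\<forall>V\<in>set (level d S k # map ?G [0..<r]). cvec.subspace V"
    using subspace_level[OF S(1)] subspace_comb_space by auto
  have choose: "\<exists>q. \<forall>i<r. g i = comb c (n i + 2 - k) (q i) (f i)" if "\<forall>i<r. g i \<in> ?G i" for g
  proof -
    have "\<forall>i. \<exists>q. i < r \<longrightarrow> g i = comb c (n i + 2 - k) q (f i)"
      using that by (auto simp: comb_space_def)
    then show ?thesis by metis
  qed
  show "level d T k = sum_list ` listset (level d S k # map ?G [0..<r])"
  proof (intro equalityI subsetI)
    fix v assume "v \<in> level d T k"
    then obtain s q where s: "s \<in> level d S k" "v = s + comb_sum c k r n f q"
      using span unfolding spans_mod_def by blast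
    have "s # map (\<lambda>i. comb c (n i + 2 - k) (q i) (f i)) [0..<r] \<in> listset (level d S k # map ?G [0..<r])"
      unfolding listset_Cons_map_iff comb_space_def using s(1) by blast
    moreover have "v = sum_list (s # map (\<lambda>i. comb c (n i + 2 - k) (q i) (f i)) [0..<r])"
      using s(2) by (simp add: sum_list_map_upt comb_sum_def)
    ultimately show "v \<in> sum_list ` listset (level d S k # map ?G [0..<r])" by blast
  next
    fix v assume "v \<in> sum_list ` listset (level d S k # map ?G [0..<r])"
    then obtain xs where xs: "xs \<in> listset (level d S k # map ?G [0..<r])" "v = sum_list xs" by blast
    obtain s g where "s \<in> level d S k" "xs = s # map g [0..<r]" "\<forall>i<r. g i \<in> ?G i"
      using xs(1) unfolding listset_Cons_map_iff by blast
    with xs(2) have s: "s \<in> level d S k" "v = sum_list (s # map g [0..<r])" "\<forall>i<r. g i \<in> ?G i" by simp_all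
    have "g i \<in> level d T k" if "i < r" for i
      using s(3) that comb_in_level[OF T f[OF that]] by (auto simp: comb_space_def)
    moreover have "s \<in> level d T k" using s(1) level_mono[OF S(2)] by blast
    ultimately show "v \<in> level d T k"
      unfolding s(2) sum_list.Cons sum_list_map_upt
      by (intro cvec.subspace_add cvec.subspace_sum subspace_level[OF T]) auto
  qed
  fix xs assume "xs \<in> listset (level d S k # map ?G [0..<r])" and 0: "sum_list xs = 0"
  then obtain s g where s: "s \<in> level d S k" "xs = s # map g [0..<r]" "\<forall>i<r. g i \<in> ?G i"
    unfolding listset_Cons_map_iff by blast
  obtain q where q: "\<forall>i<r. g i = comb c (n i + 2 - k) (q i) (f i)" using choose[OF s(3)] by blast
  then have "sum_list xs = s + comb_sum c k r n f q"
    unfolding s(2) by (simp add: sum_list_map_upt comb_sum_def)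
  then have eq: "comb_sum c k r n f q = - s" using 0 by (simp add: add_eq_0_iff)
  then have "comb_sum c k r n f q \<in> level d S k"
    using s(1) cvec.subspace_neg[OF subspace_level[OF S(1)]] by simp
  then have z: "\<forall>i<r. \<forall>t<n i + 2 - k. q i t = 0" using free unfolding free_mod_def by blast
  then have "g i = 0" if "i < r" for i using q that comb_eq_0 by simp
  moreover have "s = 0" using eq comb_sum_eq_0[of r n k q c f] z by simp
  ultimately show "set xs \<subseteq> {0}" unfolding s(2) by auto
qed

lemma free_mod_comb_inj:
  assumes "free_mod d c S k r n f" "cvec.subspace S" "i < r"
  shows "comb_inj c (n i + 2 - k) (f i)"
  unfolding comb_inj_def
proof (intro allI impI)
  fix q t assume q: "comb c (n i + 2 - k) q (f i) = 0" and t: "t < n i + 2 - k"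
  define p where "p = (\<lambda>j t. if j = i then q t else (0::complex))"
  have "comb c (n j + 2 - k) (p j) (f j) = 0" for j
  proof (cases "j = i")
    case True
    then show ?thesis using q by (simp add: p_def)
  next
    case False
    then show ?thesis by (intro comb_eq_0) (simp add: p_def)
  qed
  then have "comb_sum c k r n f p = 0" unfolding comb_sum_def by simp
  then have "comb_sum c k r n f p \<in> level d S k" using cvec.subspace_0[OF subspace_level[OF assms(2)]] by simp
  then have "p i t = 0" using assms(1,3) t unfolding free_mod_def by blast
  then show "q t = 0" by (simp add: p_def)
qed

lemma dim_level:
  assumes S: "cvec.subspace S" "S \<subseteq> T" and T: "cvec.subspace T" "T \<subseteq> binary_forms d" "d > 0"
    and f: "\<And>i. i < r \<Longrightarrow> f i \<in> prolong d T (n i)"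
    and free: "free_mod d c S k r n f" and span: "spans_mod d c S T k r n f"
  shows "cvec.dim (level d T k) = cvec.dim (level d S k) + (\<Sum>i<r. n i + 2 - k)"
proof -
  let ?Vs = "level d S k # map (\<lambda>i. comb_space c (n i + 2 - k) (f i)) [0..<r]"
  have "comb_space c (n i + 2 - k) (f i) \<subseteq> level d T k" if "i < r" for i
    using comb_in_level[OF T(1) f[OF that]] by (auto simp: comb_space_def)
  then have "\<forall>V\<in>set ?Vs. cvec.subspace V \<and> V \<subseteq> binary_forms (d - 1 + k)"
    using subspace_level[OF S(1)] subspace_comb_space level_mono[OF S(2), of d k] level_subset_forms[OF T(2,3), of k]
    by fastforce
  then have "cvec.dim (level d T k) = sum_list (map cvec.dim ?Vs)"
    using dim_direct_sum[OF is_direct_sum_level[OF S T(1) f free span]] by blast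
  also have "\<dots> = cvec.dim (level d S k) + (\<Sum>i<r. cvec.dim (comb_space c (n i + 2 - k) (f i)))"
    by (simp add: sum_list_map_upt o_def interv_sum_list_conv_sum_set_nat atLeast0LessThan)
  also have "(\<Sum>i<r. cvec.dim (comb_space c (n i + 2 - k) (f i))) = (\<Sum>i<r. n i + 2 - k)"
    using dim_comb_space[OF free_mod_comb_inj[OF free S(1)]] by (intro sum.cong) auto
  finally show ?thesis .
qed

text \<open>
  Level \<open>0\<close> consists of the derivatives of level \<open>1\<close>.
\<close>

lemma spans_mod_0:
  assumes S: "cvec.subspace S" and T: "cvec.subspace T" and span: "spans_mod d c S T (Suc 0) r n f"
  shows "spans_mod d c S T 0 r n f"
  unfolding spans_mod_def
proof
  fix v assume "v \<in> level d T 0"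
  then obtain w1 w2 where w: "w1 \<in> T" "w2 \<in> T" "v = dder c w1 + deriv_y w2"
    using deriv_space_eq_dder[OF T, of c] by auto
  obtain s1 q1 where s1: "s1 \<in> S" "w1 = s1 + comb_sum c (Suc 0) r n f q1"
    using span w(1) unfolding spans_mod_def by auto
  obtain s2 q2 where s2: "s2 \<in> S" "w2 = s2 + comb_sum c (Suc 0) r n f q2"
    using span w(2) unfolding spans_mod_def by auto
  have "dder c s1 + deriv_y s2 \<in> level d S 0"
    using s1(1) s2(1) deriv_space_eq_dder[OF S, of c] by auto
  moreover have "v = (dder c s1 + deriv_y s2) + comb_sum c 0 r n f (\<lambda>i t. (case t of 0 \<Rightarrow> 0 | Suc t' \<Rightarrow> q1 i t') +
        (if t < n i + 2 - Suc 0 then q2 i t else 0))"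
    unfolding comb_sum_add dder_comb_sum[symmetric] deriv_y_comb_sum[symmetric] w(3) s1(2) s2(2) by (simp add: algebra_simps)
  ultimately show "\<exists>s\<in>level d S 0. \<exists>q. v = s + comb_sum c 0 r n f q" by blast
qed

lemma prolong_if_polar:
  assumes "g \<in> binary_forms (d + n)" "polar_space n g \<subseteq> T"
  shows "g \<in> prolong d T n"
proof (rule prolongI[OF assms(1)])
  fix a b assume ab: "a + b = n"
  then have "(deriv_x ^^ (n - b)) ((deriv_y ^^ b) g) \<in> polar_space n g"
    unfolding polar_space_def by (intro cvec.span_base) auto
  then show "(deriv_x ^^ a) ((deriv_y ^^ b) g) \<in> T" using ab assms(2) by auto
qed

lemma summand_subset:
  fixes Vs :: "bipoly set list"
  assumes "\<forall>V\<in>set Vs. 0 \<in> V" "V \<in> set Vs"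
  shows "V \<subseteq> sum_list ` listset Vs"
proof
  fix v assume "v \<in> V"
  with assms show "v \<in> sum_list ` listset Vs"
  proof (induction Vs)
    case (Cons A Vs)
    show ?case
    proof (cases "V = A")
      case True
      have "replicate (length Vs) 0 \<in> listset Vs"
        using Cons.prems by (auto simp: listset_iff list_all2_conv_all_nth)
      then have "v # replicate (length Vs) 0 \<in> listset (A # Vs)"
        using True Cons.prems by (auto simp: set_Cons_def)
      moreover have "sum_list (replicate m (0::bipoly)) = 0" for m by (induction m) simp_all
      then have "v = sum_list (v # replicate (length Vs) 0)" by simp
      ultimately show ?thesis by blast
    next
      case False
      then obtain xs where xs: "xs \<in> listset Vs" "v = sum_list xs" using Cons by auto
      then have "0 # xs \<in> listset (A # Vs)" using Cons.prems by (auto simp: set_Cons_def)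
      moreover have "v = sum_list (0 # xs)" using xs by simp
      ultimately show ?thesis by blast
    qed
  qed simp
qed

section \<open>Uniqueness of the indices\<close>

text \<open>
  The first difference in \<open>j\<close> of these sums counts the entries that are at least \<open>j\<close>.
\<close>

lemma sum_truncated_determines:
  fixes xs ys :: "nat list"
  assumes "sorted_wrt (\<ge>) xs" "sorted_wrt (\<ge>) ys"
    and eq: "\<And>j. (\<Sum>x\<leftarrow>xs. x + 1 - j) = (\<Sum>y\<leftarrow>ys. y + 1 - j)"
  shows "xs = ys"
proof -
  define len where "len zs j = length (filter (\<lambda>z. j \<le> z) zs)" for j and zs :: "nat list"
  have step: "(\<Sum>z\<leftarrow>zs. z + 1 - j) = (\<Sum>z\<leftarrow>zs. z + 1 - Suc j) + len zs j" for j and zs :: "nat list"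
    by (induction zs) (auto simp: len_def)
  have "len xs j = len ys j" for j
    using step[where zs = xs and j = j] step[where zs = ys and j = j] eq[of j] eq[of "Suc j"] by simp
  moreover have "count (mset zs) j + len zs (Suc j) = len zs j" for j and zs :: "nat list"
    by (induction zs) (auto simp: len_def)
  ultimately have "count (mset xs) j = count (mset ys) j" for j
    by (metis add_right_cancel)
  then have "mset (rev xs) = mset (rev ys)" by (simp add: multiset_eq_iff)
  moreover have "sorted (rev xs)" "sorted (rev ys)"
    using assms(1,2) by (simp_all add: sorted_wrt_rev)
  ultimately have "rev xs = rev ys"
    by (metis properties_for_sort)
  then show ?thesis by simp
qed

context transversal
begin

text \<open>
  A decomposition as in the theorem, in coordinates: spanning is required for \<open>T\<close> and freeness for its derivative space.
  This suffices, because spanning passes to the derivative space and freeness to \<open>T\<close>.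
\<close>

definition generators :: "nat \<Rightarrow> (nat \<Rightarrow> nat) \<Rightarrow> (nat \<Rightarrow> bipoly) \<Rightarrow> bool" where
  "generators r n f \<longleftrightarrow> (\<forall>i<r. f i \<in> prolong d T (n i)) \<and> free_mod d c core 0 r n f \<and> spans_mod d c core T (Suc 0) r n f"

lemma generators_direct_sum:
  assumes "generators r n f"
  shows "is_direct_sum T (core # map (\<lambda>i. polar_space (n i) (f i)) [0..<r])"
    and "is_direct_sum (deriv_space T) (deriv_space core # map (\<lambda>i. polar_space (n i + 1) (f i)) [0..<r])"
proof -
  have g: "\<And>i. i < r \<Longrightarrow> f i \<in> prolong d T (n i)" "free_mod d c core 0 r n f" "spans_mod d c core T (Suc 0) r n f"
    using assms by (auto simp: generators_def)
  show "is_direct_sum T (core # map (\<lambda>i. polar_space (n i) (f i)) [0..<r])"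
    using is_direct_sum_level[OF subspace_core core_subset sub_T g(1) free_mod_Suc[OF g(2) subspace_core] g(3)]
    by (simp add: polar_space_eq_comb_space[of _ _ c])
  show "is_direct_sum (deriv_space T) (deriv_space core # map (\<lambda>i. polar_space (n i + 1) (f i)) [0..<r])"
    using is_direct_sum_level[OF subspace_core core_subset sub_T g(1) g(2) spans_mod_0[OF subspace_core sub_T g(3)]]
    by (simp add: polar_space_eq_comb_space[of _ _ c])
qed

lemma generators_dim_prolong:
  assumes "generators r n f"
  shows "cvec.dim (prolong d T j) = cvec.dim (prolong d core j) + (\<Sum>i<r. n i + 1 - j)"
proof -
  have g: "\<And>i. i < r \<Longrightarrow> f i \<in> prolong d T (n i)" "free_mod d c core 0 r n f" "spans_mod d c core T (Suc 0) r n f"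
    using assms by (auto simp: generators_def)
  show ?thesis
    using dim_level[OF subspace_core core_subset sub_T T_forms d_pos g(1) free_mod_level[OF g(2) subspace_core]
        spans_mod_level[OF subspace_core core_subset sub_T T_forms g(1) g(2) g(3)]]
    by simp
qed

lemma generators_dim_deriv_space:
  assumes "generators r n f"
  shows "cvec.dim (deriv_space T) = cvec.dim core + (\<Sum>i<r. n i + 2)"
proof -
  have g: "\<And>i. i < r \<Longrightarrow> f i \<in> prolong d T (n i)" "free_mod d c core 0 r n f" "spans_mod d c core T (Suc 0) r n f"
    using assms by (auto simp: generators_def)
  show ?thesis
    using dim_level[OF subspace_core core_subset sub_T T_forms d_pos g(1) g(2) spans_mod_0[OF subspace_core sub_T g(3)]]
    by (simp add: dim_deriv_space_core)
qed

lemma generators_defect: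
  assumes "generators r n f"
  shows "defect T = int r"
proof -
  have "(\<Sum>i<r. n i + 2) = (\<Sum>i<r. n i + 1) + r"
    by (induction r) simp_all
  then show ?thesis
    using generators_dim_prolong[OF assms, of 0] generators_dim_deriv_space[OF assms]
    by (simp add: defect_def)
qed

text \<open>
  The dimensions of the prolongations of \<open>T\<close> and of its core determine the indices.
\<close>

lemma generators_unique:
  assumes "generators r n f" "generators r' n' f'"
    and "sorted_wrt (\<ge>) (map n [0..<r])" "sorted_wrt (\<ge>) (map n' [0..<r'])"
  shows "map n [0..<r] = map n' [0..<r']"
proof (rule sum_truncated_determines[OF assms(3,4)])
  fix j
  have "(\<Sum>i<r. n i + 1 - j) = (\<Sum>i<r'. n' i + 1 - j)"
    using generators_dim_prolong[OF assms(1), of j] generators_dim_prolong[OF assms(2), of j] by simp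
  then show "(\<Sum>x\<leftarrow>map n [0..<r]. x + 1 - j) = (\<Sum>y\<leftarrow>map n' [0..<r']. y + 1 - j)"
    by (simp add: o_def interv_sum_list_conv_sum_set_nat atLeast0LessThan)
qed

text \<open>
  A relation among the derivatives of order \<open>m\<close> may be divided by \<open>u\<close>, which is injective, until it involves a pure power of \<open>v\<close>.
  That power is then a multiple of \<open>u\<close>, and so are its products with \<open>v\<close>.
\<close>

lemma dependent_comb:
  assumes f: "f \<in> prolong d T n"
  shows "m \<le> Suc n \<Longrightarrow> comb c (Suc m) q f = 0 \<Longrightarrow> \<exists>t\<le>m. q t \<noteq> 0 \<Longrightarrow> (deriv_y ^^ m) f \<in> dder c ` comb_space c m f"
proof (induction m arbitrary: q)
  case (Suc m)
  have eq: "scale (q 0) ((deriv_y ^^ Suc m) f) + dder c (comb c (Suc m) (\<lambda>t. q (Suc t)) f) = 0"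
    using Suc.prems(2) unfolding comb_Suc_first[of c "Suc m"] .
  show ?case
  proof (cases "q 0 = 0")
    case False
    then have "(deriv_y ^^ Suc m) f = scale (- 1 / q 0) (scale (- q 0) ((deriv_y ^^ Suc m) f))" by simp
    also have "scale (- q 0) ((deriv_y ^^ Suc m) f) = dder c (comb c (Suc m) (\<lambda>t. q (Suc t)) f)"
      unfolding cvec.scale_minus_left by (rule minus_unique[OF eq])
    finally have "(deriv_y ^^ Suc m) f = dder c (scale (- 1 / q 0) (comb c (Suc m) (\<lambda>t. q (Suc t)) f))" by simp
    moreover have "scale (- 1 / q 0) (comb c (Suc m) (\<lambda>t. q (Suc t)) f) \<in> comb_space c (Suc m) f"
      by (intro cvec.subspace_scale subspace_comb_space) (simp add: comb_space_def)
    ultimately show ?thesis by blast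
  next
    case True
    then have "dder c (comb c (Suc m) (\<lambda>t. q (Suc t)) f) = 0" using eq by simp
    moreover have "comb c (Suc m) (\<lambda>t. q (Suc t)) f \<in> prolong d T (n - m)"
    proof -
      have k: "n + 2 - Suc (n - m) = Suc m" using Suc.prems(1) by simp
      show ?thesis using comb_in_level[OF sub_T f, of c "Suc (n - m)"] unfolding k by simp
    qed
    ultimately have "comb c (Suc m) (\<lambda>t. q (Suc t)) f = 0" using dder_inj_prolong by blast
    moreover have "\<exists>t\<le>m. q (Suc t) \<noteq> 0"
    proof -
      obtain t where t: "t \<le> Suc m" "q t \<noteq> 0" using Suc.prems(3) by blast
      then show ?thesis using True by (cases t) auto
    qed
    ultimately have "(deriv_y ^^ m) f \<in> dder c ` comb_space c m f"
      using Suc.IH[of "\<lambda>t. q (Suc t)"] Suc.prems(1) by simp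
    then obtain p where p: "(deriv_y ^^ m) f = dder c (comb c m p f)" by (auto simp: comb_space_def)
    have "(deriv_y ^^ Suc m) f = dder c (deriv_y (comb c m p f))"
      using p by (simp add: dder_deriv_y)
    moreover have "deriv_y (comb c m p f) \<in> comb_space c (Suc m) f"
      using deriv_y_comb[of c "Suc m" 0 p f] by (simp add: comb_space_def)
    ultimately show ?thesis by blast
  qed
qed (simp add: comb_def comb_space_def)

text \<open>
  Unless \<open>f\<close> has as many independent derivatives of order \<open>n + 1\<close> as possible, \<open>u\<close> alone maps its polar space of
  order \<open>n\<close> onto that of order \<open>n + 1\<close>.
\<close>

lemma polar_dim_growth:
  assumes f: "f \<in> prolong d T n"
  shows "comb_inj c (n + 2) f \<and> cvec.dim (polar_space (n + 1) f) = cvec.dim (polar_space n f) + 1 \<or>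
    cvec.dim (polar_space (n + 1) f) \<le> cvec.dim (polar_space n f)"
proof (cases "comb_inj c (n + 2) f")
  case True
  have "comb_inj c (n + 1) f"
    unfolding comb_inj_def
  proof (intro allI impI)
    fix q t assume q: "comb c (n + 1) q f = 0" and t: "t < n + 1"
    have "comb c (n + 2) (\<lambda>t. case t of 0 \<Rightarrow> 0 | Suc s \<Rightarrow> q s) f = 0"
      using dder_comb[of c "n + 2" 0 q f] q by simp
    then have "(case Suc t of 0 \<Rightarrow> 0 | Suc s \<Rightarrow> q s) = 0"
      using True t unfolding comb_inj_def by (metis add_2_eq_Suc' Suc_eq_plus1 Suc_less_eq)
    then show "q t = 0" by simp
  qed
  then show ?thesis
    using True dim_comb_space by (simp add: polar_space_eq_comb_space[of _ _ c])
next
  case False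
  then obtain q t where q: "comb c (Suc (Suc n)) q f = 0" "t < Suc (Suc n)" "q t \<noteq> 0"
    unfolding comb_inj_def by auto
  then have dep: "(deriv_y ^^ Suc n) f \<in> dder c ` comb_space c (Suc n) f"
    using dependent_comb[OF f, of "Suc n" q] less_Suc_eq_le by blast
  have sub: "cvec.subspace (dder c ` comb_space c (Suc n) f)"
    by (rule endo.linear_subspace_image[OF linear_dder subspace_comb_space])
  have "comb_space c (Suc (Suc n)) f \<subseteq> dder c ` comb_space c (Suc n) f"
  proof
    fix h assume "h \<in> comb_space c (Suc (Suc n)) f"
    then obtain p where p: "h = comb c (Suc (Suc n)) p f" by (auto simp: comb_space_def)
    show "h \<in> dder c ` comb_space c (Suc n) f"
      unfolding p comb_Suc_first[of c "Suc n"]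
      by (intro cvec.subspace_add[OF sub] cvec.subspace_scale[OF sub] dep) (simp add: comb_space_def)
  qed
  moreover have T: "comb_space c (Suc n) f \<subseteq> T"
    using comb_in_level[OF sub_T f, of c "Suc 0"] by (auto simp: comb_space_def)
  moreover have "dder c ` T \<subseteq> binary_forms (d - 1)"
    using deriv_level(3)[OF sub_T, of _ d 0 c] level_forms[of 0] by fastforce
  ultimately have "cvec.dim (comb_space c (Suc (Suc n)) f) \<le> cvec.dim (dder c ` comb_space c (Suc n) f)"
    by (intro dim_mono[of _ _ "d - 1"] subspace_comb_space sub) auto
  also have "\<dots> = cvec.dim (comb_space c (Suc n) f)"
    using T T_forms dder_inj by (intro dim_image_inj[of _ d] subspace_comb_space linear_dder) auto
  finally show ?thesis by (simp add: polar_space_eq_comb_space[of _ _ c])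
qed

text \<open>
  Each of the \<open>r\<close> summands contributes at most \<open>1\<close> to \<open>defect T = r\<close>, hence exactly \<open>1\<close>, which makes each of them free.
  So freeness follows from the two direct sums alone.
\<close>

lemma generators_if_direct_sum:
  assumes f: "\<And>i. i < r \<Longrightarrow> f i \<in> binary_forms (d + n i)"
    and sumT: "is_direct_sum T (core # map (\<lambda>i. polar_space (n i) (f i)) [0..<r])"
    and sumD: "is_direct_sum (deriv_space T) (deriv_space core # map (\<lambda>i. polar_space (n i + 1) (f i)) [0..<r])"
    and r: "defect T = int r"
  shows "generators r n f"
proof -
  let ?P = "\<lambda>i. polar_space (n i) (f i)" and ?Q = "\<lambda>i. polar_space (n i + 1) (f i)"
  have subP: "cvec.subspace (polar_space m g)" for m g
    unfolding polar_space_def by simp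
  have subs: "\<forall>V\<in>set (core # map ?P [0..<r]). cvec.subspace V"
    "\<forall>V\<in>set (deriv_space core # map ?Q [0..<r]). cvec.subspace V"
    using subP subspace_core subspace_deriv_space[OF subspace_core] by auto
  have PT: "V \<subseteq> T" if "V \<in> set (core # map ?P [0..<r])" for V
  proof -
    have "\<forall>V\<in>set (core # map ?P [0..<r]). 0 \<in> V" using subs(1) cvec.subspace_0 by blast
    from summand_subset[OF this that] show ?thesis using is_direct_sum_image[OF sumT] by argo
  qed
  have QD: "V \<subseteq> deriv_space T" if "V \<in> set (deriv_space core # map ?Q [0..<r])" for V
  proof -
    have "\<forall>V\<in>set (deriv_space core # map ?Q [0..<r]). 0 \<in> V" using subs(2) cvec.subspace_0 by blast
    from summand_subset[OF this that] show ?thesis using is_direct_sum_image[OF sumD] by argo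
  qed
  have prolong: "f i \<in> prolong d T (n i)" if "i < r" for i
    using prolong_if_polar[OF f[OF that]] PT that by simp
  have "cvec.dim T = sum_list (map cvec.dim (core # map ?P [0..<r]))"
    using dim_direct_sum[OF sumT, of d] subs(1) PT T_forms by blast
  then have dimT: "cvec.dim T = cvec.dim core + (\<Sum>i<r. cvec.dim (?P i))"
    by (simp add: o_def interv_sum_list_conv_sum_set_nat atLeast0LessThan)
  have "deriv_space T \<subseteq> binary_forms (d - 1)" using level_forms[of 0] by simp
  then have "cvec.dim (deriv_space T) = sum_list (map cvec.dim (deriv_space core # map ?Q [0..<r]))"
    using dim_direct_sum[OF sumD, of "d - 1"] subs(2) QD by blast
  then have dimD: "cvec.dim (deriv_space T) = cvec.dim core + (\<Sum>i<r. cvec.dim (?Q i))"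
    by (simp add: o_def interv_sum_list_conv_sum_set_nat atLeast0LessThan dim_deriv_space_core)
  have le: "cvec.dim (?Q i) \<le> cvec.dim (?P i) + 1" if "i < r" for i
    using polar_dim_growth[OF prolong[OF that]] by auto
  have total: "(\<Sum>i<r. cvec.dim (?Q i)) = (\<Sum>i<r. cvec.dim (?P i) + 1)"
  proof -
    have "(\<Sum>i<r. cvec.dim (?P i) + 1) = (\<Sum>i<r. cvec.dim (?P i)) + r"
      by (induction r) simp_all
    moreover have "int (cvec.dim (deriv_space T)) = int (cvec.dim T) + int r"
      using r by (simp add: defect_def)
    ultimately show ?thesis using dimT dimD by linarith
  qed
  have eq: "cvec.dim (?Q i) = cvec.dim (?P i) + 1" if "i < r" for i
  proof (rule ccontr)
    assume "cvec.dim (?Q i) \<noteq> cvec.dim (?P i) + 1"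
    then have "cvec.dim (?Q i) < cvec.dim (?P i) + 1" using le[OF that] by simp
    then have "(\<Sum>i<r. cvec.dim (?Q i)) < (\<Sum>i<r. cvec.dim (?P i) + 1)"
      using that le by (intro sum_strict_mono_ex1) auto
    then show False using total by simp
  qed
  have inj: "comb_inj c (n i + 2) (f i)" if "i < r" for i
    using polar_dim_growth[OF prolong[OF that]] eq[OF that] by auto
  have "free_mod d c core 0 r n f"
    unfolding free_mod_def
  proof (intro allI impI)
    fix q i t assume q: "comb_sum c 0 r n f q \<in> level d core 0" and i: "i < r" and t: "t < n i + 2 - 0"
    let ?xs = "(- comb_sum c 0 r n f q) # map (\<lambda>i. comb c (n i + 2 - 0) (q i) (f i)) [0..<r]"
    have "- comb_sum c 0 r n f q \<in> deriv_space core"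
      using q cvec.subspace_neg[OF subspace_deriv_space[OF subspace_core]] by simp
    moreover have "comb c (n i + 2 - 0) (q i) (f i) \<in> ?Q i" for i
      by (simp add: polar_space_eq_comb_space[of _ _ c] comb_space_def)
    ultimately have "?xs \<in> listset (deriv_space core # map ?Q [0..<r])"
      unfolding listset_Cons_map_iff by blast
    moreover have "sum_list ?xs = 0" by (simp add: sum_list_map_upt comb_sum_def)
    ultimately have "set ?xs \<subseteq> {0}" by (rule is_direct_sumD[OF sumD subs(2)])
    then have "\<forall>x\<in>set ?xs. x = 0" by blast
    then have "comb c (n i + 2) (q i) (f i) = 0" using i by simp
    then show "q i t = 0" using inj[OF i] t unfolding comb_inj_def by simp
  qed
  moreover have "spans_mod d c core T (Suc 0) r n f"
    unfolding spans_mod_def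
  proof
    fix v assume "v \<in> level d T (Suc 0)"
    then have "v \<in> sum_list ` listset (core # map ?P [0..<r])" using is_direct_sum_image[OF sumT] by simp
    then obtain xs where xs: "xs \<in> listset (core # map ?P [0..<r])" "v = sum_list xs" by blast
    obtain s g where "s \<in> core" "xs = s # map g [0..<r]" "\<forall>i<r. g i \<in> ?P i"
      using xs(1) unfolding listset_Cons_map_iff by blast
    with xs(2) have s: "s \<in> core" "v = sum_list (s # map g [0..<r])" "\<forall>i<r. g i \<in> ?P i" by simp_all
    have "\<forall>i. \<exists>q. i < r \<longrightarrow> g i = comb c (n i + 2 - Suc 0) q (f i)"
      using s(3) by (auto simp: polar_space_eq_comb_space[of _ _ c] comb_space_def)
    then obtain q where "\<forall>i<r. g i = comb c (n i + 2 - Suc 0) (q i) (f i)" by metis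
    then have "v = s + comb_sum c (Suc 0) r n f q"
      unfolding s(2) sum_list.Cons sum_list_map_upt comb_sum_def by simp
    then show "\<exists>s\<in>level d core (Suc 0). \<exists>q. v = s + comb_sum c (Suc 0) r n f q" using s(1) by auto
  qed
  ultimately show ?thesis using prolong by (simp add: generators_def)
qed

end

section \<open>Forms outside the secant variety\<close>

text \<open>
  The determinant as an explicit polynomial in the entries, of which membership in the coordinate ring can be read off.
\<close>

definition minor :: "nat \<Rightarrow> (nat \<Rightarrow> nat \<Rightarrow> complex) \<Rightarrow> complex" where
  "minor N A = (\<Sum>p | p permutes {0..<N}. signof p * (\<Prod>i\<in>{0..<N}. A i (p i)))"

lemma minor_eq_det: "minor N A = det (mat N N (\<lambda>(i, j). A i j))"
  unfolding minor_def det_def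
  by (auto intro!: sum.cong prod.cong dest: permutes_in_image)

lemma minor_identity:
  assumes "\<And>i j. i < N \<Longrightarrow> j < N \<Longrightarrow> A i j = (if i = j then 1 else 0)"
  shows "minor N A = 1"
proof -
  have "mat N N (\<lambda>(i, j). A i j) = 1\<^sub>m N"
    by (rule eq_matI) (auto simp: assms)
  then show ?thesis by (simp add: minor_eq_det)
qed

lemma minor_low_rank:
  assumes "\<And>i j. i < N \<Longrightarrow> j < N \<Longrightarrow> A i j = (\<Sum>k<r. B i k * C k j)" "r < N"
  shows "minor N A = 0"
proof -
  define B' where "B' = mat N N (\<lambda>(i, k). if k < r then B i k else 0)"
  define C' where "C' = mat N N (\<lambda>(k, j). if k < r then C k j else 0)"
  have carrier: "B' \<in> carrier_mat N N" "C' \<in> carrier_mat N N" by (simp_all add: B'_def C'_def)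
  have "mat N N (\<lambda>(i, j). A i j) = B' * C'"
  proof (rule eq_matI)
    fix i j assume "i < dim_row (B' * C')" "j < dim_col (B' * C')"
    then have ij: "i < N" "j < N" by (simp_all add: B'_def C'_def)
    have "(B' * C') $$ (i, j) = (\<Sum>k = 0..<N. (if k < r then B i k else 0) * (if k < r then C k j else 0))"
      using ij by (simp add: B'_def C'_def scalar_prod_def)
    also have "\<dots> = (\<Sum>k<r. B i k * C k j)"
      using assms(2) by (intro sum.mono_neutral_cong_right) auto
    finally show "mat N N (\<lambda>(i, j). A i j) $$ (i, j) = (B' * C') $$ (i, j)"
      using ij assms(1) by simp
  qed (simp_all add: B'_def C'_def)
  moreover have "det C' = minor N (\<lambda>k j. if k < r then C k j else 0)"
    by (simp add: minor_eq_det C'_def)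
  moreover have "minor N (\<lambda>k j. if k < r then C k j else 0) = 0"
    unfolding minor_def using assms(2)
    by (intro sum.neutral ballI) (auto intro!: prod_zero bexI[of _ r])
  ultimately show ?thesis
    using det_mult[OF carrier] by (simp add: minor_eq_det)
qed

lemma minor_scale: "minor N (\<lambda>i j. k * A i j) = k ^ N * minor N A"
  by (simp add: minor_def prod.distrib sum_distrib_left mult_ac)

lemma minor_in_coord_ring:
  assumes "\<And>i j. (\<lambda>f. A f i j) \<in> coord_ring n"
  shows "(\<lambda>f. minor N (A f)) \<in> coord_ring n"
  unfolding minor_def
  by (intro coord_ring_sum coord_ring.mult coord_ring.const coord_ring_prod assms)

lemma dder_funpow_lin_form: "(dder c ^^ t) (lin_form \<alpha> \<beta> ^ (L + t)) = scale (fact (L + t) / fact L * (\<alpha> + c * \<beta>) ^ t) (lin_form \<alpha> \<beta> ^ L)"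
proof (induction t)
  case (Suc t)
  have "(dder c ^^ Suc t) (lin_form \<alpha> \<beta> ^ (L + Suc t)) = (dder c ^^ t) (dder c (lin_form \<alpha> \<beta> ^ Suc (L + t)))"
    by (simp only: funpow_Suc_right o_apply add_Suc_right)
  also have "\<dots> = scale (of_nat (Suc (L + t)) * (\<alpha> + c * \<beta>)) ((dder c ^^ t) (lin_form \<alpha> \<beta> ^ (L + t)))"
    unfolding dder_lin_form_power endo.linear_scale[OF linear_funpow[OF linear_dder]] ..
  also have "\<dots> = scale (fact (L + Suc t) / fact L * (\<alpha> + c * \<beta>) ^ Suc t) (lin_form \<alpha> \<beta> ^ L)"
    unfolding Suc cvec.scale_scale by (rule arg_cong[of _ _ "\<lambda>k. scale k _"]) (simp add: algebra_simps add_divide_distrib)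
  finally show ?case .
qed simp

lemma deriv_y_funpow_lin_form: "(deriv_y ^^ t) (lin_form \<alpha> \<beta> ^ (L + t)) = scale (fact (L + t) / fact L * \<beta> ^ t) (lin_form \<alpha> \<beta> ^ L)"
proof (induction t)
  case (Suc t)
  have "(deriv_y ^^ Suc t) (lin_form \<alpha> \<beta> ^ (L + Suc t)) = (deriv_y ^^ t) (deriv_y (lin_form \<alpha> \<beta> ^ Suc (L + t)))"
    by (simp only: funpow_Suc_right o_apply add_Suc_right)
  also have "\<dots> = scale (of_nat (Suc (L + t)) * \<beta>) ((deriv_y ^^ t) (lin_form \<alpha> \<beta> ^ (L + t)))"
    unfolding deriv_y_lin_form_power endo.linear_scale[OF linear_funpow[OF linear_deriv_y]] ..
  also have "\<dots> = scale (fact (L + Suc t) / fact L * \<beta> ^ Suc t) (lin_form \<alpha> \<beta> ^ L)"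
    unfolding Suc cvec.scale_scale by (rule arg_cong[of _ _ "\<lambda>k. scale k _"]) (simp add: algebra_simps add_divide_distrib)
  finally show ?case .
qed simp

lemma mixed_deriv_lin_form:
  "(dder c ^^ t) ((deriv_y ^^ s) (lin_form \<alpha> \<beta> ^ (L + t + s))) =
    scale (fact (L + t + s) / fact L * ((\<alpha> + c * \<beta>) ^ t * \<beta> ^ s)) (lin_form \<alpha> \<beta> ^ L)"
  unfolding deriv_y_funpow_lin_form endo.linear_scale[OF linear_funpow[OF linear_dder]] dder_funpow_lin_form cvec.scale_scale
  by simp

text \<open>
  Let \<open>A(g)\<close> be the matrix of the derivatives of order \<open>b + 1\<close> of \<open>g\<close>, as vectors, in the coordinates that are dual to
  those derivatives of \<open>f\<close>. Its determinant is a homogeneous polynomial in the coefficients of \<open>g\<close>, and it is \<open>1\<close> at \<open>f\<close>.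
  All derivatives of a power of a linear form are proportional to one lower power of it, so a power contributes a matrix of
  rank one, and the \<open>b + 2\<close> rowed determinant vanishes on sums of \<open>b + 1\<close> powers.
\<close>

lemma not_in_secant_variety:
  assumes d: "d > 0" and f: "f \<in> binary_forms (d + b)" and inj: "comb_inj c (b + 2) f"
  shows "proj_point f \<notin> secant_variety b (d + b)"
proof
  assume sec: "proj_point f \<in> secant_variety b (d + b)"
  define n where "n = d + b"
  define N where "N = b + 2"
  define D where "D t g = (dder c ^^ t) ((deriv_y ^^ (N - 1 - t)) g)" for t g
  have linD: "Vector_Spaces.linear scale scale (D t)" for t
    using linear_funpow[OF linear_dder, of t c] linear_funpow[OF linear_deriv_y, of "N - 1 - t"]
    by (simp add: linear_iff_cvec D_def)
  have *: "(\<Sum>t<N. scale (q t) (D t f)) = 0 \<Longrightarrow> \<forall>t<N. q t = 0" for q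
    using inj unfolding comb_inj_def comb_def D_def N_def by blast
  have injD: "inj_on (\<lambda>t. D t f) {..<N}" and indD: "cvec.independent ((\<lambda>t. D t f) ` {..<N})"
    by (rule indexed_independent(1), erule *, rule indexed_independent(2), erule *)
  have "\<forall>s. \<exists>\<phi>. linear_functional \<phi> \<and> (\<forall>x\<in>(\<lambda>t. D t f) ` {..<N}. \<phi> x = (if x = D s f then 1 else 0))"
    by (intro allI functional_on_basis indD)
  then obtain \<phi> where \<phi>: "\<And>s. linear_functional (\<phi> s)"
    "\<And>s. \<forall>x\<in>(\<lambda>t. D t f) ` {..<N}. \<phi> s x = (if x = D s f then 1 else 0)" by metis
  define A where "A g s t = \<phi> s (D t (hom_part n g))" for g s t
  have lin: "linear_functional (\<lambda>h. \<phi> s (D t h))" for s t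
    using linD[of t] \<phi>(1)[of s] by (simp add: linear_functional_def linear_iff_cvec)
  define F where "F g = minor N (A g)" for g
  have Fc: "F \<in> coord_ring n"
    unfolding F_def A_def by (intro minor_in_coord_ring functional_in_coord_ring lin)
  have A_scale: "A (scale k g) = (\<lambda>s t. k * A g s t)" for k g
    using lin unfolding A_def linear_functional_def by (intro ext) simp
  have F_scale: "F (scale k g) = k ^ N * F g" for k g
    unfolding F_def A_scale by (rule minor_scale)
  have Fhom: "F \<in> homogeneous n N"
    using Fc F_scale by (simp add: homogeneous_def)
  have "F f = 1"
    unfolding F_def
  proof (rule minor_identity)
    fix s t assume st: "s < N" "t < N"
    have "A f s t = \<phi> s (D t f)" using f by (simp add: A_def n_def hom_part_id)
    also have "\<dots> = (if D t f = D s f then 1 else 0)" using \<phi>(2)[of s] st by blast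
    also have "\<dots> = (if s = t then 1 else 0)" using injD st by (auto simp: inj_on_def)
    finally show "A f s t = (if s = t then 1 else 0)" .
  qed
  have zero: "F (\<Sum>i\<le>b. p i ^ n) = 0" if p: "\<forall>i\<le>b. proj_point (p i) \<in> proj_space (binary_forms 1)" for p
  proof -
    let ?\<alpha> = "\<lambda>i. cf 1 0 (p i)" and ?\<beta> = "\<lambda>i. cf 0 1 (p i)"
    have pi: "p i = lin_form (?\<alpha> i) (?\<beta> i)" if "i \<le> b" for i
      using p that proj_point_in_iff[OF subspace_binary_forms] form_1_eq_lin_form by blast
    have "(\<Sum>i\<le>b. p i ^ n) = (\<Sum>i\<le>b. lin_form (?\<alpha> i) (?\<beta> i) ^ n)"
      using pi by (intro sum.cong) simp_all
    also have "\<dots> = (\<Sum>i<b + 1. lin_form (?\<alpha> i) (?\<beta> i) ^ n)"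
      by (simp add: lessThan_Suc_atMost)
    finally have sum_eq: "(\<Sum>i\<le>b. p i ^ n) = (\<Sum>i<b + 1. lin_form (?\<alpha> i) (?\<beta> i) ^ n)" .
    have forms: "(\<Sum>i<b + 1. lin_form (?\<alpha> i) (?\<beta> i) ^ n) \<in> binary_forms n"
      by (intro cvec.subspace_sum subspace_binary_forms lin_form_power_in_forms)
    show ?thesis
      unfolding F_def sum_eq
    proof (rule minor_low_rank)
      fix s t assume st: "s < N" "t < N"
      have n: "n = (d - 1) + t + (N - 1 - t)" using st d by (simp add: n_def N_def)
      have "D t (lin_form a e ^ n) = scale (fact n / fact (d - 1) * ((a + c * e) ^ t * e ^ (N - 1 - t))) (lin_form a e ^ (d - 1))" for a e
        using mixed_deriv_lin_form[where c = c and t = t and s = "N - 1 - t" and \<alpha> = a and \<beta> = e and L = "d - 1"] unfolding D_def n[symmetric] .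
      then have "\<phi> s (D t (lin_form a e ^ n)) = \<phi> s (lin_form a e ^ (d - 1)) * (fact n / fact (d - 1) * ((a + c * e) ^ t * e ^ (N - 1 - t)))" for a e
        using linear_functional_scale[OF \<phi>(1)] by simp
      then show "A (\<Sum>i<b + 1. lin_form (?\<alpha> i) (?\<beta> i) ^ n) s t =
        (\<Sum>k<b + 1. \<phi> s (lin_form (?\<alpha> k) (?\<beta> k) ^ (d - 1)) *
          (fact n / fact (d - 1) * ((?\<alpha> k + c * ?\<beta> k) ^ t * ?\<beta> k ^ (N - 1 - t))))"
        unfolding A_def hom_part_id[OF forms] linear_functional_sum[OF lin] by simp
    qed (simp add: N_def)
  qed
  let ?X = "{proj_point (\<Sum>i\<le>b. p i ^ n) |p. (\<forall>i\<le>b. proj_point (p i) \<in> proj_space (binary_forms 1)) \<and>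
        inj_on (\<lambda>i. proj_point (p i)) {..b} \<and> (\<Sum>i\<le>b. p i ^ n) \<noteq> 0}"
  have vanish: "\<forall>M\<in>?X. \<forall>v\<in>M. F v = 0"
  proof (intro ballI)
    fix M v assume M: "M \<in> ?X" and v: "v \<in> M"
    then obtain p where p: "M = proj_point (\<Sum>i\<le>b. p i ^ n)" "\<forall>i\<le>b. proj_point (p i) \<in> proj_space (binary_forms 1)"
      by blast
    obtain k where "v = scale k (\<Sum>i\<le>b. p i ^ n)"
      using v p(1) by (auto simp: proj_point_def cvec.span_singleton)
    then show "F v = 0" using F_scale zero[OF p(2)] by simp
  qed
  have "\<forall>v\<in>proj_point f. F v = 0"
    using sec Fhom vanish unfolding secant_variety_def zariski_closure_def n_def[symmetric] by blast
  moreover have "f \<in> proj_point f" by (simp add: proj_point_def cvec.span_base)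
  ultimately show False using \<open>F f = 1\<close> by simp
qed

section \<open>Tuples\<close>

context transversal
begin

lemma generators_decomposes:
  assumes g: "generators r n f"
  shows "decomposes d T (map n [0..<r]) (map f [0..<r])"
  unfolding decomposes_def section_span_eq_core
proof (intro conjI allI impI)
  fix i assume "i < length (map n [0..<r])"
  then have i: "i < r" by simp
  have f: "f i \<in> prolong d T (n i)" and free: "free_mod d c core 0 r n f"
    using g i by (auto simp: generators_def)
  have forms: "f i \<in> binary_forms (d + n i)" using f prolong_forms by blast
  have inj: "comb_inj c (n i + 2) (f i)" using free_mod_comb_inj[OF free subspace_core i] by simp
  have "f i \<noteq> 0"
  proof
    assume "f i = 0"
    then have "comb c (n i + 2) (\<lambda>_. 1) (f i) = 0"
      unfolding comb_def
      by (simp add: endo.linear_0[OF linear_funpow[OF linear_dder]] endo.linear_0[OF linear_funpow[OF linear_deriv_y]])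
    then have "\<forall>t<n i + 2. (1::complex) = 0" using inj unfolding comb_inj_def by blast
    then show False by auto
  qed
  then have "proj_point (f i) \<in> proj_space (binary_forms (d + n i))"
    using forms proj_point_in_iff[OF subspace_binary_forms] by blast
  moreover have "proj_point (f i) \<notin> secant_variety (n i) (d + n i)"
    by (rule not_in_secant_variety[OF d_pos forms inj])
  ultimately show "proj_point (map f [0..<r] ! i) \<in> proj_space (binary_forms (d + map n [0..<r] ! i)) -
      secant_variety (map n [0..<r] ! i) (d + map n [0..<r] ! i)"
    using i by simp
next
  show "is_direct_sum T (core # map2 polar_space (map n [0..<r]) (map f [0..<r]))"
    using generators_direct_sum(1)[OF g] by (simp add: map2_map_map)
  show "is_direct_sum (deriv_space T) (deriv_space core # map2 (\<lambda>b. polar_space (b + 1)) (map n [0..<r]) (map f [0..<r]))"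
    using generators_direct_sum(2)[OF g] by (simp add: map2_map_map)
qed simp

text \<open>
  Tuples are the sorted index lists of generating families, so that their existence and uniqueness reduce to those of the families.
\<close>

lemma has_tuple_iff:
  "has_tuple d T (a, bs) \<longleftrightarrow> (\<exists>r n f. generators r n f \<and> sorted_wrt (\<ge>) (map n [0..<r]) \<and>
     bs = map int (map n [0..<r]) \<and> a = int (cvec.dim core) - 1)"
proof
  assume "has_tuple d T (a, bs)"
  then obtain ns fs where *: "a = int (cvec.dim core) - 1" "int (length bs) = defect T" "sorted_wrt (\<ge>) bs"
    "bs = map int ns" "decomposes d T ns fs"
    unfolding has_tuple_def section_span_eq_core by auto
  define r where "r = length ns"
  define n where "n i = ns ! i" for i
  define f where "f i = fs ! i" for i
  have len: "length fs = r" using *(5) by (simp add: decomposes_def r_def)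
  have ns: "ns = map n [0..<r]" by (rule nth_equalityI) (simp_all add: r_def n_def)
  have fs: "fs = map f [0..<r]" by (rule nth_equalityI) (simp_all add: len f_def)
  have dec: "\<And>i. i < r \<Longrightarrow> proj_point (f i) \<in> proj_space (binary_forms (d + n i))"
    "is_direct_sum T (core # map (\<lambda>i. polar_space (n i) (f i)) [0..<r])"
    "is_direct_sum (deriv_space T) (deriv_space core # map (\<lambda>i. polar_space (n i + 1) (f i)) [0..<r])"
    using *(5) unfolding decomposes_def section_span_eq_core ns fs by (simp_all add: map2_map_map)
  have "generators r n f"
  proof (rule generators_if_direct_sum[OF _ dec(2,3)])
    show "f i \<in> binary_forms (d + n i)" if "i < r" for i
      using dec(1)[OF that] proj_point_in_iff[OF subspace_binary_forms] by blast
    show "defect T = int r" using *(2,4) by (simp add: r_def)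
  qed
  moreover have "sorted_wrt (\<ge>) (map n [0..<r])"
    using *(3,4) unfolding ns by (simp add: sorted_wrt_map)
  ultimately show "\<exists>r n f. generators r n f \<and> sorted_wrt (\<ge>) (map n [0..<r]) \<and>
     bs = map int (map n [0..<r]) \<and> a = int (cvec.dim core) - 1"
    using *(1,4) ns by blast
next
  assume "\<exists>r n f. generators r n f \<and> sorted_wrt (\<ge>) (map n [0..<r]) \<and>
     bs = map int (map n [0..<r]) \<and> a = int (cvec.dim core) - 1"
  then obtain r n f where *: "generators r n f" "sorted_wrt (\<ge>) (map n [0..<r])"
     "bs = map int (map n [0..<r])" "a = int (cvec.dim core) - 1" by blast
  have "int (length bs) = defect T" using generators_defect[OF *(1)] *(3) by simp
  moreover have "sorted_wrt (\<ge>) bs" using *(2) unfolding *(3) by (simp add: sorted_wrt_map)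
  moreover have "bs = map int (map n [0..<r]) \<and> decomposes d T (map n [0..<r]) (map f [0..<r])"
    using *(3) generators_decomposes[OF *(1)] by blast
  ultimately show "has_tuple d T (a, bs)"
    unfolding has_tuple_def section_span_eq_core prod.case using *(4) by blast
qed

lemma sorted_generators_exist:
  "\<exists>r n f. generators r n f \<and> sorted_wrt (\<ge>) (map n [0..<r])"
proof -
  obtain r n f where *: "\<And>i. i < r \<Longrightarrow> f i \<in> prolong d T (n i)" "\<And>i j. i < j \<Longrightarrow> j < r \<Longrightarrow> n j \<le> n i"
    "free_mod d c core 0 r n f" "spans_mod d c core T (Suc 0) r n f"
    by (rule generators_exist) (rule that)
  have "generators r n f" using * by (simp add: generators_def)
  moreover have "sorted_wrt (\<ge>) (map n [0..<r])"
    using *(2) by (simp add: sorted_wrt_iff_nth_less)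
  ultimately show ?thesis by blast
qed

lemma tuple_unique: "\<exists>!t. has_tuple d T t"
proof -
  obtain r n f where g: "generators r n f" "sorted_wrt (\<ge>) (map n [0..<r])"
    using sorted_generators_exist by blast
  show ?thesis
  proof (rule ex1I)
    show "has_tuple d T (int (cvec.dim core) - 1, map int (map n [0..<r]))"
      unfolding has_tuple_iff using g by blast
    fix t assume t: "has_tuple d T t"
    obtain a bs where ab: "t = (a, bs)" by (cases t)
    obtain r' n' f' where g': "generators r' n' f'" "sorted_wrt (\<ge>) (map n' [0..<r'])"
      "bs = map int (map n' [0..<r'])" "a = int (cvec.dim core) - 1"
      using t unfolding ab has_tuple_iff by blast
    show "t = (int (cvec.dim core) - 1, map int (map n [0..<r]))"
      unfolding ab g'(3,4) generators_unique[OF g(1) g'(1) g(2) g'(2)] ..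
  qed
qed

text \<open>
  The sum is the dimension of the derivative space, which lives in the space of forms of degree \<open>d - 1\<close>.
\<close>

lemma tuple_bound:
  assumes "has_tuple d T (a, bs)"
  shows "a \<ge> -1" "\<forall>b\<in>set bs. b \<ge> 0" "a + 1 + (\<Sum>b\<leftarrow>bs. b + 2) \<le> int d"
proof -
  obtain r n f where g: "generators r n f" "bs = map int (map n [0..<r])" "a = int (cvec.dim core) - 1"
    using assms unfolding has_tuple_iff by blast
  show "a \<ge> -1" using g(3) by simp
  show "\<forall>b\<in>set bs. b \<ge> 0" using g(2) by simp
  have "cvec.dim (deriv_space T) \<le> Suc (d - 1)"
    using level_forms[of 0] by (intro dim_le_binary_forms) simp
  then have "cvec.dim core + (\<Sum>i<r. n i + 2) \<le> d"
    using generators_dim_deriv_space[OF g(1)] d_pos by simp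
  moreover have "(\<Sum>b\<leftarrow>bs. b + 2) = int (\<Sum>i<r. n i + 2)"
    unfolding g(2) by (simp add: o_def interv_sum_list_conv_sum_set_nat atLeast0LessThan sum.distrib)
  ultimately show "a + 1 + (\<Sum>b\<leftarrow>bs. b + 2) \<le> int d" using g(3) by linarith
qed

lemma structure_of_subspace:
  "let S = section_span d T; r = defect T in
          contains_curve_section d T S \<and>
          (\<forall>S'. contains_curve_section d T S' \<longrightarrow> S \<subseteq> S') \<and>
          S \<subseteq> T \<and>
          cvec.dim (deriv_space S) = cvec.dim S \<and>
          r \<ge> 0 \<and>
          ((r = 0 \<and> T = S) \<or>
           (r \<ge> 1 \<and> (\<exists>bs fs. int (length bs) = r \<and> decomposes d T bs fs))) \<and>
          (\<exists>!t. has_tuple d T t)"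
proof -
  obtain r n f where g: "generators r n f"
    using sorted_generators_exist by blast
  have defect: "defect T = int r" by (rule generators_defect[OF g])
  have "T = core" if "r = 0"
  proof -
    have "T = sum_list ` listset [core]"
      using is_direct_sum_image[OF generators_direct_sum(1)[OF g]] that by simp
    also have "\<dots> = core" by (force simp: set_Cons_def)
    finally show ?thesis .
  qed
  moreover have "int (length (map n [0..<r])) = defect T \<and> decomposes d T (map n [0..<r]) (map f [0..<r])"
    using defect generators_decomposes[OF g] by simp
  then have "\<exists>bs fs. int (length bs) = defect T \<and> decomposes d T bs fs" by blast
  ultimately have "(defect T = 0 \<and> T = core) \<or>
      (defect T \<ge> 1 \<and> (\<exists>bs fs. int (length bs) = defect T \<and> decomposes d T bs fs))"
    using defect by (cases "r = 0") auto
  then show ?thesis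
    unfolding Let_def section_span_eq_core
    using core_contains_curve_section core_minimal core_subset dim_deriv_space_core defect tuple_unique
    by (intro conjI allI impI) auto
qed

end

section \<open>Subspaces with prescribed tuple\<close>

text \<open>
  The linear form on \<open>S^m U\<close> that takes \<open>(x + \<beta> y)^m\<close> to \<open>p \<beta>\<close>, for \<open>p\<close> of degree at most \<open>m\<close>.
\<close>

definition moment :: "nat \<Rightarrow> complex poly \<Rightarrow> bipoly \<Rightarrow> complex" where
  "moment m p g = (\<Sum>j\<le>m. coeff p j / of_nat (m choose j) * cf (m - j) j g)"

lemma linear_functional_moment: "linear_functional (moment m p)"
  unfolding linear_functional_def moment_def
  by (simp add: algebra_simps sum.distrib sum_distrib_left)

lemma moment_lin_form_power:
  assumes "degree p \<le> m"
  shows "moment m p (lin_form 1 \<beta> ^ m) = poly p \<beta>"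
proof -
  have "moment m p (lin_form 1 \<beta> ^ m) = (\<Sum>j\<le>m. coeff p j * \<beta> ^ j)"
    unfolding moment_def by (intro sum.cong) (auto simp: cf_lin_form_power)
  also have "\<dots> = poly p \<beta>"
    unfolding poly_altdef using assms by (intro sum.mono_neutral_right) (auto simp: coeff_eq_0)
  finally show ?thesis .
qed

text \<open>
  Up to a factor, the Lagrange polynomial at \<open>k\<close> for the nodes \<open>0, ..., D - 1\<close>. The corresponding moment
  isolates one power in a combination of at most \<open>m + 1\<close> powers of distinct linear forms.
\<close>

definition sieve :: "nat \<Rightarrow> nat \<Rightarrow> complex poly" where
  "sieve D k = (\<Prod>l\<in>{..<D} - {k}. [:- of_nat l, 1:])"

lemma degree_sieve: "k < D \<Longrightarrow> D \<le> Suc m \<Longrightarrow> degree (sieve D k) \<le> m"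
proof -
  assume "k < D" "D \<le> Suc m"
  have "degree (sieve D k) \<le> (\<Sum>l\<in>{..<D} - {k}. degree [:- of_nat l, 1::complex:])"
    unfolding sieve_def
    using degree_prod_sum_le[of "{..<D} - {k}" "\<lambda>l. [:- of_nat l, 1::complex:]"] by (simp add: o_def)
  also have "\<dots> = D - 1" using \<open>k < D\<close> by simp
  finally show ?thesis using \<open>D \<le> Suc m\<close> by simp
qed

lemma poly_sieve: "l < D \<Longrightarrow> l \<noteq> k \<Longrightarrow> poly (sieve D k) (of_nat l) = 0"
  unfolding sieve_def poly_prod by (rule prod_zero) auto

lemma poly_sieve_nonzero: "poly (sieve D k) (of_nat k) \<noteq> 0"
  unfolding sieve_def poly_prod by auto

lemma comb_sum_right: "comb c n q (\<Sum>a\<in>A. F a) = (\<Sum>a\<in>A. comb c n q (F a))"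
  unfolding comb_def endo.linear_sum[OF linear_funpow[OF linear_deriv_y]]
    endo.linear_sum[OF linear_funpow[OF linear_dder]] cvec.scale_sum_right
  by (rule sum.swap)

lemma comb_lin_form_power:
  "comb c (Suc N) q (lin_form 1 \<beta> ^ (L + N)) =
    scale (fact (L + N) / fact L * (\<Sum>t<Suc N. q t * ((1 + c * \<beta>) ^ t * \<beta> ^ (N - t)))) (lin_form 1 \<beta> ^ L)"
proof -
  have "scale (q t) ((dder c ^^ t) ((deriv_y ^^ (Suc N - 1 - t)) (lin_form 1 \<beta> ^ (L + N)))) =
      scale (fact (L + N) / fact L * (q t * ((1 + c * \<beta>) ^ t * \<beta> ^ (N - t)))) (lin_form 1 \<beta> ^ L)" if "t < Suc N" for t
  proof -
    have e: "L + N = L + t + (N - t)" using that by simp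
    have "(dder c ^^ t) ((deriv_y ^^ (N - t)) (lin_form 1 \<beta> ^ (L + N))) =
        scale (fact (L + N) / fact L * ((1 + c * \<beta>) ^ t * \<beta> ^ (N - t))) (lin_form 1 \<beta> ^ L)"
      using mixed_deriv_lin_form[where c = c and t = t and s = "N - t" and \<alpha> = 1 and \<beta> = \<beta> and L = L]
      unfolding e[symmetric] .
    then show ?thesis by (simp add: mult_ac)
  qed
  then have "comb c (Suc N) q (lin_form 1 \<beta> ^ (L + N)) =
      (\<Sum>t<Suc N. scale (fact (L + N) / fact L * (q t * ((1 + c * \<beta>) ^ t * \<beta> ^ (N - t)))) (lin_form 1 \<beta> ^ L))"
    unfolding comb_def by (intro sum.cong) auto
  then show ?thesis
    unfolding sum_distrib_left cvec.scale_sum_left .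
qed

text \<open>
  A form of degree \<open>N\<close> in \<open>1 + c \<beta>\<close> and \<open>\<beta>\<close> is a polynomial in \<open>\<beta>\<close> of degree at most \<open>N\<close>, so \<open>N + 1\<close> zeros make it
  vanish; its coefficients are then read off successively at \<open>\<beta> = 0\<close>.
\<close>

lemma binary_form_zero:
  fixes q :: "nat \<Rightarrow> complex"
  assumes "finite B" "card B = Suc N"
    and "\<And>\<beta>. \<beta> \<in> B \<Longrightarrow> (\<Sum>t<Suc N. q t * ((1 + c * \<beta>) ^ t * \<beta> ^ (N - t))) = 0"
  shows "\<forall>t<Suc N. q t = 0"
proof -
  define P where "P N = (\<Sum>t<Suc N. Polynomial.smult (q t) ([:1, c:] ^ t * [:0, 1:] ^ (N - t)))" for N
  have poly_P: "poly (P N) \<beta> = (\<Sum>t<Suc N. q t * ((1 + c * \<beta>) ^ t * \<beta> ^ (N - t)))" for N \<beta>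
    by (simp add: P_def poly_sum mult_ac del: sum.lessThan_Suc)
  have deg: "degree (P N) \<le> N" for N
    unfolding P_def
  proof (rule degree_sum_le)
    fix t assume t: "t \<in> {..<Suc N}"
    have "degree (Polynomial.smult (q t) ([:1, c:] ^ t * [:0, 1:] ^ (N - t))) \<le> degree ([:1, c:] ^ t * [:0, 1:] ^ (N - t))"
      by (rule degree_smult_le)
    also have "\<dots> \<le> degree ([:1, c:] ^ t) + degree ([:0, 1::complex:] ^ (N - t))" by (rule degree_mult_le)
    also have "\<dots> \<le> 1 * t + 1 * (N - t)"
      by (intro add_mono order_trans[OF degree_power_le] mult_right_mono) (auto simp: degree_pCons_eq_if)
    finally show "degree (Polynomial.smult (q t) ([:1, c:] ^ t * [:0, 1:] ^ (N - t))) \<le> N" using t by simp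
  qed simp
  have "P N = 0"
  proof (rule ccontr)
    assume "P N \<noteq> 0"
    then have "card {x. poly (P N) x = 0} \<le> degree (P N)" "finite {x. poly (P N) x = 0}"
      by (simp_all add: card_poly_roots_bound poly_roots_finite)
    moreover have "B \<subseteq> {x. poly (P N) x = 0}" using assms(3) poly_P by auto
    ultimately have "Suc N \<le> N" using deg[of N] assms(2) card_mono by (metis order_trans)
    then show False by simp
  qed
  then show ?thesis
  proof (induction N)
    case 0
    then show ?case by (simp add: P_def)
  next
    case (Suc N)
    have "q t * ((1 + c * 0) ^ t * 0 ^ (Suc N - t)) = (if t = Suc N then q t else 0)" if "t < Suc (Suc N)" for t
      using that by (auto simp: zero_power)
    then have "poly (P (Suc N)) 0 = (\<Sum>t<Suc (Suc N). if t = Suc N then q t else 0)"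
      unfolding poly_P by (intro sum.cong) auto
    then have last: "q (Suc N) = 0" using Suc.prems by simp
    have "P (Suc N) = [:0, 1:] * P N"
    proof -
      have "Polynomial.smult (q t) ([:1, c:] ^ t * [:0, 1:] ^ (Suc N - t)) = [:0, 1:] * Polynomial.smult (q t) ([:1, c:] ^ t * [:0, 1:] ^ (N - t))"
        if "t < Suc N" for t
        using that by (simp only: Suc_diff_le less_Suc_eq_le power_Suc mult_smult_right mult.left_commute)
      then show ?thesis
        unfolding P_def sum.lessThan_Suc[of _ "Suc N"] last sum_distrib_left by (simp del: sum.lessThan_Suc)
    qed
    then have "P N = 0" using Suc.prems by simp
    then show ?case using Suc.IH last less_Suc_eq by auto
  qed
qed

lemma comb_sum_scale: "comb_sum c k r n f (\<lambda>i t. a * q i t) = scale a (comb_sum c k r n f q)"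
  unfolding comb_sum_def comb_scale cvec.scale_sum_right ..

text \<open>
  Take distinct linear forms \<open>z k = x + k y\<close>, at most \<open>d\<close> in number. The first \<open>e\<close> of their d-th powers span the core, and the
  next ones are distributed over consecutive blocks of \<open>n i + 2\<close> elements, the i-th starting at \<open>off i\<close>; the sum of the
  powers in a block is \<open>f i\<close>. Since at most \<open>d\<close> powers of degree \<open>d - 1\<close> are independent, a relation in the derivative space holds
  for each power separately. For the block of \<open>f i\<close> it says that a form of degree \<open>n i + 1\<close> has \<open>n i + 2\<close>
  zeros. So the family is free, and that \<open>S\<close> is the core follows from its prolongations.
\<close>

lemma prescribed_generators_exist:
  assumes d: "d > 0" and bound: "e + (\<Sum>i<r. n i + 2) \<le> d"
  shows "\<exists>T c f. transversal d T c \<and> T \<subset> binary_forms d \<and> cvec.dim (transversal.core d T c) = e \<and>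
    transversal.generators d T c r n f"
proof -
  define off where "off i = e + (\<Sum>j<i. n j + 2)" for i
  define z where "z k = lin_form 1 (of_nat k)" for k
  define f where "f i = (\<Sum>k<n i + 2. z (off i + k) ^ (d + n i))" for i
  define S where "S = cvec.span ((\<lambda>k. z k ^ d) ` {..<e})"
  \<comment> \<open>The constant 0 is as good as any other: a transversal one is only available once \<open>T\<close> is defined.\<close>
  define T where "T = {s + comb_sum 0 (Suc 0) r n f q |s q. s \<in> S}"
  have off_Suc: "off (Suc i) = off i + (n i + 2)" for i by (simp add: off_def)
  have off_mono: "i \<le> j \<Longrightarrow> off i \<le> off j" for i j
    by (rule lift_Suc_mono_le[of off]) (simp_all add: off_Suc)
  have off_d: "off r \<le> d" using bound by (simp add: off_def)
  have e_off: "e \<le> off i" for i by (simp add: off_def)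
  have off_bound: "off i + k < off r" if "i < r" "k < n i + 2" for i k
    using off_mono[of "Suc i" r] that by (simp add: off_Suc)
  have off_inj: "i = i' \<and> k = k'" if "off i + k = off i' + k'" "k < n i + 2" "k' < n i' + 2" for i i' k k'
  proof -
    have "i = i'"
    proof (rule linorder_cases[of i i'])
      assume "i < i'"
      then show ?thesis using off_mono[of "Suc i" i'] that by (simp add: off_Suc)
    next
      assume "i' < i"
      then show ?thesis using off_mono[of "Suc i'" i] that by (simp add: off_Suc)
    qed simp
    then show ?thesis using that by simp
  qed
  have subS: "cvec.subspace S" by (simp add: S_def)
  have zS: "z k ^ d \<in> S" if "k < e" for k
    unfolding S_def using that by (intro cvec.span_base) auto
  have z_forms: "z k ^ m \<in> binary_forms m" for k m by (simp add: z_def lin_form_power_in_forms)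
  have S_forms: "S \<subseteq> binary_forms d"
    unfolding S_def by (rule cvec.span_minimal) (use z_forms in auto)
  have ST: "S \<subseteq> T"
  proof
    fix s assume "s \<in> S"
    moreover have "s = s + comb_sum 0 (Suc 0) r n f (\<lambda>_ _. 0)" using comb_sum_eq_0 by simp
    ultimately show "s \<in> T" unfolding T_def by blast
  qed
  have subT: "cvec.subspace T"
  proof (rule cvec.subspaceI)
    show "0 \<in> T" using ST cvec.subspace_0[OF subS] by blast
  next
    fix x y assume "x \<in> T" "y \<in> T"
    then obtain s q s' q' where "s \<in> S" "s' \<in> S" "x = s + comb_sum 0 (Suc 0) r n f q" "y = s' + comb_sum 0 (Suc 0) r n f q'"
      unfolding T_def by blast
    then have "x + y = (s + s') + comb_sum 0 (Suc 0) r n f (\<lambda>i t. q i t + q' i t)" "s + s' \<in> S"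
      using cvec.subspace_add[OF subS] by (simp_all add: comb_sum_add algebra_simps)
    then show "x + y \<in> T" unfolding T_def by blast
  next
    fix a x assume "x \<in> T"
    then obtain s q where "s \<in> S" "x = s + comb_sum 0 (Suc 0) r n f q" unfolding T_def by blast
    then have "scale a x = scale a s + comb_sum 0 (Suc 0) r n f (\<lambda>i t. a * q i t)" "scale a s \<in> S"
      using cvec.subspace_scale[OF subS] by (simp_all add: comb_sum_scale cvec.scale_right_distrib)
    then show "scale a x \<in> T" unfolding T_def by blast
  qed
  have f_forms: "f i \<in> binary_forms (d + n i)" for i
    unfolding f_def using z_forms by (intro cvec.subspace_sum subspace_binary_forms)
  have T_forms: "T \<subseteq> binary_forms d"
  proof
    fix x assume "x \<in> T"
    then obtain s q where x: "s \<in> S" "x = s + comb_sum 0 (Suc 0) r n f q" unfolding T_def by blast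
    have "comb_sum 0 (Suc 0) r n f q \<in> level d (binary_forms d) (Suc 0)"
      using f_forms by (intro comb_sum_in_level subspace_binary_forms) (simp add: prolong_binary_forms)
    then show "x \<in> binary_forms d"
      using x S_forms by (auto intro!: cvec.subspace_add)
  qed
  have fT: "f i \<in> prolong d T (n i)" if i: "i < r" for i
  proof (rule prolong_if_polar[OF f_forms])
    show "polar_space (n i) (f i) \<subseteq> T"
    proof
      fix h assume "h \<in> polar_space (n i) (f i)"
      then obtain q where q: "h = comb 0 (Suc (n i)) q (f i)"
        by (auto simp: polar_space_eq_comb_space[of _ _ 0] comb_space_def)
      have "comb_sum 0 (Suc 0) r n f (\<lambda>j t. if j = i then q t else 0) = (\<Sum>j<r. if j = i then h else 0)"
        unfolding comb_sum_def q by (intro sum.cong) (auto intro!: comb_eq_0)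
      then have "h = 0 + comb_sum 0 (Suc 0) r n f (\<lambda>j t. if j = i then q t else 0)" using i by simp
      then show "h \<in> T" unfolding T_def using cvec.subspace_0[OF subS] by blast
    qed
  qed
  have free: "free_mod d c S 0 r n f" for c
    unfolding free_mod_def
  proof (intro allI impI)
    fix q i t assume q: "comb_sum c 0 r n f q \<in> level d S 0" and i: "i < r" and t: "t < n i + 2 - 0"
    define V where "V i \<beta> = (\<Sum>t<Suc (Suc (n i)). q i t * ((1 + c * \<beta>) ^ t * \<beta> ^ (Suc (n i) - t)))" for i \<beta>
    define K where "K i = (fact (d + n i) / fact (d - 1) :: complex)" for i
    have comb_z: "comb c (n i + 2) (q i) (z k ^ (d + n i)) = scale (K i * V i (of_nat k)) (z k ^ (d - 1))" for i k
      using comb_lin_form_power[of c "Suc (n i)" "q i" "of_nat k" "d - 1"] d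
      unfolding V_def K_def z_def by simp
    have V0: "V i (of_nat (off i + k)) = 0" if k: "k < n i + 2" for k
    proof -
      let ?k0 = "off i + k"
      \<comment> \<open>This moment sees only the power \<open>z (off i + k)\<close>, which occurs in block \<open>i\<close> alone.\<close>
      let ?p = "sieve (off r) ?k0"
      let ?M = "moment (d - 1) ?p"
      note lin = linear_functional_moment[of "d - 1" ?p]
      have k0: "?k0 < off r" using off_bound[OF i k] .
      have deg: "degree ?p \<le> d - 1" using degree_sieve[OF k0] off_d d by simp
      have Mz: "?M (z l ^ (d - 1)) = poly ?p (of_nat l)" for l
        unfolding z_def by (rule moment_lin_form_power[OF deg])
      have "cvec.span (deriv_x ` (\<lambda>k. z k ^ d) ` {..<e} \<union> deriv_y ` (\<lambda>k. z k ^ d) ` {..<e}) \<subseteq> {g. ?M g = 0}"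
      proof (rule cvec.span_minimal)
        obtain m where m: "d = Suc m" using d by (cases d) auto
        have "?M (deriv_x (z l ^ d)) = 0 \<and> ?M (deriv_y (z l ^ d)) = 0" if l: "l < e" for l
        proof -
          have "poly ?p (of_nat l) = 0"
            using l e_off[of i] e_off[of r] k0 by (intro poly_sieve) auto
          then have "?M (z l ^ m) = 0" using Mz[of l] m by simp
          then show ?thesis
            unfolding m z_def deriv_x_lin_form_power deriv_y_lin_form_power
            using linear_functional_scale[OF lin] m by (simp add: z_def del: power_Suc of_nat_Suc)
        qed
        then show "deriv_x ` (\<lambda>k. z k ^ d) ` {..<e} \<union> deriv_y ` (\<lambda>k. z k ^ d) ` {..<e} \<subseteq> {g. ?M g = 0}"
          by auto
        show "cvec.subspace {g. ?M g = 0}"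
          by (rule subspace_functional_kernel[OF lin])
      qed
      then have M0: "?M (comb_sum c 0 r n f q) = 0" using q by (auto simp: S_def deriv_space_span)
      have "?M (comb_sum c 0 r n f q) =
          (\<Sum>i'<r. \<Sum>k'<n i' + 2. K i' * V i' (of_nat (off i' + k')) * poly ?p (of_nat (off i' + k')))"
        unfolding comb_sum_def f_def comb_sum_right linear_functional_sum[OF lin]
        using comb_z linear_functional_scale[OF lin] Mz by simp
      also have "\<dots> = (\<Sum>i'<r. if i' = i then K i * V i (of_nat ?k0) * poly ?p (of_nat ?k0) else 0)"
      proof (rule sum.cong[OF refl])
        fix i' assume i': "i' \<in> {..<r}"
        have "K i' * V i' (of_nat (off i' + k')) * poly ?p (of_nat (off i' + k')) =
            (if i' = i \<and> k' = k then K i * V i (of_nat ?k0) * poly ?p (of_nat ?k0) else 0)" if k': "k' < n i' + 2" for k'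
        proof (cases "i' = i \<and> k' = k")
          case False
          then have "off i' + k' \<noteq> ?k0" using off_inj k k' by blast
          then have "poly ?p (of_nat (off i' + k')) = 0"
            using off_bound[of i' k'] i' k' by (intro poly_sieve) auto
          then show ?thesis using False by auto
        qed auto
        then have "(\<Sum>k'<n i' + 2. K i' * V i' (of_nat (off i' + k')) * poly ?p (of_nat (off i' + k'))) =
            (\<Sum>k'<n i' + 2. if k' = k then (if i' = i then K i * V i (of_nat ?k0) * poly ?p (of_nat ?k0) else 0) else 0)"
          by (intro sum.cong) auto
        also have "\<dots> = (if i' = i then K i * V i (of_nat ?k0) * poly ?p (of_nat ?k0) else 0)"
          using k by (subst sum.delta) auto
        finally show "(\<Sum>k'<n i' + 2. K i' * V i' (of_nat (off i' + k')) * poly ?p (of_nat (off i' + k'))) =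
            (if i' = i then K i * V i (of_nat ?k0) * poly ?p (of_nat ?k0) else 0)" .
      qed
      also have "\<dots> = K i * V i (of_nat ?k0) * poly ?p (of_nat ?k0)" using i by simp
      finally have "K i * V i (of_nat ?k0) * poly ?p (of_nat ?k0) = 0" using M0 by simp
      then show ?thesis using poly_sieve_nonzero[of "off r" ?k0] by (simp add: K_def del: of_nat_add)
    qed
    have "\<forall>t<Suc (Suc (n i)). q i t = 0"
    proof (rule binary_form_zero)
      show "finite ((\<lambda>k. of_nat (off i + k) :: complex) ` {..<n i + 2})" by simp
      have "inj_on (\<lambda>k. of_nat (off i + k) :: complex) {..<n i + 2}" by (auto simp: inj_on_def)
      then show "card ((\<lambda>k. of_nat (off i + k) :: complex) ` {..<n i + 2}) = Suc (Suc (n i))"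
        by (simp add: card_image)
      fix \<beta> assume "\<beta> \<in> (\<lambda>k. of_nat (off i + k) :: complex) ` {..<n i + 2}"
      then show "(\<Sum>t<Suc (Suc (n i)). q i t * ((1 + c * \<beta>) ^ t * \<beta> ^ (Suc (n i) - t))) = 0"
        using V0 unfolding V_def by blast
    qed
    then show "q i t = 0" using t by simp
  qed
  have spans: "spans_mod d c S T (Suc 0) r n f" for c
    unfolding spans_mod_def
  proof
    fix v assume "v \<in> level d T (Suc 0)"
    then obtain s q where v: "s \<in> S" "v = s + comb_sum 0 (Suc 0) r n f q" by (auto simp: T_def)
    have "\<forall>i. \<exists>q'. comb 0 (n i + 2 - Suc 0) (q i) (f i) = comb c (n i + 2 - Suc 0) q' (f i)"
    proof
      fix i
      have "comb 0 (n i + 2 - Suc 0) (q i) (f i) \<in> polar_space (n i) (f i)"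
        by (simp add: polar_space_eq_comb_space[of _ _ 0] comb_space_def)
      then show "\<exists>q'. comb 0 (n i + 2 - Suc 0) (q i) (f i) = comb c (n i + 2 - Suc 0) q' (f i)"
        by (auto simp: polar_space_eq_comb_space[of _ _ c] comb_space_def)
    qed
    then obtain q' where "\<forall>i. comb 0 (n i + 2 - Suc 0) (q i) (f i) = comb c (n i + 2 - Suc 0) (q' i) (f i)" by metis
    then have "comb_sum 0 (Suc 0) r n f q = comb_sum c (Suc 0) r n f q'" unfolding comb_sum_def by simp
    then show "\<exists>s\<in>level d S (Suc 0). \<exists>q. v = s + comb_sum c (Suc 0) r n f q" using v by auto
  qed
  have dimS: "cvec.dim S = e"
  proof -
    have *: "\<forall>k<e. a k = 0" if 0: "(\<Sum>k<e. scale (a k) (z k ^ d)) = 0" for a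
    proof (intro allI impI)
      fix k assume k: "k < e"
      let ?p = "sieve e k"
      have deg: "degree ?p \<le> d" using degree_sieve[OF k] e_off[of r] off_d by simp
      note lin = linear_functional_moment[of d ?p]
      have "moment d ?p (\<Sum>k<e. scale (a k) (z k ^ d)) = (\<Sum>l<e. a l * poly ?p (of_nat l))"
        unfolding linear_functional_sum[OF lin] linear_functional_scale[OF lin] z_def moment_lin_form_power[OF deg] ..
      also have "\<dots> = (\<Sum>l<e. if l = k then a k * poly ?p (of_nat k) else 0)"
        using poly_sieve by (intro sum.cong) auto
      also have "\<dots> = a k * poly ?p (of_nat k)" using k by simp
      finally have "a k * poly ?p (of_nat k) = 0" unfolding 0 linear_functional_0[OF lin] by simp
      then show "a k = 0" using poly_sieve_nonzero by simp
    qed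
    have "cvec.dim S = card ((\<lambda>k. z k ^ d) ` {..<e})"
      unfolding S_def by (intro cvec.dim_span_eq_card_independent indexed_independent(2)) (rule *)
    also have "\<dots> = e"
      by (subst card_image, rule indexed_independent(1)) (simp_all add: *)
    finally show ?thesis .
  qed
  have proper: "T \<subset> binary_forms d"
  proof -
    have "cvec.dim T = e + (\<Sum>i<r. n i + 1)"
      using dim_level[OF subS ST subT T_forms d fT free_mod_Suc[OF free[of 0] subS] spans] dimS by simp
    also have "(\<Sum>i<r. n i + 1) \<le> (\<Sum>i<r. n i + 2)" by (rule sum_mono) simp
    finally have "cvec.dim T \<le> d" using bound by simp
    then have "T \<noteq> binary_forms d" using dim_binary_forms[of d] by auto
    then show ?thesis using T_forms by blast
  qed
  obtain c where "transversal d T c" using transversal_exists[OF d subT proper] by blast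
  then interpret transversal d T c .
  \<comment> \<open>Beyond the largest index the generators no longer contribute, so \<open>T\<close> and \<open>S\<close> have the same prolongations of large order.\<close>
  have "core = S"
  proof
    define j where "j = Suc (\<Sum>i<r. n i)"
    have "prolong d T j \<subseteq> prolong d S j"
    proof
      fix v assume "v \<in> prolong d T j"
      then obtain s q where v: "s \<in> prolong d S j" "v = s + comb_sum c (Suc j) r n f q"
        using spans_mod_level[OF subS ST subT T_forms fT free[of c] spans[of c], where j = j] unfolding spans_mod_def by auto
      have "n i \<le> (\<Sum>i<r. n i)" if "i < r" for i
        using that by (intro member_le_sum) auto
      then have "comb_sum c (Suc j) r n f q = 0"
        by (intro comb_sum_eq_0) (fastforce simp: j_def)
      then show "v \<in> prolong d S j" using v by simp
    qed
    moreover have "(dder c ^^ j) g \<in> S" if "g \<in> prolong d S j" for g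
      using deriv_funpow_level(2)[OF subS, of g d 1 j c] that by simp
    ultimately show "core \<subseteq> S" using core_subset_image[of j] by blast
  next
    obtain J where J: "stable J" using stable_exists by blast
    have dder0: "dder 0 = deriv_x" by (rule ext) (simp add: dder_def)
    have "z k ^ d \<in> core" if k: "k < e" for k
    proof -
      have zT: "z k ^ d \<in> T" using zS[OF k] ST by blast
      \<comment> \<open>Otherwise \<open>dder c\<close> would kill the power \<open>z k ^ d\<close>, which lies in \<open>T\<close>.\<close>
      have ne: "1 + c * of_nat k \<noteq> 0"
      proof
        assume 0: "1 + c * of_nat k = 0"
        obtain m where m: "d = Suc m" using d by (cases d) auto
        have "dder c (z k ^ d) = 0" unfolding m z_def dder_lin_form_power 0 by simp
        then have "z k ^ d = 0" by (rule dder_inj[OF zT])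
        moreover have "cf d 0 (z k ^ d) = 1" unfolding z_def cf_lin_form_power by simp
        ultimately show False by (metis cf_0 zero_neq_one)
      qed
      have "z k ^ (d + J) \<in> prolong d T J"
      proof (rule prolongI[OF z_forms])
        fix a b assume "a + b = J"
        then have "d + J = d + a + b" by simp
        then have "(deriv_x ^^ a) ((deriv_y ^^ b) (z k ^ (d + J))) =
            scale (fact (d + a + b) / fact d * ((1 + 0 * of_nat k) ^ a * of_nat k ^ b)) (z k ^ d)"
          unfolding z_def dder0[symmetric] by (simp only: mixed_deriv_lin_form)
        then show "(deriv_x ^^ a) ((deriv_y ^^ b) (z k ^ (d + J))) \<in> T"
          using cvec.subspace_scale[OF subT zT] by simp
      qed
      then have "(dder c ^^ J) (z k ^ (d + J)) \<in> core" unfolding core_eq[OF J] by blast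
      then have "scale (fact (d + J) / fact d * (1 + c * of_nat k) ^ J) (z k ^ d) \<in> core"
        unfolding z_def dder_funpow_lin_form .
      then have "scale (1 / (fact (d + J) / fact d * (1 + c * of_nat k) ^ J))
          (scale (fact (d + J) / fact d * (1 + c * of_nat k) ^ J) (z k ^ d)) \<in> core"
        by (rule cvec.subspace_scale[OF subspace_core])
      then show ?thesis using ne by simp
    qed
    then show "S \<subseteq> core"
      unfolding S_def by (intro cvec.span_minimal subspace_core) auto
  qed
  moreover have "generators r n f"
    unfolding generators_def \<open>core = S\<close> using fT free spans by blast
  ultimately show ?thesis using \<open>transversal d T c\<close> proper dimS by metis
qed

section \<open>The structure theorem\<close>

theorem theorem1:
  fixes d :: nat
  assumes "d \<ge> 2"
  shows
    "(\<forall>T. cvec.subspace T \<and> T \<subset> binary_forms d \<longrightarrow>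
        (let S = section_span d T; r = defect T in
          contains_curve_section d T S \<and>
          (\<forall>S'. contains_curve_section d T S' \<longrightarrow> S \<subseteq> S') \<and>
          S \<subseteq> T \<and>
          cvec.dim (deriv_space S) = cvec.dim S \<and>
          r \<ge> 0 \<and>
          ((r = 0 \<and> T = S) \<or>
           (r \<ge> 1 \<and> (\<exists>bs fs. int (length bs) = r \<and> decomposes d T bs fs))) \<and>
          (\<exists>!t. has_tuple d T t))) \<and>
     (\<forall>(a :: int) (bs :: int list). sorted_wrt (\<ge>) bs \<longrightarrow>
        ((\<exists>T. cvec.subspace T \<and> T \<subset> binary_forms d \<and> has_tuple d T (a, bs)) \<longleftrightarrow>
         a \<ge> -1 \<and> (\<forall>b \<in> set bs. b \<ge> 0) \<and> a + 1 + (\<Sum>b\<leftarrow>bs. b + 2) \<le> int d))"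
proof (intro conjI allI impI, goal_cases)
  case (1 T)
  then obtain c where "transversal d T c" using transversal_exists[of d T] assms by auto
  then interpret transversal d T c .
  show ?case
    by (rule structure_of_subspace)
next
  case (2 a bs)
  then have sorted: "sorted_wrt (\<ge>) bs" .
  show ?case
  proof
    assume "\<exists>T. cvec.subspace T \<and> T \<subset> binary_forms d \<and> has_tuple d T (a, bs)"
    then obtain T where T: "cvec.subspace T" "T \<subset> binary_forms d" "has_tuple d T (a, bs)" by blast
    then obtain c where "transversal d T c" using transversal_exists[of d T] assms by auto
    then interpret transversal d T c .
    show "a \<ge> -1 \<and> (\<forall>b \<in> set bs. b \<ge> 0) \<and> a + 1 + (\<Sum>b\<leftarrow>bs. b + 2) \<le> int d"
      using tuple_bound[OF T(3)] by blast
  next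
    assume *: "a \<ge> -1 \<and> (\<forall>b \<in> set bs. b \<ge> 0) \<and> a + 1 + (\<Sum>b\<leftarrow>bs. b + 2) \<le> int d"
    define e where "e = nat (a + 1)"
    define n where "n i = nat (bs ! i)" for i
    define r where "r = length bs"
    have bs: "bs = map int (map n [0..<r])"
      using * by (intro nth_equalityI) (auto simp: r_def n_def)
    have sum: "(\<Sum>b\<leftarrow>bs. b + 2) = int (\<Sum>i<r. n i + 2)"
      by (subst bs) (simp add: o_def interv_sum_list_conv_sum_set_nat atLeast0LessThan sum.distrib)
    have "int e + int (\<Sum>i<r. n i + 2) \<le> int d" using * sum by (simp add: e_def)
    then have "e + (\<Sum>i<r. n i + 2) \<le> d" by linarith
    then obtain T c f where T: "transversal d T c" "T \<subset> binary_forms d" "cvec.dim (transversal.core d T c) = e"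
      "transversal.generators d T c r n f"
      using prescribed_generators_exist[where d = d and e = e and r = r and n = n] assms by auto
    interpret transversal d T c by (rule T(1))
    have "sorted_wrt (\<ge>) (map n [0..<r])"
      using sorted by (subst (asm) bs) (simp add: sorted_wrt_map)
    moreover have "a = int (cvec.dim core) - 1" using * T(3) by (simp add: e_def)
    ultimately have "has_tuple d T (a, bs)"
      unfolding has_tuple_iff using T(4) bs by blast
    then show "\<exists>T. cvec.subspace T \<and> T \<subset> binary_forms d \<and> has_tuple d T (a, bs)"
      using sub_T T(2) by blast
  qed
qed

end
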